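(* Let $F$ be a forest on $n$ vertices with $3\mid e(F)$ and without isolated vertices. Then \[ R(F,\mathbb{Z}_3)=\begin{cases} n+2, & \text{if $F$ is $1 \pmod 3$ regular or a star;}\\ n+1, & \text{if $F$ is not $1 \pmod 3$ regular and not a star, and either $3\nmid d(v)$ for every $v \in V(F)$, or $F$ has exactly one vertex of degree $\equiv 0 \pmod 3$ and all other vertices have degree $\equiv 1 \pmod 3$;}\\ n, & \text{otherwise.} \end{cases} \]
   Context: For a positive integer $k$ and a graph $G$ with $k\mid e(G)$, the zero-sum Ramsey number $R(G,\mathbb{Z}_k)$ is the least integer $N$ such that for every edge-coloring $\chi: E(K_N)\to\mathbb{Z}_k$ there is a subgraph of $K_N$ isomorphic to $G$ whose edge colors sum to $0$ in $\mathbb{Z}_k$. A graph is "$1 \pmod 3$ regular" if every vertex has degree congruent to $1$ modulo $3$. $d(v)$ denotes the degree of $v$ in $F$. A star is a graph $K_{1,m}$, $m\ge 1$. *)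

theory Defs
  imports Main
begin

type_synonym 'a ugraph = "'a set \<times> 'a set set"

abbreviation uverts :: "'a ugraph \<Rightarrow> 'a set" where "uverts G \<equiv> fst G"
abbreviation uedges :: "'a ugraph \<Rightarrow> 'a set set" where "uedges G \<equiv> snd G"

definition simple_graph :: "'a ugraph \<Rightarrow> bool" where
  "simple_graph G \<longleftrightarrow>
     finite (uverts G) \<and> (\<forall>e \<in> uedges G. e \<subseteq> uverts G \<and> card e = 2)"

definition deg :: "'a ugraph \<Rightarrow> 'a \<Rightarrow> nat" where
  "deg G v = card {e \<in> uedges G. v \<in> e}"

definition subgraph :: "'a ugraph \<Rightarrow> 'a ugraph \<Rightarrow> bool" where
  "subgraph H G \<longleftrightarrow>
     simple_graph H \<and> uverts H \<subseteq> uverts G \<and> uedges H \<subseteq> uedges G"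

definition isomorphic :: "'a ugraph \<Rightarrow> 'b ugraph \<Rightarrow> bool" where
  "isomorphic G H \<longleftrightarrow>
     (\<exists>f. bij_betw f (uverts G) (uverts H) \<and> uedges H = (\<lambda>e. f ` e) ` uedges G)"

definition complete_graph :: "nat \<Rightarrow> nat ugraph" where
  "complete_graph N = ({..<N}, {e. e \<subseteq> {..<N} \<and> card e = 2})"

text \<open>The star \<open>K\<^sub>1\<^sub>,\<^sub>m\<close>, with centre 0 and leaves 1, ..., \<open>m\<close>.\<close>
definition star_graph :: "nat \<Rightarrow> nat ugraph" where
  "star_graph m = ({0..m}, {{0, i} | i. i \<in> {1..m}})"

definition is_star :: "'a ugraph \<Rightarrow> bool" where
  "is_star G \<longleftrightarrow> (\<exists>m \<ge> 1. isomorphic (star_graph m) G)"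

text \<open>A cycle is given by the list of its vertices in cyclic order; the index
  is reduced modulo the length so that the closing edge is included.\<close>
definition cycle_in :: "'a ugraph \<Rightarrow> 'a list \<Rightarrow> bool" where
  "cycle_in G c \<longleftrightarrow>
     length c \<ge> 3 \<and> distinct c \<and> set c \<subseteq> uverts G \<and>
     (\<forall>i < length c. {c ! i, c ! (Suc i mod length c)} \<in> uedges G)"

definition forest :: "'a ugraph \<Rightarrow> bool" where
  "forest G \<longleftrightarrow> simple_graph G \<and> (\<nexists>c. cycle_in G c)"

definition one_mod_3_regular :: "'a ugraph \<Rightarrow> bool" where
  "one_mod_3_regular G \<longleftrightarrow> (\<forall>v \<in> uverts G. deg G v mod 3 = 1)"

text \<open>Elements of \<open>\<int>\<^sub>k\<close> are represented by their residues in \<open>{..<k}\<close>. Values of a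
  colouring outside the edge set of the complete graph are irrelevant.\<close>
definition zero_sum_arrows :: "nat \<Rightarrow> 'a ugraph \<Rightarrow> nat \<Rightarrow> bool" where
  "zero_sum_arrows N G k \<longleftrightarrow>
     (\<forall>\<chi> :: nat set \<Rightarrow> nat. (\<forall>e \<in> uedges (complete_graph N). \<chi> e \<in> {..<k}) \<longrightarrow>
        (\<exists>H. subgraph H (complete_graph N) \<and> isomorphic G H \<and>
             (\<Sum>e \<in> uedges H. \<chi> e) mod k = 0))"

text \<open>Meaningful when \<open>k\<close> is positive and divides the number of edges of \<open>G\<close>, which
  guarantees by Ramsey's theorem that some \<open>N\<close> has the required property.\<close>
definition zero_sum_ramsey :: "'a ugraph \<Rightarrow> nat \<Rightarrow> nat" where
  "zero_sum_ramsey G k = (LEAST N. zero_sum_arrows N G k)"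

end

theory Submission
  imports Defs "HOL-Combinatorics.Transposition"
begin

text \<open>
  For the upper bounds add isolated vertices to \<open>F\<close>, so that copies of \<open>F\<close> in \<open>K\<^sub>N\<close> become bijections
  \<open>\<phi>\<close> from the vertices of a spanning forest \<open>G\<close> to those of \<open>K\<^sub>N\<close>. If two transpositions of vertices
  of \<open>G\<close> do not interact and both change the colour sum, all residues modulo 3 occur; hence in a
  colouring without zero-sum copy, an active local change freezes the rest of \<open>G\<close>.

  If all alternating sums over 4-cycles vanish, the colouring has the form \<open>c x y = w x + w y\<close> and the
  colour sum is \<open>\<Sum> deg(x) w(\<phi> x)\<close>; a vertex of degree divisible by 3 and a second vertex of degree
  not congruent to 1 (possibly isolated) make it possible to reach 0. Otherwise put two leaves with
  distinct supports on a nonzero alternating 4-cycle \<open>a, u, b, v\<close>: exchanging the leaves is active, so all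
  other exchanges are idle, and comparing with the placement in which \<open>a\<close> and \<open>b\<close> are swapped shows
  that the rows \<open>c a\<close> and \<open>c b\<close> differ by a constant off the cycle. This forces
  \<open>c x y = w x + w y\<close> up to a single edge, where a zero-sum copy is found directly. The forests without
  a suitable pair of leaves are the path on four vertices and spiders with legs of length two.

  The lower bounds come from weights supported on one or two vertices and, for stars, from a Hamiltonian
  cycle.
\<close>

text \<open>The three values reflect how many vertices of degree divisible by 3, isolated ones
  included, the host leaves room for. One theorem about spanning forests serves the bounds
  \<open>n\<close> and \<open>n + 1\<close>: it needs a vertex \<open>f0\<close> with degree
  divisible by 3 and a second vertex \<open>fx\<close> whose degree is at least 2 and not 1 modulo
  3. In a host of size \<open>n + 1\<close> the added isolated vertex is \<open>f0\<close>; in a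
  host of size \<open>n\<close> both lie in the forest. If all degrees are 1 modulo 3 there is no
  \<open>fx\<close>, and if the forest is a star there are no two leaves with distinct supports;
  then two added isolated vertices are used, and the local changes exchange a leaf with an isolated
  vertex. There a copy on which the colouring is constant ends the argument, because 3 divides the
  number of edges. The obstacle in the main theorem is that the rows of the colouring can only be
  compared through a vertex adjacent to exactly one of the two supports. Forests where this fails
  are very rigid, and divisibility of the number of edges by 3 removes most of them.\<close>

section \<open>The field with three elements\<close>

datatype z3 = Z0 | Z1 | Z2

instantiation z3 :: field
begin
definition "0 = Z0"
definition "1 = Z1"
fun uminus_z3 where "- Z0 = Z0" | "- Z1 = Z2" | "- Z2 = Z1"
fun plus_z3 where "Z0 + y = y" | "Z1 + Z0 = Z1" | "Z1 + Z1 = Z2" | "Z1 + Z2 = Z0"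
  | "Z2 + Z0 = Z2" | "Z2 + Z1 = Z0" | "Z2 + Z2 = Z1"
fun times_z3 where "Z0 * y = Z0" | "Z1 * y = y" | "Z2 * y = - (y::z3)"
definition "x - y = x + - (y::z3)"
definition "inverse (x::z3) = x"
definition "x div y = x * inverse (y::z3)"
instance
proof
  fix a b c :: z3
  show "a * b * c = a * (b * c)" by (cases a; cases b; cases c; simp)
  show "a * b = b * a" by (cases a; cases b; simp)
  show "1 * a = a" by (simp add: one_z3_def)
  show "a + b + c = a + (b + c)" by (cases a; cases b; cases c; simp)
  show "a + b = b + a" by (cases a; cases b; simp)
  show "0 + a = a" by (simp add: zero_z3_def)
  show "- a + a = 0" by (cases a; simp add: zero_z3_def)
  show "a - b = a + - b" by (simp add: minus_z3_def)
  show "(a + b) * c = a * c + b * c" by (cases a; cases b; cases c; simp)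
  show "(0::z3) \<noteq> 1" by (simp add: zero_z3_def one_z3_def)
  show "a \<noteq> 0 \<Longrightarrow> inverse a * a = 1" by (cases a; simp add: inverse_z3_def zero_z3_def one_z3_def)
  show "a div b = a * inverse b" by (simp add: divide_z3_def)
  show "inverse (0::z3) = 0" by (simp add: inverse_z3_def)
qed
end

lemmas z3_defs = zero_z3_def one_z3_def minus_z3_def

lemma z3_numeral_3 [simp]: "(3::z3) = 0"
proof -
  have "(1::z3) + 1 + 1 = 0" by (simp add: z3_defs del: one_add_one)
  then show ?thesis by simp
qed

lemma of_nat_z3_eq_0_iff: "(of_nat k :: z3) = 0 \<longleftrightarrow> 3 dvd k"
proof -
  have "(1::z3) + 1 \<noteq> 0"
    by (simp add: z3_defs del: one_add_one)
  then have two: "(of_nat 2 :: z3) \<noteq> 0" and three: "(of_nat 3 :: z3) = 0"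
    by simp_all
  have "(of_nat k :: z3) = of_nat (k div 3 * 3 + k mod 3)"
    by (simp only: div_mult_mod_eq)
  also have "\<dots> = of_nat (k mod 3)"
    unfolding of_nat_add of_nat_mult three by simp
  finally have "(of_nat k :: z3) = of_nat (k mod 3)" .
  moreover have "k mod 3 = 0 \<or> k mod 3 = 1 \<or> k mod 3 = 2" by linarith
  ultimately show ?thesis
    using two unfolding dvd_eq_mod_eq_0 by (elim disjE) (simp_all del: of_nat_numeral)
qed

lemma of_nat_z3_eq_iff: "(of_nat k :: z3) = of_nat l \<longleftrightarrow> k mod 3 = l mod 3"
proof (induction k l rule: linorder_wlog)
  case (le a b)
  have "(of_nat a :: z3) = of_nat b \<longleftrightarrow> of_nat (b - a) = (0::z3)"
    using le by (auto simp: of_nat_diff)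
  then show ?case
    using mod_eq_dvd_iff_nat [OF le, of 3] unfolding of_nat_z3_eq_0_iff by auto
next
  case (sym a b) then show ?case by auto
qed

text \<open>Cauchy--Davenport for two sets of size two.\<close>
lemma z3_two_changes:
  fixes s \<alpha> \<beta> :: z3
  assumes "\<alpha> \<noteq> 0" "\<beta> \<noteq> 0"
  shows "s = 0 \<or> s + \<alpha> = 0 \<or> s + \<beta> = 0 \<or> s + \<alpha> + \<beta> = 0"
  using assms by (cases s; cases \<alpha>; cases \<beta>; simp add: z3_defs)

section \<open>Colourings of complete graphs\<close>

text \<open>\<open>a\<close> and \<open>b\<close> are opposite corners of the 4-cycle
  \<open>a, u, b, v\<close>. The value vanishes exactly when the rows \<open>c a\<close> and
  \<open>c b\<close> differ by the same amount in the columns \<open>u\<close> and \<open>v\<close>;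
  exchanging \<open>a\<close> and \<open>b\<close> only changes its sign.\<close>

definition alt :: "('v \<Rightarrow> 'v \<Rightarrow> z3) \<Rightarrow> 'v \<Rightarrow> 'v \<Rightarrow> 'v \<Rightarrow> 'v \<Rightarrow> z3" where
  "alt c a b u v = c a u + c b v - c a v - c b u"

text \<open>A triangle determines the weight of its corner \<open>a\<close>, the edges at
  \<open>a\<close> determine all other weights, and vanishing 4-cycle sums carry the formula to the
  remaining edges.\<close>

lemma weighted_if_alt_zero:
  fixes c :: "'v \<Rightarrow> 'v \<Rightarrow> z3"
  assumes sym: "\<And>x y. c x y = c y x"
    and V: "a \<in> V" "b \<in> V" "u \<in> V" "distinct [a, b, u]"
    and alt0: "\<And>a b u v. distinct [a, b, u, v] \<Longrightarrow> {a, b, u, v} \<subseteq> V \<Longrightarrow> alt c a b u v = 0"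
  shows "\<exists>w. \<forall>x\<in>V. \<forall>y\<in>V. x \<noteq> y \<longrightarrow> c x y = w x + w y"
proof -
  \<comment> \<open>The triangle \<open>a, b, u\<close> requires
    \<open>2 * w a = c a b + c a u - c b u\<close>, and dividing by 2 is negation in characteristic
    3.\<close>
  define wa where "wa = c b u - c a b - c a u"
  define w where "w x = (if x = a then wa else c x a - wa)" for x
  have four: "c x u = c x b + c a u - c a b" "c x b = c x a + c b u - c a u"
    if "x \<in> V" "x \<notin> {a, b, u}" for x
  proof -
    have "alt c x a u b = 0" "alt c x u a b = 0"
      using V that by (intro alt0; auto)+
    then show "c x u = c x b + c a u - c a b" "c x b = c x a + c b u - c a u"
      using sym[of u a] sym[of u b] unfolding alt_def by algebra+
  qed
  \<comment> \<open>This is \<open>w x + w y\<close> for \<open>w x = c x a - wa\<close>, since -2 =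
    1.\<close>
  have two: "c x y = c x a + c y a + wa" if xy: "x \<in> V" "y \<in> V" "x \<noteq> y" "x \<noteq> a" "y \<noteq> a" for x y
  proof -
    consider "x = b" "y = u" | "x = u" "y = b" | "x \<in> {b, u}" "y \<notin> {a, b, u}"
      | "y \<in> {b, u}" "x \<notin> {a, b, u}" | "x \<notin> {a, b, u}" "y \<notin> {a, b, u}"
      using xy by (cases "x \<in> {b, u}"; cases "y \<in> {b, u}") auto
    then show ?thesis
    proof cases
      case 1 then show ?thesis using sym[of u a] sym[of b a] unfolding wa_def by simp
    next
      case 2 then show ?thesis using sym[of u a] sym[of b a] sym[of u b] unfolding wa_def by simp
    next
      case 3 then show ?thesis
        using four[of y] that sym[of u a] sym[of b a] sym[of x y] unfolding wa_def by auto
    next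
      case 4 then show ?thesis
        using four[of x] that sym[of u a] sym[of b a] sym[of x y] unfolding wa_def by auto
    next
      case 5
      have "alt c x b y a = 0"
        using V that 5 by (intro alt0) auto
      moreover have "c y b = c y a + c b u - c a u" using four(2)[of y] xy 5 by blast
      ultimately show ?thesis
        using sym[of y b] sym[of b a] unfolding wa_def alt_def by algebra
    qed
  qed
  have "c x y = w x + w y" if "x \<in> V" "y \<in> V" "x \<noteq> y" for x y
  proof (cases "x = a \<or> y = a")
    case True
    then show ?thesis using that sym[of a y] by (auto simp: w_def)
  next
    case False
    then have "c x y = c x a + c y a + wa" using two that by blast
    also have "\<dots> = w x + w y" using False
      by (simp add: w_def algebra_simps)
    finally show ?thesis .
  qed
  then show ?thesis by blast
qed

section \<open>Colourings with parallel rows\<close>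

definition weighted_but_one_edge :: "'v set \<Rightarrow> ('v \<Rightarrow> 'v \<Rightarrow> z3) \<Rightarrow> bool" where
  "weighted_but_one_edge V c \<longleftrightarrow>
     (\<exists>w a b \<epsilon>. a \<in> V \<and> b \<in> V \<and> a \<noteq> b \<and> \<epsilon> \<noteq> 0 \<and>
       (\<forall>x\<in>V. \<forall>y\<in>V. x \<noteq> y \<longrightarrow> c x y = w x + w y + (if {x, y} = {a, b} then \<epsilon> else 0)))"

text \<open>The three perfect matchings of the four points do not all have the same colour sum. For
  symmetric \<open>c\<close> this says that one of the three 4-cycles on the points has nonzero
  alternating sum; unlike \<open>alt\<close>, the notion does not single out opposite
  corners.\<close>

definition unbalanced :: "('v \<Rightarrow> 'v \<Rightarrow> z3) \<Rightarrow> 'v \<Rightarrow> 'v \<Rightarrow> 'v \<Rightarrow> 'v \<Rightarrow> bool" where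
  "unbalanced c a b u v \<longleftrightarrow>
     \<not> (c a b + c u v = c a u + c b v \<and> c a u + c b v = c a v + c b u)"

lemma ex_not_in_list:
  assumes "finite V" "length xs < card V"
  obtains x where "x \<in> V" "x \<notin> set xs"
proof -
  have "\<not> V \<subseteq> set xs"
    using assms card_mono[of "set xs" V] card_length[of xs] by fastforce
  then show ?thesis using that by blast
qed

text \<open>This isolates what rigidity says about the colouring alone: a nonzero 4-cycle makes the
  rows of two opposite corners differ by a constant off the cycle. Six points are needed to compare
  two columns \<open>r\<close> and \<open>s\<close> there.\<close>

locale parallel_rows =
  fixes V :: "'v set" and c :: "'v \<Rightarrow> 'v \<Rightarrow> z3"
  assumes finV: "finite V" and card6: "card V \<ge> 6"
    and sym: "\<And>x y. c x y = c y x"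
    and parallel: "\<And>a b u v r s. distinct [a, b, u, v, r, s] \<Longrightarrow> {a, b, u, v, r, s} \<subseteq> V \<Longrightarrow>
      alt c a b u v \<noteq> 0 \<Longrightarrow> c a r - c a s = c b r - c b s"
begin

text \<open>If the 4-cycle with opposite corners \<open>a, b\<close> has sum 0, then the other two
  have nonzero sums, so row \<open>a\<close> is parallel to row \<open>u\<close> and row
  \<open>u\<close> to row \<open>b\<close>.\<close>

lemma unbalanced_parallel:
  assumes "distinct [a, b, u, v, r, s]" "{a, b, u, v, r, s} \<subseteq> V" "unbalanced c a b u v"
  shows "c a r - c a s = c b r - c b s"
proof (cases "alt c a b u v = 0")
  case False
  then show ?thesis using parallel[OF assms(1,2)] by blast
next
  case True
  then have eq: "c a u + c b v = c a v + c b u" unfolding alt_def by algebra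
  then have ne: "c a b + c u v \<noteq> c a u + c b v"
    using assms(3) unfolding unbalanced_def by blast
  have "c a b + c u v = c a u + c b v" if "alt c a u b v = 0"
    using that eq sym[of u b] unfolding alt_def by algebra
  moreover have "c a b + c u v = c a u + c b v" if "alt c u b a v = 0"
    using that sym[of u a] sym[of b a] unfolding alt_def by algebra
  ultimately have alts: "alt c a u b v \<noteq> 0" "alt c u b a v \<noteq> 0"
    using ne by blast+
  have "distinct [a, u, b, v, r, s]" "{a, u, b, v, r, s} \<subseteq> V"
    using assms(1,2) by auto
  from parallel[OF this alts(1)] have "c a r - c a s = c u r - c u s" .
  also have "distinct [u, b, a, v, r, s]" "{u, b, a, v, r, s} \<subseteq> V"
    using assms(1,2) by auto
  from parallel[OF this alts(2)] have "c u r - c u s = c b r - c b s" .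
  finally show ?thesis .
qed

text \<open>The three transpositions generate all permutations of the four points.\<close>

lemma unbalanced_perm:
  assumes "unbalanced c a b u v"
  shows "unbalanced c b a u v" "unbalanced c a u b v" "unbalanced c a b v u"
  using assms unfolding unbalanced_def
  by (auto simp: sym[of b a] sym[of v u] sym[of u b] add.commute)

text \<open>Unbalancedness of \<open>a, b, u, v\<close> makes these four rows parallel off the
  quadruple. Then whether \<open>a, b, u, s\<close> is unbalanced no longer depends on the outer
  point \<open>s\<close>, so \<open>r\<close> spreads it to all \<open>s\<close>; letting the fourth
  point vary makes the remaining columns comparable.\<close>

lemma weighted_off_triangle:
  assumes dist: "distinct [a, b, u, v, r]" and V: "{a, b, u, v, r} \<subseteq> V"
    and v: "unbalanced c a b u v" and r: "unbalanced c a b u r"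
  shows "\<exists>w. \<forall>x\<in>V. \<forall>y\<in>V. x \<noteq> y \<longrightarrow> \<not> {x, y} \<subseteq> {a, b, u} \<longrightarrow> c x y = w x + w y"
proof -
  define \<kappa> where "\<kappa> q = c q r - c a r" for q
  have row: "c q s = \<kappa> q + c a s" if "q \<in> {a, b, u, v}" "s \<in> V" "s \<notin> {a, b, u, v}" for q s
  proof (cases "s = r \<or> q = a")
    case True
    then show ?thesis by (auto simp: \<kappa>_def)
  next
    case False
    have "unbalanced c a b u v" "unbalanced c a u b v" "unbalanced c a v b u"
      using v unbalanced_perm by blast+
    then have "c q r - c q s = c a r - c a s"
      using unbalanced_parallel[of a b u v r s] unbalanced_parallel[of a u b v r s]
        unbalanced_parallel[of a v b u r s] that False dist V by auto
    then show ?thesis unfolding \<kappa>_def by algebra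
  qed
  \<comment> \<open>The right-hand side is free of \<open>s\<close>: each of the three matchings
    contains exactly one edge at \<open>s\<close>, and each such edge contributes the same
    \<open>c a s\<close>.\<close>
  have tri_iff: "unbalanced c a b u s \<longleftrightarrow> \<not> (c a b + \<kappa> u = c a u + \<kappa> b \<and> c a u + \<kappa> b = c b u)"
    if s: "s \<in> V" "s \<notin> {a, b, u, v}" for s
  proof -
    have "c b s = \<kappa> b + c a s" "c u s = \<kappa> u + c a s" using row s by blast+
    then show ?thesis unfolding unbalanced_def by (simp add: algebra_simps)
  qed
  have tri: "unbalanced c a b u s" if s: "s \<in> V" "s \<notin> {a, b, u, v}" for s
    using tri_iff[OF s] tri_iff[of r] r dist V by auto
  \<comment> \<open>With \<open>t\<close> as the fourth point of the quadruple, \<open>v\<close>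
    lies outside, so columns \<open>v\<close> and \<open>s\<close> may be compared.\<close>
  have cross: "c a v - c a s = c q v - c q s"
    if "q \<in> {b, u, t}" "s \<in> V" "t \<in> V" "s \<notin> {a, b, u, v}" "t \<notin> {a, b, u, v}" "s \<noteq> t" for q s t
  proof -
    have "unbalanced c a b u t" "unbalanced c a u b t" "unbalanced c a t b u"
      using tri[of t] that unbalanced_perm by blast+
    then show ?thesis
      using unbalanced_parallel[of a b u t v s] unbalanced_parallel[of a u b t v s]
        unbalanced_parallel[of a t b u v s] that dist V by auto
  qed
  define \<gamma> where "\<gamma> = c a v - \<kappa> v"
  obtain t where t: "t \<in> V" "t \<notin> {a, b, u, v, r}"
    using ex_not_in_list[of V "[a, b, u, v, r]"] finV card6 by auto
  have qv: "c q v = \<kappa> q + \<kappa> v + \<gamma>" if "q \<in> {a, b, u}" for q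
    using cross[of q t r] row[of q t] that t V dist by (auto simp: \<gamma>_def \<kappa>_def)
  have st: "c s t = c a s + c a t - \<gamma>"
    if "s \<in> V" "t \<in> V" "s \<notin> {a, b, u, v}" "t \<notin> {a, b, u, v}" "s \<noteq> t" for s t
  proof -
    have "c a v - c a t = c s v - c s t" using cross[of s s t] that by blast
    moreover have "c s v = \<kappa> v + c a s" using row[of v s] that sym[of s v] by simp
    ultimately show ?thesis unfolding \<gamma>_def by algebra
  qed
  \<comment> \<open>Inside the quadruple the weight is shifted by \<open>- \<gamma>\<close>, outside
    by \<open>\<gamma>\<close>. Mixed edges are unaffected, and edges within one side change by
    \<open>- 2 * \<gamma>\<close> or \<open>2 * \<gamma>\<close>, which are \<open>\<gamma>\<close>
    and \<open>- \<gamma>\<close>, as \<open>qv\<close> and \<open>st\<close> demand.\<close>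
  define w where "w x = (if x \<in> {a, b, u, v} then \<kappa> x - \<gamma> else c a x + \<gamma>)" for x
  have 3: "\<gamma> + \<gamma> + \<gamma> = 0" by simp
  have half: "c x y = w x + w y"
    if xy: "x \<in> V" "y \<in> V" "x \<noteq> y" and split: "y = v \<or> y \<notin> {a, b, u, v}" "x \<in> {a, b, u} \<or> y \<notin> {a, b, u, v}" for x y
  proof -
    consider "y = v" "x \<in> {a, b, u}" | "y \<notin> {a, b, u, v}" "x \<in> {a, b, u, v}"
      | "y \<notin> {a, b, u, v}" "x \<notin> {a, b, u, v}"
      using split by blast
    then show ?thesis
    proof cases
      case 1
      then have "w x + w y = \<kappa> x + \<kappa> v + \<gamma> - (\<gamma> + \<gamma> + \<gamma>)"
        by (auto simp: w_def algebra_simps)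
      then show ?thesis using qv[of x] 1 3 by simp
    next
      case 2
      then have "w x = \<kappa> x - \<gamma>" "w y = c a y + \<gamma>" by (simp_all only: w_def if_True if_False)
      then show ?thesis using row[of x y] 2 xy by simp
    next
      case 3
      have "w x + w y = c a x + c a y - \<gamma> + (\<gamma> + \<gamma> + \<gamma>)"
        using 3 by (simp add: w_def algebra_simps )
      then show ?thesis using st[of x y] 3 xy by simp
    qed
  qed
  have "c x y = w x + w y" if "x \<in> V" "y \<in> V" "x \<noteq> y" "\<not> {x, y} \<subseteq> {a, b, u}" for x y
  proof (cases "(y = v \<or> y \<notin> {a, b, u, v}) \<and> (x \<in> {a, b, u} \<or> y \<notin> {a, b, u, v})")
    case True
    then show ?thesis using half that by blast
  next
    case False
    then have "c y x = w y + w x" using that by (intro half) auto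
    then show ?thesis using sym[of x y] by (simp add: add.commute)
  qed
  then show ?thesis by blast
qed

text \<open>For \<open>r, s\<close> off the triangle, \<open>a b\<close> is the only edge of the
  quadruple \<open>a, b, r, s\<close> that violates the weights, so the quadruple is unbalanced.
  Hence the rows of \<open>a\<close> and \<open>b\<close> are parallel to rows of correctly weighted
  points, and this transfers the formula from column \<open>v\<close> to column
  \<open>u\<close>.\<close>

lemma single_edge:
  assumes w: "\<And>x y. x \<in> V \<Longrightarrow> y \<in> V \<Longrightarrow> x \<noteq> y \<Longrightarrow> \<not> {x, y} \<subseteq> {a, b, u} \<Longrightarrow> c x y = w x + w y"
    and dist: "distinct [a, b, u]" and V: "{a, b, u} \<subseteq> V" and ab: "c a b \<noteq> w a + w b"
  shows "weighted_but_one_edge V c"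
proof -
  obtain r where r: "r \<in> V" "r \<notin> set [a, b, u]"
    using ex_not_in_list[of V "[a, b, u]"] finV card6 by auto
  obtain s where s: "s \<in> V" "s \<notin> set [a, b, u, r]"
    using ex_not_in_list[of V "[a, b, u, r]"] finV card6 by auto
  obtain v where v: "v \<in> V" "v \<notin> set [a, b, u, r, s]"
    using ex_not_in_list[of V "[a, b, u, r, s]"] finV card6 by auto
  have u: "c q u = w q + w u" if q: "q \<in> {a, b}" for q
  proof -
    have rs: "c r s = w r + w s" "c r u = w r + w u" "c r v = w r + w v"
      using r s v V dist by (auto intro!: w)
    have qr: "c x r = w x + w r" "c x s = w x + w s" "c x v = w x + w v" if "x \<in> {a, b}" for x
      using r s v V dist that by (auto intro!: w)
    have "unbalanced c a b r s"
      using rs qr[of a] qr[of b] ab unfolding unbalanced_def by (auto simp: algebra_simps)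
    then have "unbalanced c a r b s" "unbalanced c b r a s"
      using unbalanced_perm by blast+
    then have "c q u - c q v = c r u - c r v"
      using unbalanced_parallel[of a r b s u v] unbalanced_parallel[of b r a s u v] q dist r s v V
      by auto
    then show ?thesis using rs qr[OF q] by algebra
  qed
  define \<epsilon> where "\<epsilon> = c a b - w a - w b"
  have "\<epsilon> \<noteq> 0" using ab by (auto simp: \<epsilon>_def algebra_simps)
  moreover have "c x y = w x + w y + (if {x, y} = {a, b} then \<epsilon> else 0)"
    if "x \<in> V" "y \<in> V" "x \<noteq> y" for x y
  proof (cases "{x, y} \<subseteq> {a, b, u}")
    case False
    then show ?thesis using w that by auto
  next
    case True
    then show ?thesis
      using that u sym[of u a] sym[of u b] sym[of b a] dist
      by (auto simp: \<epsilon>_def doubleton_eq_iff algebra_simps)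
  qed
  ultimately show ?thesis
    unfolding weighted_but_one_edge_def
    using V dist by (intro exI[of _ w] exI[of _ a] exI[of _ b] exI[of _ \<epsilon>]) auto
qed

text \<open>Two unbalanced quadruples sharing a triple give weights off that triple. One of its
  three edges must be wrong, since the quadruple would be balanced otherwise, and then it is the
  only wrong edge.\<close>

theorem weighted_up_to_one_edge:
  assumes dist: "distinct [a, b, u, v]" and V: "{a, b, u, v} \<subseteq> V" and bad: "alt c a b u v \<noteq> 0"
  shows "weighted_but_one_edge V c"
proof -
  have fin: "weighted_but_one_edge V c" if q: "distinct [a, b, u, v, r]" "{a, b, u, v, r} \<subseteq> V"
    "unbalanced c a b u v" "unbalanced c a b u r" for a b u v r
  proof -
    obtain w where w: "\<And>x y. x \<in> V \<Longrightarrow> y \<in> V \<Longrightarrow> x \<noteq> y \<Longrightarrow> \<not> {x, y} \<subseteq> {a, b, u} \<Longrightarrow> c x y = w x + w y"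
      using weighted_off_triangle[OF q] by blast
    have "c a r = w a + w r" "c b r = w b + w r" "c u r = w u + w r"
      using that by (auto intro!: w)
    then have "c a b \<noteq> w a + w b \<or> c a u \<noteq> w a + w u \<or> c b u \<noteq> w b + w u"
      using that(4) unfolding unbalanced_def by (auto simp: algebra_simps)
    moreover have "weighted_but_one_edge V c" if "c a b \<noteq> w a + w b"
      using single_edge[of a b u w] w that \<open>distinct [a, b, u, v, r]\<close> \<open>{a, b, u, v, r} \<subseteq> V\<close> by auto
    moreover have "weighted_but_one_edge V c" if "c a u \<noteq> w a + w u"
      using single_edge[of a u b w] w that \<open>distinct [a, b, u, v, r]\<close> \<open>{a, b, u, v, r} \<subseteq> V\<close>
      by (auto simp: insert_commute)
    moreover have "weighted_but_one_edge V c" if "c b u \<noteq> w b + w u"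
      using single_edge[of b u a w] w that \<open>distinct [a, b, u, v, r]\<close> \<open>{a, b, u, v, r} \<subseteq> V\<close>
      by (auto simp: insert_commute)
    ultimately show ?thesis by blast
  qed
  obtain r where r: "r \<in> V" "r \<notin> set [a, b, u, v]"
    using ex_not_in_list[of V "[a, b, u, v]"] finV card6 by auto
  have ub: "unbalanced c a b u v"
    using bad unfolding unbalanced_def alt_def by auto
  \<comment> \<open>Any fifth point works: the balance equations of the three quadruples through
    \<open>a\<close> and \<open>r\<close> would add up to a vanishing sum on the original
    4-cycle.\<close>
  have "unbalanced c a b u r \<or> unbalanced c a b v r \<or> unbalanced c a u v r"
  proof (rule ccontr)
    assume "\<not> ?thesis"
    then have "c a b + c u r = c a u + c b r" "c a u + c b r = c a r + c b u"
      "c a b + c v r = c a v + c b r" "c a v + c b r = c a r + c b v"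
      unfolding unbalanced_def by auto
    then have "alt c a b u v = 0" unfolding alt_def by algebra
    then show False using bad by simp
  qed
  moreover have "unbalanced c a b v u" "unbalanced c a u v b"
    using ub unbalanced_perm by blast+
  ultimately show ?thesis
    using fin[of a b u v r] fin[of a b v u r] fin[of a u v b r] ub dist V r
    by auto
qed

end

section \<open>Sums over spanning copies\<close>

lemma ex_bij_extending:
  assumes fin: "finite V" and xs: "distinct xs" "set xs \<subseteq> V"
    and ys: "distinct ys" "set ys \<subseteq> V" and len: "length xs = length ys"
  obtains \<phi> where "bij_betw \<phi> V V" "map \<phi> xs = ys"
proof -
  define f where "f = the \<circ> map_of (zip xs ys)"
  have f: "map f xs = ys"
    using xs(1) len by (intro nth_equalityI) (auto simp: f_def map_of_zip_nth)
  have "inj_on f (set xs)" using f ys(1) by (metis distinct_map)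
  then have bf: "bij_betw f (set xs) (set ys)" using f by (auto simp: bij_betw_def)
  have "card (V - set xs) = card (V - set ys)"
    using xs ys len fin by (simp add: card_Diff_subset distinct_card)
  then obtain g where bg: "bij_betw g (V - set xs) (V - set ys)"
    using finite_same_card_bij[of "V - set xs" "V - set ys"] fin by auto
  define \<phi> where "\<phi> x = (if x \<in> set xs then f x else g x)" for x
  have "bij_betw \<phi> (set xs \<union> (V - set xs)) (set ys \<union> (V - set ys))"
  proof (rule bij_betw_combine)
    show "bij_betw \<phi> (set xs) (set ys)" using bf by (rule bij_betw_cong[THEN iffD1, rotated]) (simp add: \<phi>_def)
    show "bij_betw \<phi> (V - set xs) (V - set ys)"
      using bg by (rule bij_betw_cong[THEN iffD1, rotated]) (simp add: \<phi>_def)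
  qed auto
  moreover have "set xs \<union> (V - set xs) = V" "set ys \<union> (V - set ys) = V" using xs ys by auto
  moreover have "map \<phi> xs = ys" using f by (auto simp: \<phi>_def intro: map_cong)
  ultimately show ?thesis using that by metis
qed

lemma bij_betw_transpose:
  assumes "bij_betw \<phi> V V" "x \<in> V" "y \<in> V"
  shows "bij_betw (\<phi> \<circ> transpose x y) V V"
proof -
  have "bij_betw (transpose x y) V V"
    using assms(2,3) by (intro bij_betw_byWitness[of _ "transpose x y"]) (auto simp: transpose_def)
  then show ?thesis using assms(1) by (rule bij_betw_trans)
qed

locale spanning_colouring =
  fixes G :: "'v ugraph" and C :: "'v set \<Rightarrow> z3"
  assumes simple: "simple_graph G"
begin

abbreviation "V \<equiv> uverts G"
abbreviation "E \<equiv> uedges G"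

definition csum :: "('v \<Rightarrow> 'v) \<Rightarrow> z3" where
  "csum \<phi> = (\<Sum>e\<in>E. C (\<phi> ` e))"

definition ind :: "'v \<Rightarrow> 'v \<Rightarrow> z3" where
  "ind x y = (if {x, y} \<in> E then 1 else 0)"

definition leaf_at :: "'v \<Rightarrow> 'v \<Rightarrow> bool" where
  "leaf_at l p \<longleftrightarrow> (\<forall>g. {l, g} \<in> E \<longleftrightarrow> g = p)"

definition isolated :: "'v \<Rightarrow> bool" where
  "isolated z \<longleftrightarrow> (\<forall>g. {z, g} \<notin> E)"

lemma finV: "finite V" and finE: "finite E"
proof -
  show "finite V" using simple by (simp add: simple_graph_def)
  then show "finite E"
    using simple finite_subset[of E "Pow V"] by (auto simp: simple_graph_def)
qed

lemma edge_verts: "{x, y} \<in> E \<Longrightarrow> x \<in> V \<and> y \<in> V \<and> x \<noteq> y"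
  using simple unfolding simple_graph_def by fastforce

lemma edge_cases:
  assumes "e \<in> E" obtains x y where "e = {x, y}" "x \<noteq> y" "x \<in> V" "y \<in> V"
  using assms simple unfolding simple_graph_def by (metis card_2_iff insert_subset)

lemma leaf_at_verts: "leaf_at l p \<Longrightarrow> l \<in> V \<and> p \<in> V \<and> l \<noteq> p \<and> {l, p} \<in> E"
  using edge_verts unfolding leaf_at_def by blast

lemma ind_commute: "ind x y = ind y x"
  by (simp add: ind_def insert_commute)

lemma ind_leaf: "leaf_at l p \<Longrightarrow> ind l g = (if g = p then 1 else 0)"
  by (simp add: ind_def leaf_at_def)

lemma ind_isolated: "isolated z \<Longrightarrow> ind z g = 0"
  by (simp add: ind_def isolated_def)

text \<open>The edge \<open>{x, y}\<close> is grouped with the edges avoiding both vertices, because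
  exactly these are fixed as sets by the transposition of \<open>x\<close> and
  \<open>y\<close>.\<close>

lemma csum_split:
  assumes xy: "x \<in> V" "y \<in> V" "x \<noteq> y"
  shows "csum \<phi> = (\<Sum>e\<in>{e\<in>E. x \<notin> e \<and> y \<notin> e \<or> e = {x, y}}. C (\<phi> ` e))
    + (\<Sum>g\<in>V-{x,y}. ind x g * C {\<phi> x, \<phi> g}) + (\<Sum>g\<in>V-{x,y}. ind y g * C {\<phi> y, \<phi> g})"
proof -
  define E0 where "E0 = {e\<in>E. x \<notin> e \<and> y \<notin> e \<or> e = {x, y}}"
  define N where "N v = {g \<in> V - {x, y}. {v, g} \<in> E}" for v
  define S where "S v = (\<lambda>g. {v, g}) ` N v" for v
  have E: "E = (E0 \<union> S x) \<union> S y"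
  proof
    show "E \<subseteq> (E0 \<union> S x) \<union> S y"
    proof
      fix e assume e: "e \<in> E"
      then obtain a b where ab: "e = {a, b}" "a \<noteq> b" "a \<in> V" "b \<in> V" by (rule edge_cases)
      have other: "\<exists>g. e = {v, g} \<and> g \<in> V" if "v \<in> e" for v
        using ab that by auto
      show "e \<in> (E0 \<union> S x) \<union> S y"
      proof (cases "x \<notin> e \<and> y \<notin> e \<or> e = {x, y}")
        case True
        then show ?thesis using e by (simp add: E0_def)
      next
        case False
        then obtain v g where v: "v \<in> {x, y}" "e = {v, g}" "g \<in> V" using other by blast
        have "g \<noteq> x" "g \<noteq> y" using v False e edge_verts[of v g] by auto
        then have "e \<in> S v" using v e unfolding S_def N_def by blast
        then show ?thesis using v(1) by auto
      qed
    qed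
    show "(E0 \<union> S x) \<union> S y \<subseteq> E" unfolding E0_def S_def N_def by auto
  qed
  have fin: "finite E0" "finite (S x)" "finite (S y)"
    using finE finV unfolding E0_def S_def N_def by auto
  have disj: "E0 \<inter> S x = {}" "(E0 \<union> S x) \<inter> S y = {}"
    using xy unfolding E0_def S_def N_def by (auto simp: doubleton_eq_iff)
  have S: "(\<Sum>e\<in>S v. C (\<phi> ` e)) = (\<Sum>g\<in>V-{x,y}. ind v g * C {\<phi> v, \<phi> g})" for v
  proof -
    have "inj_on (\<lambda>g. {v, g}) (N v)"
      by (auto simp: inj_on_def doubleton_eq_iff)
    then have "(\<Sum>e\<in>S v. C (\<phi> ` e)) = (\<Sum>g\<in>N v. C {\<phi> v, \<phi> g})"
      unfolding S_def by (subst sum.reindex) auto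
    also have "\<dots> = (\<Sum>g\<in>V-{x,y}. if {v, g} \<in> E then C {\<phi> v, \<phi> g} else 0)"
      unfolding N_def using finV by (subst sum.inter_filter) auto
    also have "\<dots> = (\<Sum>g\<in>V-{x,y}. ind v g * C {\<phi> v, \<phi> g})"
      by (intro sum.cong) (auto simp: ind_def)
    finally show ?thesis .
  qed
  have "csum \<phi> = (\<Sum>e\<in>E0. C (\<phi> ` e)) + (\<Sum>e\<in>S x. C (\<phi> ` e)) + (\<Sum>e\<in>S y. C (\<phi> ` e))"
    unfolding csum_def by (subst E) (simp add: sum.union_disjoint fin disj)
  then show ?thesis unfolding S E0_def .
qed

lemma csum_transpose:
  assumes xy: "x \<in> V" "y \<in> V" "x \<noteq> y"
  shows "csum (\<phi> \<circ> transpose x y) = csum \<phi> +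
    (\<Sum>g\<in>V-{x,y}. (ind x g - ind y g) * (C {\<phi> y, \<phi> g} - C {\<phi> x, \<phi> g}))"
proof -
  let ?E0 = "{e\<in>E. x \<notin> e \<and> y \<notin> e \<or> e = {x, y}}"
  have "(\<Sum>e\<in>?E0. C ((\<phi> \<circ> transpose x y) ` e)) = (\<Sum>e\<in>?E0. C (\<phi> ` e))"
  proof (rule sum.cong[OF refl])
    fix e assume "e \<in> ?E0"
    then have "transpose x y ` e = e"
      by (auto simp: transpose_def image_iff)
    then show "C ((\<phi> \<circ> transpose x y) ` e) = C (\<phi> ` e)" by (metis image_comp)
  qed
  moreover have "(\<Sum>g\<in>V-{x,y}. ind x g * C {(\<phi> \<circ> transpose x y) x, (\<phi> \<circ> transpose x y) g})
      = (\<Sum>g\<in>V-{x,y}. ind x g * C {\<phi> y, \<phi> g})"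
    "(\<Sum>g\<in>V-{x,y}. ind y g * C {(\<phi> \<circ> transpose x y) y, (\<phi> \<circ> transpose x y) g})
      = (\<Sum>g\<in>V-{x,y}. ind y g * C {\<phi> x, \<phi> g})"
    by (intro sum.cong; auto)+
  ultimately show ?thesis
    unfolding csum_split[OF xy, of "\<phi> \<circ> transpose x y"] csum_split[OF xy, of \<phi>]
    by (simp add: algebra_simps sum.distrib sum_subtractf)
qed

text \<open>The copy uses two opposite edges of the 4-cycle through the images of
  \<open>p1, l1, p2, l2\<close>; exchanging the leaves replaces them by the other two.\<close>

lemma csum_swap_leaves:
  assumes l1: "leaf_at l1 p1" and l2: "leaf_at l2 p2" and "p1 \<noteq> p2" "l1 \<noteq> p2" "l2 \<noteq> p1"
  shows "csum (\<phi> \<circ> transpose l1 l2) =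
    csum \<phi> - alt (\<lambda>x y. C {x, y}) (\<phi> p1) (\<phi> p2) (\<phi> l1) (\<phi> l2)"
proof -
  note v = leaf_at_verts[OF l1] leaf_at_verts[OF l2]
  have "l1 \<noteq> l2" using assms unfolding leaf_at_def by metis
  define D where "D g = C {\<phi> l2, \<phi> g} - C {\<phi> l1, \<phi> g}" for g
  have "(\<Sum>g\<in>V-{l1,l2}. (ind l1 g - ind l2 g) * (C {\<phi> l2, \<phi> g} - C {\<phi> l1, \<phi> g}))
    = (\<Sum>g\<in>V-{l1,l2}. (if g = p1 then D p1 else 0) - (if g = p2 then D p2 else 0))"
    unfolding ind_leaf[OF l1] ind_leaf[OF l2] using assms(3) by (intro sum.cong) (auto simp: D_def)
  also have "\<dots> = D p1 - D p2"
    using v assms(3-5) finV by (auto simp: sum_subtractf)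
  finally show ?thesis
    using csum_transpose[of l1 l2 \<phi>] v \<open>l1 \<noteq> l2\<close>
    by (simp add: alt_def D_def insert_commute algebra_simps)
qed

lemma csum_swap_leaf_isolated:
  assumes l: "leaf_at l p" and z: "isolated z" "z \<in> V"
  shows "csum (\<phi> \<circ> transpose l z) = csum \<phi> + C {\<phi> p, \<phi> z} - C {\<phi> p, \<phi> l}"
proof -
  note v = leaf_at_verts[OF l]
  have ne: "l \<noteq> z" "p \<noteq> z" using l z v unfolding leaf_at_def isolated_def by (auto simp: insert_commute)
  define D where "D g = C {\<phi> z, \<phi> g} - C {\<phi> l, \<phi> g}" for g
  have "(\<Sum>g\<in>V-{l,z}. (ind l g - ind z g) * (C {\<phi> z, \<phi> g} - C {\<phi> l, \<phi> g}))
    = (\<Sum>g\<in>V-{l,z}. if g = p then D p else 0)"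
    unfolding ind_leaf[OF l] ind_isolated[OF z(1)] by (intro sum.cong) (auto simp: D_def)
  also have "\<dots> = D p"
    using v ne finV by auto
  finally show ?thesis
    using csum_transpose[of l z \<phi>] v z ne by (auto simp: D_def insert_commute)
qed

text \<open>Reversing a leg \<open>q, p, l\<close> of length two keeps the edge \<open>p l\<close>
  and moves only the edge that attaches the leg to \<open>q\<close>.\<close>

lemma csum_reverse_leg:
  assumes l: "leaf_at l p" and p: "\<And>g. {p, g} \<in> E \<longleftrightarrow> g = l \<or> g = q" and "q \<noteq> l"
  shows "csum (\<phi> \<circ> transpose p l) = csum \<phi> + C {\<phi> q, \<phi> l} - C {\<phi> q, \<phi> p}"
proof -
  note v = leaf_at_verts[OF l]
  have q: "q \<in> V" "q \<noteq> p" using p[of q] edge_verts by blast+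
  define D where "D g = C {\<phi> l, \<phi> g} - C {\<phi> p, \<phi> g}" for g
  have "(\<Sum>g\<in>V-{p,l}. (ind p g - ind l g) * (C {\<phi> l, \<phi> g} - C {\<phi> p, \<phi> g}))
    = (\<Sum>g\<in>V-{p,l}. if g = q then D q else 0)"
    unfolding ind_leaf[OF l] using q by (intro sum.cong) (auto simp: D_def ind_def p)
  also have "\<dots> = D q"
    using v q \<open>q \<noteq> l\<close> finV by simp
  finally show ?thesis
    using csum_transpose[of p l \<phi>] v by (auto simp: D_def insert_commute)
qed

text \<open>Without edges between the two pairs, every edge is affected by at most one of the
  transpositions, so their effects add.\<close>

lemma csum_transpose_add:
  assumes dist: "distinct [x1, y1, x2, y2]"
    and no: "\<And>x y. x \<in> {x1, y1} \<Longrightarrow> y \<in> {x2, y2} \<Longrightarrow> {x, y} \<notin> E"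
  shows "csum (\<phi> \<circ> transpose x1 y1 \<circ> transpose x2 y2) + csum \<phi>
    = csum (\<phi> \<circ> transpose x1 y1) + csum (\<phi> \<circ> transpose x2 y2)"
proof -
  let ?t1 = "transpose x1 y1" and ?t2 = "transpose x2 y2"
  have "C ((\<phi> \<circ> ?t1 \<circ> ?t2) ` e) + C (\<phi> ` e) = C ((\<phi> \<circ> ?t1) ` e) + C ((\<phi> \<circ> ?t2) ` e)"
    if e: "e \<in> E" for e
  proof -
    obtain a b where ab: "e = {a, b}" using edge_cases[OF e] by metis
    have "e \<inter> {x1, y1} = {} \<or> e \<inter> {x2, y2} = {}"
    proof (rule ccontr)
      assume "\<not> ?thesis"
      then obtain x y where "x \<in> e" "x \<in> {x1, y1}" "y \<in> e" "y \<in> {x2, y2}" by blast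
      moreover from this have "x \<noteq> y" using dist by auto
      ultimately have "e = {x, y}" using ab by auto
      then show False using no \<open>x \<in> {x1, y1}\<close> \<open>y \<in> {x2, y2}\<close> e by blast
    qed
    then show ?thesis
    proof
      assume "e \<inter> {x1, y1} = {}"
      then have "?t1 a = a" "?t1 b = b" "?t1 (?t2 a) = ?t2 a" "?t1 (?t2 b) = ?t2 b"
        using ab dist by (auto simp: transpose_def)
      then show ?thesis using ab by simp
    next
      assume "e \<inter> {x2, y2} = {}"
      then have "?t2 a = a" "?t2 b = b" using ab by (auto simp: transpose_def)
      then show ?thesis using ab by simp
    qed
  qed
  then show ?thesis unfolding csum_def sum.distrib[symmetric] by (rule sum.cong[OF refl])
qed

text \<open>Double counting of incidences turns the edge sum into a degree sum; the exceptional edge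
  of the host contributes only if its preimage is an edge of \<open>G\<close>.\<close>

lemma csum_weighted:
  assumes \<phi>: "bij_betw \<phi> V V" and \<alpha>: "\<alpha> \<in> V" "\<beta> \<in> V" "\<alpha> \<noteq> \<beta>"
    and C: "\<And>x y. x \<in> V \<Longrightarrow> y \<in> V \<Longrightarrow> x \<noteq> y \<Longrightarrow>
      C {x, y} = w x + w y + (if {x, y} = {\<phi> \<alpha>, \<phi> \<beta>} then \<epsilon> else 0)"
  shows "csum \<phi> = (\<Sum>x\<in>V. of_nat (deg G x) * w (\<phi> x)) + (if {\<alpha>, \<beta>} \<in> E then \<epsilon> else 0)"
proof -
  have inj: "inj_on \<phi> V" and img: "\<phi> ` V = V" using \<phi> by (auto simp: bij_betw_def)
  have "C (\<phi> ` e) = (\<Sum>x\<in>V. if x \<in> e then w (\<phi> x) else 0) + (if e = {\<alpha>, \<beta>} then \<epsilon> else 0)"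
    if "e \<in> E" for e
  proof -
    obtain x y where e: "e = {x, y}" "x \<noteq> y" "x \<in> V" "y \<in> V" using edge_cases[OF \<open>e \<in> E\<close>] .
    have "\<phi> x \<in> V" "\<phi> y \<in> V" "\<phi> x \<noteq> \<phi> y"
      using e img inj_on_eq_iff[OF inj, of x y] by blast+
    moreover have "{\<phi> x, \<phi> y} = {\<phi> \<alpha>, \<phi> \<beta>} \<longleftrightarrow> {x, y} = {\<alpha>, \<beta>}"
      using inj_on_eq_iff[OF inj e(3) \<alpha>(1)] inj_on_eq_iff[OF inj e(3) \<alpha>(2)]
        inj_on_eq_iff[OF inj e(4) \<alpha>(1)] inj_on_eq_iff[OF inj e(4) \<alpha>(2)]
      by (simp add: doubleton_eq_iff)
    moreover have "(\<Sum>x\<in>V. if x \<in> e then w (\<phi> x) else 0) = (\<Sum>x\<in>e. w (\<phi> x))"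
    proof -
      have "{v \<in> V. v \<in> e} = e" using e by auto
      then show ?thesis using sum.inter_filter[OF finV, of "\<lambda>x. w (\<phi> x)" "\<lambda>x. x \<in> e"] by simp
    qed
    ultimately show ?thesis using C[of "\<phi> x" "\<phi> y"] e by simp
  qed
  then have "csum \<phi> = (\<Sum>e\<in>E. \<Sum>x\<in>V. if x \<in> e then w (\<phi> x) else 0)
      + (\<Sum>e\<in>E. if e = {\<alpha>, \<beta>} then \<epsilon> else 0)"
    unfolding csum_def by (simp add: sum.distrib)
  also have "(\<Sum>e\<in>E. if e = {\<alpha>, \<beta>} then \<epsilon> else 0) = (if {\<alpha>, \<beta>} \<in> E then \<epsilon> else 0)"
    using finE by simp
  also have "(\<Sum>e\<in>E. \<Sum>x\<in>V. if x \<in> e then w (\<phi> x) else 0)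
      = (\<Sum>x\<in>V. \<Sum>e\<in>E. if x \<in> e then w (\<phi> x) else 0)"
    by (rule sum.swap)
  also have "\<dots> = (\<Sum>x\<in>V. of_nat (deg G x) * w (\<phi> x))"
  proof (rule sum.cong[OF refl])
    fix x
    show "(\<Sum>e\<in>E. if x \<in> e then w (\<phi> x) else 0) = of_nat (deg G x) * w (\<phi> x)"
      using sum.inter_filter[OF finE, of "\<lambda>_. w (\<phi> x)" "\<lambda>e. x \<in> e"] by (simp add: deg_def)
  qed
  finally show ?thesis .
qed

lemma deg_sum: "(\<Sum>x\<in>V. deg G x) = 2 * card E"
proof -
  have "(\<Sum>x\<in>V. deg G x) = (\<Sum>x\<in>V. \<Sum>e\<in>E. if x \<in> e then 1 else 0)"
    unfolding deg_def using finE by (intro sum.cong) (auto simp: sum.inter_filter[symmetric])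
  also have "\<dots> = (\<Sum>e\<in>E. \<Sum>x\<in>V. if x \<in> e then 1 else 0)" by (rule sum.swap)
  also have "\<dots> = (\<Sum>e\<in>E. card e)"
  proof (rule sum.cong[OF refl])
    fix e assume "e \<in> E"
    then have "{v \<in> V. v \<in> e} = e" using simple by (auto simp: simple_graph_def)
    then show "(\<Sum>x\<in>V. if x \<in> e then 1 else 0) = card e"
      using sum.inter_filter[OF finV, of "\<lambda>_. 1::nat" "\<lambda>x. x \<in> e"] by simp
  qed
  also have "\<dots> = (\<Sum>e\<in>E. 2)" using simple by (intro sum.cong) (auto simp: simple_graph_def)
  finally show ?thesis by simp
qed

end

text \<open>A counterexample to the upper bound; the \<open>not_...\<close> lemmas below refute it
  under various conditions.\<close>

locale zero_sum_free = spanning_colouring +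
  assumes no_zero: "bij_betw \<phi> V V \<Longrightarrow> csum \<phi> \<noteq> 0"
begin

lemma one_transposition_idle:
  assumes \<phi>: "bij_betw \<phi> V V" and dist: "distinct [x1, y1, x2, y2]"
    and V: "{x1, y1, x2, y2} \<subseteq> V"
    and no: "\<And>x y. x \<in> {x1, y1} \<Longrightarrow> y \<in> {x2, y2} \<Longrightarrow> {x, y} \<notin> E"
  shows "csum (\<phi> \<circ> transpose x1 y1) = csum \<phi> \<or> csum (\<phi> \<circ> transpose x2 y2) = csum \<phi>"
proof (rule ccontr)
  assume "\<not> ?thesis"
  moreover define \<alpha> \<beta> where "\<alpha> = csum (\<phi> \<circ> transpose x1 y1) - csum \<phi>"
    and "\<beta> = csum (\<phi> \<circ> transpose x2 y2) - csum \<phi>"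
  ultimately have "\<alpha> \<noteq> 0" "\<beta> \<noteq> 0" by simp_all
  then have "csum \<phi> = 0 \<or> csum \<phi> + \<alpha> = 0 \<or> csum \<phi> + \<beta> = 0 \<or> csum \<phi> + \<alpha> + \<beta> = 0"
    by (rule z3_two_changes)
  moreover have "csum (\<phi> \<circ> transpose x1 y1 \<circ> transpose x2 y2) = csum \<phi> + \<alpha> + \<beta>"
    using csum_transpose_add[OF dist no, of \<phi>] by (simp add: \<alpha>_def \<beta>_def algebra_simps)
  moreover have "bij_betw (\<phi> \<circ> transpose x1 y1) V V" "bij_betw (\<phi> \<circ> transpose x2 y2) V V"
    using \<phi> V by (auto intro: bij_betw_transpose)
  moreover have "bij_betw (\<phi> \<circ> transpose x1 y1 \<circ> transpose x2 y2) V V"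
    using calculation V by (auto intro: bij_betw_transpose)
  ultimately show False
    using no_zero \<phi> unfolding \<alpha>_def \<beta>_def by (metis add.commute diff_add_cancel)
qed

end

section \<open>Weighted colourings and two isolated vertices\<close>

lemma length_le_card:
  assumes "finite V" "distinct xs" "set xs \<subseteq> V"
  shows "length xs \<le> card V"
  using assms card_mono[of V "set xs"] by (simp add: distinct_card)

text \<open>If \<open>f x\<close> and \<open>f y\<close> differ, all other values agree; comparing
  the pairs \<open>x, t\<close> and \<open>y, s\<close> then shows that \<open>x\<close> or
  \<open>y\<close> has this common value too.\<close>

lemma const_but_one:
  assumes fin: "finite A" and card: "card A \<ge> 4"
    and pairs: "\<And>x y z t. distinct [x, y, z, t] \<Longrightarrow> {x, y, z, t} \<subseteq> A \<Longrightarrow> f x = f y \<or> f z = f t"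
  obtains u \<kappa> where "u \<in> A" "\<And>x. x \<in> A \<Longrightarrow> x \<noteq> u \<Longrightarrow> f x = \<kappa>"
proof (cases "\<exists>x\<in>A. \<exists>y\<in>A. f x \<noteq> f y")
  case False
  obtain u where "u \<in> A" using card by fastforce
  then show ?thesis using False that[of u "f u"] by blast
next
  case True
  then obtain x y where xy: "x \<in> A" "y \<in> A" "f x \<noteq> f y" by blast
  obtain t where t: "t \<in> A" "t \<notin> set [x, y]"
    using ex_not_in_list[of A "[x, y]"] fin card by auto
  obtain s where s: "s \<in> A" "s \<notin> set [x, y, t]"
    using ex_not_in_list[of A "[x, y, t]"] fin card by auto
  have others: "f z = f t" if "z \<in> A" "z \<notin> {x, y}" for z
    using pairs[of x y z t] xy t that by (cases "z = t") auto
  have "f x = f t \<or> f y = f s"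
    using pairs[of x t y s] xy t s by auto
  then have "f x = f t \<or> f y = f t" using others[of s] s by auto
  then show ?thesis
  proof
    assume "f x = f t"
    then show ?thesis using that[of y "f t"] others xy by blast
  next
    assume "f y = f t"
    then show ?thesis using that[of x "f t"] others xy by blast
  qed
qed

text \<open>Any two edges are joined by a chain of at most three edges in which consecutive ones
  share a vertex.\<close>

lemma const_if_cherries_const:
  assumes sym: "\<And>x y. c x y = c y x"
    and ch: "\<And>v x y. distinct [v, x, y] \<Longrightarrow> {v, x, y} \<subseteq> A \<Longrightarrow> c v x = c v y"
    and "{g, h, g', h'} \<subseteq> A" "g \<noteq> h" "g' \<noteq> h'"
  shows "c g h = c g' h'"
proof (cases "h' = g")
  case True
  then show ?thesis using ch[of g h g'] assms(3-5) sym[of g g'] by (cases "h = g'") auto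
next
  case False
  have "c g h = c g h'" using ch[of g h h'] assms(3-5) False by (cases "h = h'") auto
  also have "\<dots> = c h' g'"
    using ch[of h' g g'] assms(3-5) False sym[of g h'] by (cases "g = g'") auto
  finally show ?thesis using sym[of h' g'] by simp
qed

text \<open>Outside a cherry \<open>v, x, y\<close> with two colours every edge has one colour
  \<open>\<kappa>\<close>. If all edges leaving the triple have this colour as well, deleting
  \<open>v\<close> and \<open>x\<close> is enough. Otherwise an edge \<open>r t\<close> of another
  colour leaves the triple; it forms such a cherry with every further outer vertex \<open>s\<close>,
  and varying \<open>s\<close> shows that all edges off \<open>r, t\<close> have colour
  \<open>\<kappa>\<close>.\<close>

lemma const_off_two:
  assumes fin: "finite V" and card: "card V \<ge> 8" and sym: "\<And>x y. c x y = c y x"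
    and ch: "\<And>v x y v' x' y'. distinct [v, x, y, v', x', y'] \<Longrightarrow> {v, x, y, v', x', y'} \<subseteq> V \<Longrightarrow>
      c v x = c v y \<or> c v' x' = c v' y'"
  obtains x y \<kappa> where "x \<in> V" "y \<in> V" "x \<noteq> y"
    "\<And>g h. g \<in> V - {x, y} \<Longrightarrow> h \<in> V - {x, y} \<Longrightarrow> g \<noteq> h \<Longrightarrow> c g h = \<kappa>"
proof (cases "\<exists>v x y. distinct [v, x, y] \<and> {v, x, y} \<subseteq> V \<and> c v x \<noteq> c v y")
  case False
  obtain x where x: "x \<in> V" using card by fastforce
  obtain y where y: "y \<in> V" "y \<notin> set [x]" using ex_not_in_list[of V "[x]"] fin card by auto
  have "c g h = c x y" if "g \<in> V - {x, y}" "h \<in> V - {x, y}" "g \<noteq> h" for g h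
  proof (rule const_if_cherries_const[of c V])
    show "\<And>v x y. distinct [v, x, y] \<Longrightarrow> {v, x, y} \<subseteq> V \<Longrightarrow> c v x = c v y" using False by blast
  qed (use that x y sym in auto)
  then show ?thesis using that[of x y "c x y"] x y by auto
next
  case True
  then obtain v x y where vxy: "distinct [v, x, y]" "{v, x, y} \<subseteq> V" "c v x \<noteq> c v y" by blast
  have off: "c g h = c g' h'"
    if nm: "distinct [v, x, y]" "{v, x, y} \<subseteq> V" "c v x \<noteq> c v y"
      and "{g, h, g', h'} \<subseteq> V - {v, x, y}" "g \<noteq> h" "g' \<noteq> h'" for v x y g h g' h'
  proof (rule const_if_cherries_const[of c "V - {v, x, y}"])
    show "c a s = c a t" if "distinct [a, s, t]" "{a, s, t} \<subseteq> V - {v, x, y}" for a s t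
      using ch[of v x y a s t] nm that by auto
  qed (use that sym in auto)
  obtain r1 where r1: "r1 \<in> V" "r1 \<notin> set [v, x, y]"
    using ex_not_in_list[of V "[v, x, y]"] fin card by auto
  obtain r2 where r2: "r2 \<in> V" "r2 \<notin> set [v, x, y, r1]"
    using ex_not_in_list[of V "[v, x, y, r1]"] fin card by auto
  define \<kappa> where "\<kappa> = c r1 r2"
  have R: "c g h = \<kappa>" if "g \<in> V - {v, x, y}" "h \<in> V - {v, x, y}" "g \<noteq> h" for g h
    unfolding \<kappa>_def using off[OF vxy, of g h r1 r2] that r1 r2 by auto
  show ?thesis
  proof (cases "\<exists>r\<in>V - {v, x, y}. \<exists>t\<in>{v, x, y}. c r t \<noteq> \<kappa>")
    case False
    have "c g h = \<kappa>" if "g \<in> V - {v, x}" "h \<in> V - {v, x}" "g \<noteq> h" for g h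
      using R[of g h] False that sym[of g h] by (cases "g = y"; cases "h = y") auto
    then show ?thesis using that[of v x \<kappa>] vxy by auto
  next
    case True
    then obtain r t where rt: "r \<in> V - {v, x, y}" "t \<in> {v, x, y}" "c r t \<noteq> \<kappa>" by blast
    have "c g h = \<kappa>" if gh: "g \<in> V - {r, t}" "h \<in> V - {r, t}" "g \<noteq> h" for g h
    proof -
      \<comment> \<open>The choice of \<open>s\<close> depends on the edge \<open>g h\<close>, which
        must avoid the new cherry \<open>r, t, s\<close>. The edge \<open>a b\<close> below avoids
        both cherries and identifies the colour as \<open>\<kappa>\<close>.\<close>
      obtain s where s: "s \<in> V" "s \<notin> set [v, x, y, r, g, h]"
        using ex_not_in_list[of V "[v, x, y, r, g, h]"] fin card by auto
      obtain a where a: "a \<in> V" "a \<notin> set [v, x, y, r, s]"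
        using ex_not_in_list[of V "[v, x, y, r, s]"] fin card by auto
      obtain b where b: "b \<in> V" "b \<notin> set [v, x, y, r, s, a]"
        using ex_not_in_list[of V "[v, x, y, r, s, a]"] fin card by auto
      have "c r s = \<kappa>" using R[of r s] rt s by auto
      then have nm: "distinct [r, t, s]" "{r, t, s} \<subseteq> V" "c r t \<noteq> c r s"
        using rt s vxy by auto
      have "c g h = c a b"
        by (rule off[OF nm]) (use gh s a b rt in auto)
      also have "\<dots> = \<kappa>" using R[of a b] a b by auto
      finally show ?thesis .
    qed
    then show ?thesis using that[of r t \<kappa>] rt vxy by auto
  qed
qed

context spanning_colouring
begin

lemma csum_const:
  assumes "3 dvd card E" "\<And>e. e \<in> E \<Longrightarrow> C (\<phi> ` e) = \<kappa>"
  shows "csum \<phi> = 0"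
proof -
  have "csum \<phi> = of_nat (card E) * \<kappa>"
    unfolding csum_def using assms(2) by simp
  then show ?thesis using assms(1) of_nat_z3_eq_0_iff by simp
qed

definition wsum :: "('v \<Rightarrow> z3) \<Rightarrow> ('v \<Rightarrow> 'v) \<Rightarrow> z3" where
  "wsum w \<phi> = (\<Sum>x\<in>V. of_nat (deg G x) * w (\<phi> x))"

lemma wsum_transpose:
  assumes xy: "x \<in> V" "y \<in> V" "x \<noteq> y"
  shows "wsum w (\<phi> \<circ> transpose x y) =
    wsum w \<phi> + (of_nat (deg G x) - of_nat (deg G y)) * (w (\<phi> y) - w (\<phi> x))"
proof -
  have split: "wsum w \<psi> = of_nat (deg G x) * w (\<psi> x) + (of_nat (deg G y) * w (\<psi> y)
      + (\<Sum>x\<in>V-{x}-{y}. of_nat (deg G x) * w (\<psi> x)))" for \<psi>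
    unfolding wsum_def using xy finV
    by (subst sum.remove[of _ x]; simp) (subst sum.remove[of _ y]; simp)
  have "(\<Sum>z\<in>V-{x}-{y}. of_nat (deg G z) * w ((\<phi> \<circ> transpose x y) z))
      = (\<Sum>z\<in>V-{x}-{y}. of_nat (deg G z) * w (\<phi> z))"
    by (intro sum.cong) auto
  then show ?thesis
    unfolding split by (simp add: algebra_simps)
qed

text \<open>The degrees sum to twice the number of edges, hence to 0 modulo 3, so subtracting a
  constant from all weights leaves the sum unchanged.\<close>

lemma wsum_const:
  assumes dvd: "3 dvd card E" and \<phi>: "\<And>x. x \<in> V - X \<Longrightarrow> w (\<phi> x) = \<kappa>" and X: "X \<subseteq> V"
  shows "wsum w \<phi> = (\<Sum>x\<in>X. of_nat (deg G x) * (w (\<phi> x) - \<kappa>))"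
proof -
  have "(\<Sum>x\<in>V. (of_nat (deg G x) :: z3)) = of_nat (2 * card E)"
    by (simp flip: deg_sum)
  also have "\<dots> = 0" using dvd of_nat_z3_eq_0_iff by (metis dvd_mult)
  finally have z: "(\<Sum>x\<in>V. (of_nat (deg G x) :: z3) * \<kappa>) = 0"
    by (simp flip: sum_distrib_right)
  have "wsum w \<phi> = (\<Sum>x\<in>V. of_nat (deg G x) * (w (\<phi> x) - \<kappa>))"
    unfolding wsum_def using z by (simp add: right_diff_distrib sum_subtractf)
  also have "\<dots> = (\<Sum>x\<in>X. of_nat (deg G x) * (w (\<phi> x) - \<kappa>))"
    using X \<phi> finV by (intro sum.mono_neutral_right) auto
  finally show ?thesis .
qed

end

context zero_sum_free
begin

text \<open>Exchanging \<open>f0\<close> with \<open>l1\<close> and \<open>fx\<close> with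
  \<open>l2\<close> changes degrees modulo 3, and in a degree-weighted sum such changes add
  regardless of adjacency. Hence two disjoint pairs of host vertices cannot both have unequal
  weights, so only one vertex \<open>u\<close> is exceptional, and \<open>f0\<close> placed there
  annihilates its weight.\<close>

lemma not_weighted:
  assumes dvd: "3 dvd card E"
    and f0: "f0 \<in> V" "deg G f0 mod 3 = 0" and fx: "fx \<in> V" "deg G fx mod 3 \<noteq> 1" "fx \<noteq> f0"
    and l: "l1 \<in> V" "l2 \<in> V" "l1 \<noteq> l2" "deg G l1 mod 3 = 1" "deg G l2 mod 3 = 1"
    and w: "\<And>x y. x \<in> V \<Longrightarrow> y \<in> V \<Longrightarrow> x \<noteq> y \<Longrightarrow> C {x, y} = w x + w y"
  shows False
proof -
  have dist: "distinct [f0, l1, fx, l2]" using f0 fx l by auto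
  have cs: "csum \<phi> = wsum w \<phi>" if "bij_betw \<phi> V V" for \<phi>
    using csum_weighted[of \<phi> f0 fx w 0] that f0 fx w by (simp add: wsum_def)
  have d: "(of_nat (deg G f0) :: z3) \<noteq> of_nat (deg G l1)" "(of_nat (deg G fx) :: z3) \<noteq> of_nat (deg G l2)"
    using f0 fx l by (auto simp: of_nat_z3_eq_iff)
  have pairs: "w r1 = w s1 \<or> w r2 = w s2"
    if rs: "distinct [r1, s1, r2, s2]" "{r1, s1, r2, s2} \<subseteq> V" for r1 s1 r2 s2
  proof (rule ccontr)
    assume ne: "\<not> ?thesis"
    obtain \<phi> where \<phi>: "bij_betw \<phi> V V" "map \<phi> [f0, l1, fx, l2] = [r1, s1, r2, s2]"
      using ex_bij_extending[of V "[f0, l1, fx, l2]" "[r1, s1, r2, s2]"] finV dist rs f0 fx l by auto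
    define \<alpha> :: z3 where "\<alpha> = (of_nat (deg G f0) - of_nat (deg G l1)) * (w s1 - w r1)"
    define \<beta> :: z3 where "\<beta> = (of_nat (deg G fx) - of_nat (deg G l2)) * (w s2 - w r2)"
    let ?t = "transpose f0 l1" and ?u = "transpose fx l2"
    have b: "bij_betw (\<phi> \<circ> ?t) V V" "bij_betw (\<phi> \<circ> ?u) V V" "bij_betw (\<phi> \<circ> ?t \<circ> ?u) V V"
      using \<phi>(1) f0 fx l by (auto intro!: bij_betw_transpose)
    have "csum (\<phi> \<circ> ?t) = csum \<phi> + \<alpha>" "csum (\<phi> \<circ> ?u) = csum \<phi> + \<beta>"
      using b \<phi> wsum_transpose[of f0 l1 w \<phi>] wsum_transpose[of fx l2 w \<phi>] f0 fx l dist
      by (auto simp: cs \<alpha>_def \<beta>_def)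
    moreover have "csum (\<phi> \<circ> ?t \<circ> ?u) = csum (\<phi> \<circ> ?t) + \<beta>"
      using b \<phi> wsum_transpose[of fx l2 w "\<phi> \<circ> ?t"] fx l dist
      by (auto simp: cs \<beta>_def transpose_def)
    moreover have "\<alpha> \<noteq> 0" "\<beta> \<noteq> 0" using d ne by (auto simp: \<alpha>_def \<beta>_def)
    ultimately show False
      using z3_two_changes[of \<alpha> \<beta> "csum \<phi>"] no_zero b \<phi>(1) by metis
  qed
  have "card V \<ge> 4"
    using length_le_card[OF finV dist] f0 fx l by auto
  then obtain u \<kappa> where u: "u \<in> V" "\<And>x. x \<in> V \<Longrightarrow> x \<noteq> u \<Longrightarrow> w x = \<kappa>"
    using const_but_one[of V w] finV pairs by metis
  obtain \<phi> where \<phi>: "bij_betw \<phi> V V" "map \<phi> [f0] = [u]"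
    using ex_bij_extending[of V "[f0]" "[u]"] finV u f0 by auto
  have "w (\<phi> x) = \<kappa>" if "x \<in> V - {f0}" for x
  proof -
    have "\<phi> x \<in> V" "\<phi> x \<noteq> \<phi> f0"
      using that \<phi>(1) f0 by (auto simp: bij_betw_def inj_on_eq_iff)
    then show ?thesis using u \<phi>(2) by auto
  qed
  then have "wsum w \<phi> = (\<Sum>x\<in>{f0}. of_nat (deg G x) * (w (\<phi> x) - \<kappa>))"
    using f0 by (intro wsum_const[OF dvd]) auto
  also have "(of_nat (deg G f0) :: z3) = 0"
    using f0 by (simp add: of_nat_z3_eq_0_iff dvd_eq_mod_eq_0)
  then have "(\<Sum>x\<in>{f0}. of_nat (deg G x) * (w (\<phi> x) - \<kappa>)) = 0" by simp
  finally show False using no_zero[OF \<phi>(1)] cs[OF \<phi>(1)] by simp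
qed

text \<open>With the centre held fixed, the two exchanges of a leaf with an isolated vertex show
  that the colours at \<open>q\<close> are constant up to one edge. An isolated vertex placed at the
  end of that edge leaves a monochromatic star.\<close>

lemma not_star_plus_two:
  assumes dvd: "3 dvd card E" and q: "\<And>e. e \<in> E \<Longrightarrow> q \<in> e"
    and l: "leaf_at l q" "leaf_at l' q" "l \<noteq> l'"
    and z: "isolated z" "isolated z'" "z \<noteq> z'" "z \<in> V" "z' \<in> V"
  shows False
proof -
  note v = leaf_at_verts[OF l(1)] leaf_at_verts[OF l(2)]
  have zq: "z \<noteq> q" "z' \<noteq> q" "z \<noteq> l" "z' \<noteq> l" "z \<noteq> l'" "z' \<noteq> l'"
    using z v unfolding isolated_def by (metis insert_commute)+
  have dist: "distinct [q, l, z, l', z']" using v l z zq by auto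
  have pairs: "C {q, x} = C {q, y} \<or> C {q, s} = C {q, t}"
    if xy: "distinct [x, y, s, t]" "{x, y, s, t} \<subseteq> V - {q}" for x y s t
  proof -
    obtain \<phi> where \<phi>: "bij_betw \<phi> V V" "map \<phi> [q, l, z, l', z'] = [q, x, y, s, t]"
      using ex_bij_extending[of V "[q, l, z, l', z']" "[q, x, y, s, t]"] finV dist v z xy by auto
    have "csum (\<phi> \<circ> transpose l z) = csum \<phi> \<or> csum (\<phi> \<circ> transpose l' z') = csum \<phi>"
    proof (rule one_transposition_idle[OF \<phi>(1)])
      show "{a, b} \<notin> E" if "a \<in> {l, z}" "b \<in> {l', z'}" for a b
        using that z l v zq unfolding isolated_def leaf_at_def by (auto simp: insert_commute)
    qed (use dist v z in auto)
    then show ?thesis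
      using csum_swap_leaf_isolated[OF l(1) z(1) z(4), of \<phi>]
        csum_swap_leaf_isolated[OF l(2) z(2) z(5), of \<phi>] \<phi>(2) by auto
  qed
  have "card (V - {q}) \<ge> 4"
    using length_le_card[of "V - {q}" "[l, z, l', z']"] dist finV v z by auto
  then obtain u \<kappa> where u: "u \<in> V - {q}" "\<And>x. x \<in> V - {q} \<Longrightarrow> x \<noteq> u \<Longrightarrow> C {q, x} = \<kappa>"
    using const_but_one[of "V - {q}" "\<lambda>x. C {q, x}"] finV pairs by (metis finite_Diff)
  obtain \<phi> where \<phi>: "bij_betw \<phi> V V" "map \<phi> [q, z] = [q, u]"
    using ex_bij_extending[of V "[q, z]" "[q, u]"] finV u v z zq by auto
  have "csum \<phi> = 0"
  proof (rule csum_const[OF dvd])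
    fix e assume e: "e \<in> E"
    obtain a b where "e = {a, b}" "a \<noteq> b" "a \<in> V" "b \<in> V" using edge_cases[OF e] .
    then obtain g where g: "e = {q, g}" "g \<in> V" "g \<noteq> q" using q[OF e] by auto
    then have "g \<noteq> z" using z e unfolding isolated_def by (auto simp: insert_commute)
    then have "\<phi> g \<in> V" "\<phi> g \<noteq> \<phi> q" "\<phi> g \<noteq> \<phi> z"
      using g \<phi>(1) v z by (auto simp: bij_betw_def inj_on_eq_iff)
    then show "C (\<phi> ` e) = \<kappa>" using u(2)[of "\<phi> g"] \<phi>(2) g by auto
  qed
  then show False using no_zero[OF \<phi>(1)] by simp
qed

text \<open>Exchanging \<open>l\<close> with \<open>z\<close> is active exactly when the cherry at
  the image of \<open>p\<close> has two colours. So two disjoint two-coloured cherries do not exist,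
  and the isolated vertices can occupy the two vertices whose deletion leaves one colour.\<close>

lemma not_two_leaves_plus_two:
  assumes dvd: "3 dvd card E" and card: "card V \<ge> 8"
    and l: "leaf_at l p" "leaf_at l' p'" "p \<noteq> p'" "l \<noteq> p'" "l' \<noteq> p"
    and z: "isolated z" "isolated z'" "z \<noteq> z'" "z \<in> V" "z' \<in> V"
  shows False
proof -
  note v = leaf_at_verts[OF l(1)] leaf_at_verts[OF l(2)]
  have zq: "z \<noteq> p" "z' \<noteq> p" "z \<noteq> p'" "z' \<noteq> p'" "z \<noteq> l" "z' \<noteq> l" "z \<noteq> l'" "z' \<noteq> l'"
    using z v unfolding isolated_def by (metis insert_commute)+
  have "l \<noteq> l'" using l unfolding leaf_at_def by metis
  then have dist: "distinct [p, l, z, p', l', z']" using v l z zq by auto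
  have ch: "C {a, x} = C {a, y} \<or> C {b, s} = C {b, t}"
    if xy: "distinct [a, x, y, b, s, t]" "{a, x, y, b, s, t} \<subseteq> V" for a x y b s t
  proof -
    obtain \<phi> where \<phi>: "bij_betw \<phi> V V" "map \<phi> [p, l, z, p', l', z'] = [a, x, y, b, s, t]"
      using ex_bij_extending[of V "[p, l, z, p', l', z']" "[a, x, y, b, s, t]"] finV dist v z xy by auto
    have "csum (\<phi> \<circ> transpose l z) = csum \<phi> \<or> csum (\<phi> \<circ> transpose l' z') = csum \<phi>"
    proof (rule one_transposition_idle[OF \<phi>(1)])
      show "{a, b} \<notin> E" if "a \<in> {l, z}" "b \<in> {l', z'}" for a b
        using that z l v zq unfolding isolated_def leaf_at_def by (auto simp: insert_commute)
    qed (use dist v z in auto)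
    then show ?thesis
      using csum_swap_leaf_isolated[OF l(1) z(1) z(4), of \<phi>]
        csum_swap_leaf_isolated[OF l(2) z(2) z(5), of \<phi>] \<phi>(2) by auto
  qed
  have sym: "C {x, y} = C {y, x}" for x y by (simp add: insert_commute)
  obtain x y \<kappa> where xy: "x \<in> V" "y \<in> V" "x \<noteq> y"
    and \<kappa>: "\<And>g h. g \<in> V - {x, y} \<Longrightarrow> h \<in> V - {x, y} \<Longrightarrow> g \<noteq> h \<Longrightarrow> C {g, h} = \<kappa>"
    using const_off_two[of V "\<lambda>x y. C {x, y}", OF finV card sym ch] by blast
  obtain \<phi> where \<phi>: "bij_betw \<phi> V V" "map \<phi> [z, z'] = [x, y]"
    using ex_bij_extending[of V "[z, z']" "[x, y]"] finV xy z by auto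
  have "csum \<phi> = 0"
  proof (rule csum_const[OF dvd])
    fix e assume e: "e \<in> E"
    obtain a b where ab: "e = {a, b}" "a \<noteq> b" "a \<in> V" "b \<in> V" using edge_cases[OF e] .
    then have "a \<noteq> z" "b \<noteq> z" "a \<noteq> z'" "b \<noteq> z'"
      using z e unfolding isolated_def by (auto simp: insert_commute)
    then have "\<phi> a \<in> V - {\<phi> z, \<phi> z'}" "\<phi> b \<in> V - {\<phi> z, \<phi> z'}" "\<phi> a \<noteq> \<phi> b"
      using ab \<phi>(1) z by (auto simp: bij_betw_def inj_on_eq_iff)
    then show "C (\<phi> ` e) = \<kappa>" using \<kappa>[of "\<phi> a" "\<phi> b"] \<phi>(2) ab by auto
  qed
  then show False using no_zero[OF \<phi>(1)] by simp
qed

end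

section \<open>Rigidity next to an active pair of leaves\<close>

lemma z3_2_neq_0 [simp]: "(2::z3) \<noteq> 0"
  using of_nat_z3_eq_0_iff[of 2] by simp

text \<open>For distinct \<open>a\<close> and \<open>b\<close> the third residue is
  \<open>- (a + b)\<close>; the hypotheses exclude it and \<open>a\<close> as values of
  \<open>e\<close>.\<close>

lemma z3_third:
  fixes a b e :: z3
  assumes "a \<noteq> b" "a + e + a \<noteq> 0" "a + e + b \<noteq> 0"
  shows "e = b"
  using assms by (cases a; cases b; cases e) (simp_all add: z3_defs)

text \<open>Both \<open>s\<close> and \<open>t\<close> avoid the two residues \<open>- a\<close> and
  \<open>- b\<close>, which leaves a single value.\<close>

lemma z3_same_change:
  fixes a b s t :: z3
  assumes "a \<noteq> b" "a + s \<noteq> 0" "b + s \<noteq> 0" "a + t \<noteq> 0" "b + t \<noteq> 0"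
  shows "s = t"
  using assms by (cases a; cases b; cases s; cases t) (simp_all add: z3_defs)

context spanning_colouring
begin

text \<open>The last two inequations exclude the ends of an isolated edge, which are leaves
  supporting each other.\<close>

definition leaf_pair :: "'v \<Rightarrow> 'v \<Rightarrow> 'v \<Rightarrow> 'v \<Rightarrow> bool" where
  "leaf_pair l1 p1 l2 p2 \<longleftrightarrow> leaf_at l1 p1 \<and> leaf_at l2 p2 \<and> p1 \<noteq> p2 \<and> l1 \<noteq> p2 \<and> l2 \<noteq> p1"

lemma leaf_pair_distinct:
  assumes "leaf_pair l1 p1 l2 p2"
  shows "distinct [p1, p2, l1, l2]" "{p1, p2, l1, l2} \<subseteq> V"
  using assms leaf_at_verts[of l1 p1] leaf_at_verts[of l2 p2]
  unfolding leaf_pair_def by (auto simp: leaf_at_def)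

lemma leaf_pair_sym: "leaf_pair l1 p1 l2 p2 \<Longrightarrow> leaf_pair l2 p2 l1 p1"
  unfolding leaf_pair_def by auto

text \<open>The assumption of \<open>parallel_rows\<close> for the colouring \<open>C\<close>, as a
  proposition because it is reached by two different routes.\<close>

definition rows_parallel :: bool where
  "rows_parallel \<longleftrightarrow> (\<forall>a b u v r s. distinct [a, b, u, v, r, s] \<longrightarrow> {a, b, u, v, r, s} \<subseteq> V \<longrightarrow>
     alt (\<lambda>x y. C {x, y}) a b u v \<noteq> 0 \<longrightarrow> C {a, r} - C {a, s} = C {b, r} - C {b, s})"

end

context zero_sum_free
begin

text \<open>The only neighbours of \<open>l1\<close> and \<open>l2\<close> are \<open>p1\<close> and
  \<open>p2\<close>, so an exchange away from all four cannot interact with the exchange of the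
  leaves.\<close>

lemma active_pair_rigid:
  assumes lp: "leaf_pair l1 p1 l2 p2" and \<phi>: "bij_betw \<phi> V V"
    and act: "alt (\<lambda>x y. C {x, y}) (\<phi> p1) (\<phi> p2) (\<phi> l1) (\<phi> l2) \<noteq> 0"
    and xy: "x \<in> V" "y \<in> V" "x \<noteq> y" "x \<notin> {p1, p2, l1, l2}" "y \<notin> {p1, p2, l1, l2}"
  shows "csum (\<phi> \<circ> transpose x y) = csum \<phi>"
proof -
  have lf: "leaf_at l1 p1" "leaf_at l2 p2" "p1 \<noteq> p2" "l1 \<noteq> p2" "l2 \<noteq> p1"
    using lp unfolding leaf_pair_def by auto
  have "csum (\<phi> \<circ> transpose l1 l2) = csum \<phi> \<or> csum (\<phi> \<circ> transpose x y) = csum \<phi>"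
  proof (rule one_transposition_idle[OF \<phi>])
    show "{a, b} \<notin> E" if "a \<in> {l1, l2}" "b \<in> {x, y}" for a b
      using that xy lf unfolding leaf_at_def by auto
  qed (use leaf_pair_distinct[OF lp] xy in auto)
  then show ?thesis using csum_swap_leaves[OF lf, of \<phi>] act by auto
qed

text \<open>The exchange of \<open>x\<close> and \<open>y\<close> is idle both before and after
  swapping the images of \<open>p1\<close> and \<open>p2\<close>, since the swap only negates the
  4-cycle sum. Subtracting the two equations isolates the difference of the rows of \<open>a\<close>
  and \<open>b\<close>.\<close>

lemma parallel_rows_by_neighbours:
  assumes lp: "leaf_pair l1 p1 l2 p2"
    and xy: "x \<in> V" "y \<in> V" "x \<noteq> y" "x \<notin> {p1, p2, l1, l2}" "y \<notin> {p1, p2, l1, l2}"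
    and x: "{x, p1} \<in> E" "{x, p2} \<notin> E" and y: "\<not> ({y, p1} \<in> E \<and> {y, p2} \<notin> E)"
  shows rows_parallel
  unfolding rows_parallel_def
proof (intro allI impI)
  fix a b u v r s
  assume dist: "distinct [a, b, u, v, r, s]" and V: "{a, b, u, v, r, s} \<subseteq> V"
    and bad: "alt (\<lambda>x y. C {x, y}) a b u v \<noteq> 0"
  note d = leaf_pair_distinct[OF lp]
  define T where "T g = ind x g - ind y g" for g
  define rest where "rest \<psi> = (\<Sum>g\<in>V-{x,y}-{p1}-{p2}. T g * (C {s, \<psi> g} - C {r, \<psi> g}))" for \<psi>
  have eq: "T p1 * (C {s, \<psi> p1} - C {r, \<psi> p1}) + (T p2 * (C {s, \<psi> p2} - C {r, \<psi> p2}) + rest \<psi>) = 0"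
    if \<psi>: "bij_betw \<psi> V V" "\<psi> x = r" "\<psi> y = s"
      and "alt (\<lambda>x y. C {x, y}) (\<psi> p1) (\<psi> p2) (\<psi> l1) (\<psi> l2) \<noteq> 0" for \<psi>
  proof -
    have "csum (\<psi> \<circ> transpose x y) = csum \<psi>"
      using active_pair_rigid[OF lp \<psi>(1)] that xy by auto
    then have "(\<Sum>g\<in>V-{x,y}. T g * (C {s, \<psi> g} - C {r, \<psi> g})) = 0"
      using csum_transpose[of x y \<psi>] xy \<psi> unfolding T_def by simp
    moreover have "p1 \<in> V - {x, y}" "p2 \<in> V - {x, y} - {p1}" using d xy by auto
    ultimately show ?thesis
      unfolding rest_def using finV
      by (simp only: sum.remove[of "V - {x, y}" p1] sum.remove[of "V - {x, y} - {p1}" p2]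
        finite_Diff)
  qed
  obtain \<phi> where \<phi>: "bij_betw \<phi> V V" "map \<phi> [p1, p2, l1, l2, x, y] = [a, b, u, v, r, s]"
    using ex_bij_extending[of V "[p1, p2, l1, l2, x, y]" "[a, b, u, v, r, s]"] finV d xy dist V by auto
  define \<phi>' where "\<phi>' = \<phi> \<circ> transpose p1 p2"
  have \<phi>': "bij_betw \<phi>' V V" "\<phi>' p1 = b" "\<phi>' p2 = a" "\<phi>' l1 = u" "\<phi>' l2 = v" "\<phi>' x = r" "\<phi>' y = s"
    using \<phi> d xy bij_betw_transpose[OF \<phi>(1)] by (auto simp: \<phi>'_def transpose_def)
  \<comment> \<open>The two placements agree on every vertex other than \<open>p1\<close> and
    \<open>p2\<close>.\<close>
  have "rest \<phi>' = rest \<phi>"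
    unfolding rest_def by (intro sum.cong) (auto simp: \<phi>'_def transpose_def)
  moreover have "alt (\<lambda>x y. C {x, y}) b a u v \<noteq> 0"
    using bad unfolding alt_def by (auto simp: algebra_simps)
  ultimately have "T p1 * (C {s, b} - C {r, b}) + (T p2 * (C {s, a} - C {r, a}) + rest \<phi>) = 0"
    using eq[of \<phi>'] \<phi>' by simp
  moreover have "T p1 * (C {s, a} - C {r, a}) + (T p2 * (C {s, b} - C {r, b}) + rest \<phi>) = 0"
    using eq[of \<phi>] \<phi> bad by simp
  ultimately have "(T p1 - T p2) * ((C {s, a} - C {r, a}) - (C {s, b} - C {r, b})) = 0"
    by algebra
  \<comment> \<open>The vertex \<open>x\<close> contributes 1, and the condition on \<open>y\<close>
    says precisely that \<open>y\<close> does not contribute 1 as well.\<close>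
  moreover have "T p1 - T p2 \<noteq> 0"
    using x y unfolding T_def ind_def by (cases "{y, p1} \<in> E"; cases "{y, p2} \<in> E") simp_all
  ultimately have "(C {s, a} - C {r, a}) - (C {s, b} - C {r, b}) = 0" by simp
  then have "C {a, s} - C {a, r} = C {b, s} - C {b, r}" by (simp add: insert_commute)
  then show "C {a, r} - C {a, s} = C {b, r} - C {b, s}" by algebra
qed

text \<open>In a spider \<open>q\<close> is adjacent to both supports, so comparing neighbours gives
  nothing. The third leg supplies idle exchanges instead: its reversal, and the exchange of its end
  with \<open>q\<close>.\<close>

lemma parallel_rows_by_legs:
  assumes l: "leaf_at l1 p1" "leaf_at l2 p2" "leaf_at l3 p3"
    and p1: "\<And>g. {p1, g} \<in> E \<longleftrightarrow> g = l1 \<or> g = q" and p2: "\<And>g. {p2, g} \<in> E \<longleftrightarrow> g = l2 \<or> g = q"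
    and p3: "\<And>g. {p3, g} \<in> E \<longleftrightarrow> g = l3 \<or> g = q"
    and dist7: "distinct [p1, p2, l1, l2, q, p3, l3]"
  shows rows_parallel
  unfolding rows_parallel_def
proof (intro allI impI)
  let ?alt = "alt (\<lambda>x y. C {x, y})"
  have lp: "leaf_pair l1 p1 l2 p2" using l dist7 unfolding leaf_pair_def by auto
  have V7: "{p1, p2, l1, l2, q, p3, l3} \<subseteq> V"
    using leaf_at_verts[OF l(1)] leaf_at_verts[OF l(2)] leaf_at_verts[OF l(3)] p1[of q] edge_verts by blast
  \<comment> \<open>The centre sits at \<open>t\<close>, and the reversal of the third leg, placed
    on \<open>r, s\<close>, is idle.\<close>
  have const: "C {t, r} = C {t, s}"
    if h: "distinct [a, b, u, v, t, r, s]" "{a, b, u, v, t, r, s} \<subseteq> V" "?alt a b u v \<noteq> 0" for a b u v t r s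
  proof -
    obtain \<phi> where \<phi>: "bij_betw \<phi> V V" "map \<phi> [p1, p2, l1, l2, q, p3, l3] = [a, b, u, v, t, r, s]"
      using ex_bij_extending[of V "[p1, p2, l1, l2, q, p3, l3]" "[a, b, u, v, t, r, s]"]
        finV dist7 V7 h by auto
    have "csum (\<phi> \<circ> transpose p3 l3) = csum \<phi>"
      using active_pair_rigid[OF lp \<phi>(1), of p3 l3] \<phi>(2) that dist7 V7 by auto
    then show ?thesis using csum_reverse_leg[OF l(3) p3, of \<phi>] \<phi>(2) dist7 by auto
  qed
  \<comment> \<open>In the idle exchange of \<open>q\<close> and \<open>l3\<close> all neighbours
    off the 4-cycle cancel by \<open>const\<close>, so only \<open>p1\<close> and \<open>p2\<close>,
    placed at \<open>a\<close> and \<open>b\<close>, remain.\<close>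
  have opp: "(C {a, s} - C {a, r}) + (C {b, s} - C {b, r}) = 0"
    if h: "distinct [a, b, u, v, r, s]" "{a, b, u, v, r, s} \<subseteq> V" "?alt a b u v \<noteq> 0" for a b u v r s
  proof -
    obtain \<phi> where \<phi>: "bij_betw \<phi> V V" "map \<phi> [p1, p2, l1, l2, q, l3] = [a, b, u, v, r, s]"
      using ex_bij_extending[of V "[p1, p2, l1, l2, q, l3]" "[a, b, u, v, r, s]"]
        finV dist7 V7 h by auto
    have "csum (\<phi> \<circ> transpose q l3) = csum \<phi>"
      using active_pair_rigid[OF lp \<phi>(1), of q l3] \<phi>(2) that dist7 V7 by auto
    then have "(\<Sum>g\<in>V-{q,l3}. (ind q g - ind l3 g) * (C {s, \<phi> g} - C {r, \<phi> g})) = 0"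
      using csum_transpose[of q l3 \<phi>] \<phi>(2) dist7 V7 by auto
    also have "(\<Sum>g\<in>V-{q,l3}. (ind q g - ind l3 g) * (C {s, \<phi> g} - C {r, \<phi> g}))
      = (\<Sum>g\<in>{p1, p2}. (ind q g - ind l3 g) * (C {s, \<phi> g} - C {r, \<phi> g}))"
    proof (rule sum.mono_neutral_right)
      show "\<forall>g\<in>V - {q, l3} - {p1, p2}. (ind q g - ind l3 g) * (C {s, \<phi> g} - C {r, \<phi> g}) = 0"
      proof
        fix g assume g: "g \<in> V - {q, l3} - {p1, p2}"
        show "(ind q g - ind l3 g) * (C {s, \<phi> g} - C {r, \<phi> g}) = 0"
        proof (cases "g \<in> {l1, l2}")
          case True
          then have "ind q g = 0" "ind l3 g = 0"
            using ind_leaf[OF l(1)] ind_leaf[OF l(2)] ind_leaf[OF l(3)] ind_commute[of q g] dist7 by auto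
          then show ?thesis by simp
        next
          case False
          have inj: "inj_on \<phi> V" using \<phi>(1) by (simp add: bij_betw_def)
          have "\<phi> g \<notin> {\<phi> p1, \<phi> p2, \<phi> l1, \<phi> l2, \<phi> q, \<phi> l3}" "\<phi> g \<in> V"
            using g False V7 \<phi>(1) inj_on_eq_iff[OF inj, of g] by (auto simp: bij_betw_def)
          then have "C {\<phi> g, s} = C {\<phi> g, r}"
            using const[of a b u v "\<phi> g" s r] h \<phi>(2) by auto
          then show ?thesis by (simp add: insert_commute)
        qed
      qed
    qed (use finV V7 dist7 in auto)
    also have "\<dots> = (C {s, a} - C {r, a}) + (C {s, b} - C {r, b})"
    proof -
      have "ind q p1 = 1" "ind q p2 = 1"
        using p1[of q] p2[of q] by (simp_all add: ind_def insert_commute)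
      moreover have "ind l3 p1 = 0" "ind l3 p2 = 0"
        using ind_leaf[OF l(3)] dist7 by auto
      ultimately show ?thesis using dist7 \<phi>(2) by auto
    qed
    finally show ?thesis by (simp add: insert_commute)
  qed
  have cherry: "C {t, x} = C {t, y} \<or> C {t, x'} = C {t, y'}"
    if xy: "distinct [t, x, y, x', y']" "{t, x, y, x', y'} \<subseteq> V" for t x y x' y'
  proof -
    obtain \<phi> where \<phi>: "bij_betw \<phi> V V" "map \<phi> [q, p1, l1, p2, l2] = [t, x, y, x', y']"
      using ex_bij_extending[of V "[q, p1, l1, p2, l2]" "[t, x, y, x', y']"]
        finV dist7 V7 xy by auto
    have "csum (\<phi> \<circ> transpose p1 l1) = csum \<phi> \<or> csum (\<phi> \<circ> transpose p2 l2) = csum \<phi>"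
    proof (rule one_transposition_idle[OF \<phi>(1)])
      show "{a, b} \<notin> E" if "a \<in> {p1, l1}" "b \<in> {p2, l2}" for a b
        using that p1 l(1) dist7 unfolding leaf_at_def by auto
    qed (use dist7 V7 in auto)
    then show ?thesis
      using csum_reverse_leg[OF l(1) p1, of \<phi>] csum_reverse_leg[OF l(2) p2, of \<phi>] \<phi>(2) dist7 by auto
  qed
  fix a b u v r s
  assume dist: "distinct [a, b, u, v, r, s]" and V: "{a, b, u, v, r, s} \<subseteq> V"
    and bad: "?alt a b u v \<noteq> 0"
  define \<delta> where "\<delta> x = C {x, s} - C {x, r}" for x
  have ab: "\<delta> a + \<delta> b = 0" using opp[of a b u v r s] dist V bad by (simp add: \<delta>_def)
  have "\<delta> a = 0"
  proof (rule ccontr)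
    assume a0: "\<delta> a \<noteq> 0"
    then have b0: "\<delta> b \<noteq> 0" using ab by auto
    \<comment> \<open>Opposite corners of any nonzero 4-cycle have opposite \<open>\<delta>\<close>.
      Besides the given one, another 4-cycle on these points is nonzero, which makes
      \<open>\<delta> u\<close> nonzero too.\<close>
    have "?alt u v a b \<noteq> 0" using bad unfolding alt_def by (simp add: insert_commute algebra_simps)
    then have uv: "\<delta> u + \<delta> v = 0" using opp[of u v a b r s] dist V by (auto simp: \<delta>_def)
    have "?alt a u b v \<noteq> 0 \<or> ?alt a v b u \<noteq> 0"
    proof (rule ccontr)
      assume "\<not> ?thesis"
      then have "C {a, b} + C {u, v} = C {a, v} + C {b, u}" "C {a, b} + C {u, v} = C {a, u} + C {b, v}"
        unfolding alt_def by (simp_all add: insert_commute algebra_simps)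
      then have "?alt a b u v = 0" unfolding alt_def by algebra
      then show False using bad by simp
    qed
    then have "\<delta> a + \<delta> u = 0 \<or> \<delta> a + \<delta> v = 0"
      using opp[of a u b v r s] opp[of a v b u r s] dist V by (auto simp: \<delta>_def)
    then have u0: "\<delta> u \<noteq> 0" using uv a0 by auto
    obtain t where t: "t \<in> V" "t \<notin> set [a, b, u, v, r, s]"
      using ex_not_in_list[of V "[a, b, u, v, r, s]"] finV length_le_card[OF finV dist7] V7 by auto
    define \<kappa> where "\<kappa> = C {r, s}"
    have \<kappa>: "C {r, t} = \<kappa>" "C {s, t} = \<kappa>" "C {s, r} = \<kappa>"
      using const[of a b u v r t s] const[of a b u v s t r] dist V bad t
      by (auto simp: \<kappa>_def insert_commute)
    have "C {x, r} \<noteq> \<kappa> \<or> C {x, s} \<noteq> \<kappa>" if "\<delta> x \<noteq> 0" for x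
      using that by (auto simp: \<delta>_def)
    then have "C {a, r} \<noteq> \<kappa> \<or> C {a, s} \<noteq> \<kappa>" "C {b, r} \<noteq> \<kappa> \<or> C {b, s} \<noteq> \<kappa>" "C {u, r} \<noteq> \<kappa> \<or> C {u, s} \<noteq> \<kappa>"
      using a0 b0 u0 by blast+
    \<comment> \<open>Pigeonhole: each of \<open>a, b, u\<close> has an edge to \<open>r\<close> or
      \<open>s\<close> of colour other than \<open>\<kappa>\<close>, so two of them share the end
      \<open>z\<close>. Two leg reversals with centre at \<open>z\<close> would then both be
      active.\<close>
    then obtain x y z where xyz: "z \<in> {r, s}" "(x, y) \<in> {(a, b), (a, u), (b, u)}"
      "C {x, z} \<noteq> \<kappa>" "C {y, z} \<noteq> \<kappa>" by blast
    define z' where "z' = (if z = r then s else r)"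
    have "C {z, t} = \<kappa>" "C {z, z'} = \<kappa>" using xyz(1) \<kappa> by (auto simp: z'_def \<kappa>_def)
    moreover have "C {z, x} = C {z, t} \<or> C {z, y} = C {z, z'}"
      using xyz(1,2) dist V t by (intro cherry) (auto simp: z'_def)
    ultimately show False using xyz(3,4) by (auto simp: insert_commute)
  qed
  then have "\<delta> a = 0" "\<delta> b = 0" using ab by auto
  then show "C {a, r} - C {a, s} = C {b, r} - C {b, s}" by (simp add: \<delta>_def)
qed

text \<open>On five points, a vertex with edges of two colours has exactly one exceptional edge, say
  to \<open>u\<close>, of colour \<open>\<beta>\<close>. This forces \<open>\<beta>\<close> on the
  triangle of the other three points and on an edge from \<open>u\<close> to it, hence on a whole
  path.\<close>

lemma not_path4_plus_one:
  assumes E: "E = {{l1, p1}, {p1, p2}, {p2, l2}}" and dist: "distinct [l1, p1, p2, l2, z]" and z: "z \<in> V"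
  shows False
proof -
  have V: "{l1, p1, p2, l2, z} \<subseteq> V" using E z edge_verts by blast
  have path: "C {x, y} + C {y, s} + C {s, t} \<noteq> 0"
    if h: "distinct [x, y, s, t]" "{x, y, s, t} \<subseteq> V" for x y s t
  proof -
    obtain \<phi> where \<phi>: "bij_betw \<phi> V V" "map \<phi> [l1, p1, p2, l2] = [x, y, s, t]"
      using ex_bij_extending[of V "[l1, p1, p2, l2]" "[x, y, s, t]"] finV dist V h by auto
    have "csum \<phi> = C {x, y} + (C {y, s} + C {s, t})"
      unfolding csum_def E using \<phi>(2) dist by (subst sum.insert; auto simp: doubleton_eq_iff)
    then show ?thesis using no_zero[OF \<phi>(1)] by (simp add: add.assoc)
  qed
  have pairs: "C {v, x} = C {v, y} \<or> C {v, s} = C {v, t}"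
    if h: "distinct [v, x, y, s, t]" "{v, x, y, s, t} \<subseteq> V" for v x y s t
  proof (rule ccontr)
    assume ne: "\<not> ?thesis"
    \<comment> \<open>Four paths through \<open>v\<close>: the first edge takes two colours, so the
      remaining two edges, traversed in either order of \<open>s\<close> and \<open>t\<close>, must
      have the same sum.\<close>
    have "C {x, v} + C {v, s} + C {s, t} \<noteq> 0" "C {y, v} + C {v, s} + C {s, t} \<noteq> 0"
      "C {x, v} + C {v, t} + C {t, s} \<noteq> 0" "C {y, v} + C {v, t} + C {t, s} \<noteq> 0"
      using h by (intro path; auto)+
    then have "C {v, s} + C {s, t} = C {v, t} + C {s, t}"
      using ne by (intro z3_same_change[of "C {v, x}" "C {v, y}"])
        (auto simp: insert_commute add.assoc)
    then show False using ne by simp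
  qed
  show False
  proof (cases "\<exists>v u x. distinct [v, u, x] \<and> {v, u, x} \<subseteq> {l1, p1, p2, l2, z} \<and> C {v, u} \<noteq> C {v, x}")
    case False
    have ch: "C {v, u} = C {v, x}" if "distinct [v, u, x]" "{v, u, x} \<subseteq> {l1, p1, p2, l2, z}" for v u x
      using False that by blast
    have "C {p1, l1} = C {p1, p2}" "C {p2, p1} = C {p2, l2}"
      using dist by (intro ch; auto)+
    then have "C {l1, p1} = C {p1, p2}" "C {p1, p2} = C {p2, l2}"
      by (simp_all add: insert_commute)
    then show False using path[of l1 p1 p2 l2] dist V by simp
  next
    case True
    then obtain v u x where vux: "distinct [v, u, x]" "{v, u, x} \<subseteq> {l1, p1, p2, l2, z}" "C {v, u} \<noteq> C {v, x}"
      by blast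
    have five: "card {l1, p1, p2, l2, z} = 5" using dist by simp
    obtain s where s: "s \<in> {l1, p1, p2, l2, z}" "s \<notin> set [v, u, x]"
      using ex_not_in_list[of "{l1, p1, p2, l2, z}" "[v, u, x]"] five by auto
    obtain t where t: "t \<in> {l1, p1, p2, l2, z}" "t \<notin> set [v, u, x, s]"
      using ex_not_in_list[of "{l1, p1, p2, l2, z}" "[v, u, x, s]"] five by auto
    have d5: "distinct [v, u, x, s, t]" using vux s t by auto
    have V5: "{v, u, x, s, t} \<subseteq> V" using vux s t V by auto
    have main: False if d5: "distinct [v, u, x, s, t]" and V5: "{v, u, x, s, t} \<subseteq> V"
      and \<alpha>: "C {v, x} = \<alpha>" "C {v, s} = \<alpha>" "C {v, t} = \<alpha>" and ne: "C {v, u} \<noteq> \<alpha>" for v u x s t \<alpha>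
    proof -
      define \<beta> where "\<beta> = C {v, u}"
      have tri: "C {y', z'} = \<beta>" if "distinct [v, u, x', y', z']" "{x', y', z'} \<subseteq> {x, s, t}" for x' y' z'
      proof (rule z3_third[of \<alpha>])
        have c: "C {v, x'} = \<alpha>" "C {v, y'} = \<alpha>" using that \<alpha> by auto
        have "C {x', v} + C {v, y'} + C {y', z'} \<noteq> 0" "C {u, v} + C {v, y'} + C {y', z'} \<noteq> 0"
          using that V5 by (intro path; auto)+
        then show "\<alpha> + C {y', z'} + \<alpha> \<noteq> 0" "\<alpha> + C {y', z'} + \<beta> \<noteq> 0"
          using c by (simp_all add: \<beta>_def insert_commute algebra_simps)
        show "\<alpha> \<noteq> \<beta>" using ne by (simp add: \<beta>_def)
      qed
      have xs: "C {x, s} = \<beta>" "C {x, t} = \<beta>" "C {s, t} = \<beta>"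
        using tri[of t x s] tri[of s x t] tri[of x s t] d5 by auto
      have "C {x, v} = C {x, s} \<or> C {x, t} = C {x, u}"
        using d5 V5 by (intro pairs) auto
      then have "C {u, x} = \<beta>" using xs \<alpha> ne by (auto simp: \<beta>_def insert_commute)
      then show False using path[of u x s t] xs d5 V5 by simp
    qed
    \<comment> \<open>The condition at \<open>v\<close> decides which of its four edges is
      exceptional: the one to \<open>x\<close> or the one to \<open>u\<close>.\<close>
    show False
    proof (cases "C {v, s} = C {v, u}")
      case True
      then have "C {v, t} = C {v, u}"
        using pairs[of v x s t u] vux d5 V5 by auto
      then show False using main[of v x u s t "C {v, u}"] True vux d5 V5 by auto
    next
      case False
      have xt: "C {v, t} = C {v, x}" using pairs[of v s u x t] False d5 V5 by auto
      have xs: "C {v, s} = C {v, x}"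
        using pairs[of v t u x s] xt vux d5 V5 by auto
      show False by (rule main[OF d5 V5 refl xs xt vux(3)])
    qed
  qed
qed

end

section \<open>Leaves of forests\<close>

lemma forest_subset:
  assumes "forest (V, E)" "E' \<subseteq> E"
  shows "forest (V, E')"
  using assms unfolding forest_def simple_graph_def cycle_in_def by fastforce

text \<open>The two ends of a longest path are leaves.\<close>
lemma forest_two_leaves:
  fixes E :: "'v set set"
  assumes F: "forest (V, E)" and ne: "E \<noteq> {}"
  obtains x p y q where "x \<noteq> y" "\<And>g. {x, g} \<in> E \<longleftrightarrow> g = p" "\<And>g. {y, g} \<in> E \<longleftrightarrow> g = q"
proof -
  have finV: "finite V" and edge: "\<And>x y. {x, y} \<in> E \<Longrightarrow> x \<in> V \<and> y \<in> V \<and> x \<noteq> y"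
    and card2: "\<And>e. e \<in> E \<Longrightarrow> card e = 2"
    and nocyc: "\<And>c. \<not> cycle_in (V, E) c"
    using F unfolding forest_def simple_graph_def by fastforce+
  define P where "P xs \<longleftrightarrow> length xs \<ge> 2 \<and> distinct xs \<and> (\<forall>i. Suc i < length xs \<longrightarrow> {xs ! i, xs ! Suc i} \<in> E)"
    for xs
  have sub: "set xs \<subseteq> V" if "P xs" for xs
  proof
    fix x assume "x \<in> set xs"
    then obtain i where i: "i < length xs" "xs ! i = x" by (auto simp: in_set_conv_nth)
    show "x \<in> V"
    proof (cases "Suc i < length xs")
      case True then show ?thesis using \<open>P xs\<close> i edge unfolding P_def by blast
    next
      case False
      then obtain j where "i = Suc j" using i \<open>P xs\<close> unfolding P_def by (cases i) auto
      then show ?thesis using \<open>P xs\<close> i edge unfolding P_def by blast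
    qed
  qed
  have bound: "length xs < Suc (card V)" if "P xs" for xs
    using length_le_card[OF finV _ sub[OF that]] that unfolding P_def by auto
  obtain a b where ab: "{a, b} \<in> E" "a \<noteq> b" using ne card2 by (metis card_2_iff ex_in_conv)
  have "P [a, b]" using ab unfolding P_def by (auto simp: less_Suc_eq)
  then obtain xs where xs: "P xs" and max: "\<And>ys. P ys \<Longrightarrow> length ys \<le> length xs"
    using ex_has_greatest_nat[of P "[a, b]" length "Suc (card V)"] bound by blast
  have end_leaf: "{ys ! 0, g} \<in> E \<longleftrightarrow> g = ys ! 1" if ys: "P ys" "length ys = length xs" for ys g
  proof
    assume "g = ys ! 1"
    then show "{ys ! 0, g} \<in> E" using ys unfolding P_def by auto
  next
    assume g: "{ys ! 0, g} \<in> E"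
    show "g = ys ! 1"
    proof (rule ccontr)
      assume g1: "g \<noteq> ys ! 1"
      have len: "length ys \<ge> 2" and dist: "distinct ys"
        and path: "\<And>i. Suc i < length ys \<Longrightarrow> {ys ! i, ys ! Suc i} \<in> E"
        using ys unfolding P_def by auto
      show False
      proof (cases "g \<in> set ys")
        case False
        have "P (g # ys)"
          unfolding P_def
        proof (intro conjI allI impI)
          fix i assume "Suc i < length (g # ys)"
          then show "{(g # ys) ! i, (g # ys) ! Suc i} \<in> E"
            using path[of "i - 1"] g by (cases i) (auto simp: insert_commute)
        qed (use len dist False in auto)
        then show False using max[of "g # ys"] ys by simp
      next
        case True
        then obtain j where j: "j < length ys" "ys ! j = g" by (auto simp: in_set_conv_nth)
        have "j \<noteq> 0" using edge[OF g] j by (metis)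
        moreover have "j \<noteq> 1" using g1 j by auto
        ultimately have j2: "j \<ge> 2" by simp
        have "cycle_in (V, E) (take (Suc j) ys)"
          unfolding cycle_in_def
        proof (intro conjI allI impI)
          show "set (take (Suc j) ys) \<subseteq> uverts (V, E)"
            using sub[OF ys(1)] set_take_subset[of "Suc j" ys] by auto
          fix i assume i: "i < length (take (Suc j) ys)"
          show "{take (Suc j) ys ! i, take (Suc j) ys ! (Suc i mod length (take (Suc j) ys))} \<in> uedges (V, E)"
          proof (cases "i = j")
            case True
            then show ?thesis using j g len by (simp add: min_absorb2 insert_commute)
          next
            case False
            then show ?thesis using i j path[of i] by (simp add: min_absorb2)
          qed
        qed (use j j2 dist in auto)
        then show False using nocyc by blast
      qed
    qed
  qed
  have len: "length xs \<ge> 2" "distinct xs" using xs unfolding P_def by auto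
  have rev: "P (rev xs)"
    unfolding P_def
  proof (intro conjI allI impI)
    fix i assume i: "Suc i < length (rev xs)"
    then have "{xs ! (length xs - Suc (Suc i)), xs ! Suc (length xs - Suc (Suc i))} \<in> E"
      using xs unfolding P_def by auto
    then show "{rev xs ! i, rev xs ! Suc i} \<in> E"
      using i by (simp add: rev_nth insert_commute Suc_diff_Suc)
  qed (use len in auto)
  have "0 < length xs" "0 \<noteq> length xs - 1" "length xs - 1 < length xs" using len by linarith+
  then have "xs ! 0 \<noteq> rev xs ! 0"
    using nth_eq_iff_index_eq[OF len(2), of 0 "length xs - 1"] rev_nth[of 0 xs] by simp
  then show ?thesis
    using that[of "xs ! 0" "rev xs ! 0" "xs ! 1" "rev xs ! 1"] end_leaf[OF xs refl]
      end_leaf[OF rev length_rev] by blast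
qed

context spanning_colouring
begin

lemma edge_through:
  assumes "e \<in> E" "x \<in> e" obtains g where "e = {x, g}" "g \<noteq> x"
  using edge_cases[OF assms(1)] assms(2) by (metis empty_iff insert_commute insert_iff)

lemma deg_leaf: "leaf_at l p \<Longrightarrow> deg G l = 1"
proof -
  assume l: "leaf_at l p"
  have "{e \<in> E. l \<in> e} = {{l, p}}"
  proof
    show "{e \<in> E. l \<in> e} \<subseteq> {{l, p}}"
    proof
      fix e assume e: "e \<in> {e \<in> E. l \<in> e}"
      then obtain g where "e = {l, g}" using edge_through by blast
      then show "e \<in> {{l, p}}" using e l unfolding leaf_at_def by auto
    qed
    show "{{l, p}} \<subseteq> {e \<in> E. l \<in> e}" using leaf_at_verts[OF l] by auto
  qed
  then show ?thesis unfolding deg_def by simp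
qed

lemma deg_ge_2_neighbours:
  assumes "deg G x \<ge> 2"
  obtains g h where "g \<noteq> h" "{x, g} \<in> E" "{x, h} \<in> E"
proof -
  obtain e where e: "e \<in> E" "x \<in> e"
    using assms unfolding deg_def by (metis (mono_tags, lifting) Collect_empty_eq card.empty not_numeral_le_zero)
  have "card {e \<in> E. x \<in> e} \<noteq> card {e}" using assms unfolding deg_def by simp
  then have "{e \<in> E. x \<in> e} \<noteq> {e}" by metis
  then obtain e' where e': "e' \<in> E" "x \<in> e'" "e' \<noteq> e" using e by blast
  obtain g h where "e = {x, g}" "e' = {x, h}" using edge_through e e' by metis
  then show ?thesis using that[of g h] e e' by auto
qed

lemma deg_le_card:
  assumes "\<And>g. {x, g} \<in> E \<Longrightarrow> g \<in> N" "finite N"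
  shows "deg G x \<le> card N"
proof -
  have "{e \<in> E. x \<in> e} \<subseteq> (\<lambda>g. {x, g}) ` N"
  proof
    fix e assume e: "e \<in> {e \<in> E. x \<in> e}"
    then obtain g where "e = {x, g}" using edge_through by blast
    then show "e \<in> (\<lambda>g. {x, g}) ` N" using e assms(1) by blast
  qed
  then have "deg G x \<le> card ((\<lambda>g. {x, g}) ` N)"
    unfolding deg_def using assms(2) by (intro card_mono) auto
  also have "\<dots> \<le> card N" using assms(2) by (rule card_image_le)
  finally show ?thesis .
qed

end

locale forest_colouring = spanning_colouring +
  assumes forest: "forest G"
begin

text \<open>Of the two leaves of the subforest one differs from \<open>v\<close>; callers with
  nothing to avoid pass \<open>undefined\<close>. The edge set \<open>E'\<close> is chosen in each
  use so that the leaf can be controlled in the whole forest.\<close>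

lemma sub_leaf:
  assumes "E' \<subseteq> E" "E' \<noteq> {}"
  obtains y p where "y \<noteq> v" "\<And>g. {y, g} \<in> E' \<longleftrightarrow> g = p"
proof -
  have "forest (V, E')" using forest_subset[of V E E'] forest assms by simp
  then show ?thesis
    using forest_two_leaves[OF _ assms(2), of V] that by metis
qed

lemma no_triangle:
  assumes "{x, y} \<in> E" "{y, z} \<in> E" shows "{x, z} \<notin> E"
proof
  assume xz: "{x, z} \<in> E"
  then have zx: "{z, x} \<in> E" by (simp add: insert_commute)
  have "cycle_in G [x, y, z]"
    unfolding cycle_in_def
  proof (intro conjI allI impI)
    fix i assume "i < length [x, y, z]"
    then have "i = 0 \<or> i = 1 \<or> i = 2" by (simp, linarith)
    then show "{[x, y, z] ! i, [x, y, z] ! (Suc i mod length [x, y, z])} \<in> E"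
      using assms zx by (elim disjE) simp_all
  qed (use edge_verts[OF assms(1)] edge_verts[OF assms(2)] edge_verts[OF xz] in simp_all)
  then show False using forest unfolding forest_def by blast
qed

lemma no_square:
  assumes "{x, y} \<in> E" "{y, z} \<in> E" "{z, t} \<in> E" "{t, x} \<in> E" shows "x = z \<or> y = t"
proof (rule ccontr)
  assume "\<not> ?thesis"
  then have "x \<noteq> z" "y \<noteq> t" by auto
  have "cycle_in G [x, y, z, t]"
    unfolding cycle_in_def
  proof (intro conjI allI impI)
    fix i assume "i < length [x, y, z, t]"
    then have "i = 0 \<or> i = 1 \<or> i = 2 \<or> i = 3" by (simp, linarith)
    then show "{[x, y, z, t] ! i, [x, y, z, t] ! (Suc i mod length [x, y, z, t])} \<in> E"
      using assms by (elim disjE) simp_all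
  qed (use \<open>x \<noteq> z\<close> \<open>y \<noteq> t\<close> edge_verts[OF assms(1)] edge_verts[OF assms(2)]
      edge_verts[OF assms(3)] edge_verts[OF assms(4)] in auto)
  then show False using forest unfolding forest_def by blast
qed

text \<open>Discard the edges both of whose ends have degree at most 1, that is, the isolated edges.
  A vertex of degree at least 2 keeps all its edges, so a leaf of the rest is a genuine leaf and its
  support branches.\<close>

lemma ex_leaf_with_branching_support:
  assumes "deg G x \<ge> 2"
  obtains l p h where "leaf_at l p" "{p, h} \<in> E" "h \<noteq> l"
proof -
  define B where "B x \<longleftrightarrow> (\<exists>g h. g \<noteq> h \<and> {x, g} \<in> E \<and> {x, h} \<in> E)" for x
  define E' where "E' = {e \<in> E. \<exists>x\<in>e. B x}"
  obtain g h where gh: "g \<noteq> h" "{x, g} \<in> E" "{x, h} \<in> E" using deg_ge_2_neighbours[OF assms] .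
  then have "{x, g} \<in> E'" unfolding E'_def B_def by auto
  then obtain l p where l: "\<And>g. {l, g} \<in> E' \<longleftrightarrow> g = p"
    using sub_leaf[of E' undefined] unfolding E'_def by (metis (no_types, lifting) empty_iff mem_Collect_eq subsetI)
  have lp: "{l, p} \<in> E'" using l by blast
  have "\<not> B l"
  proof
    assume "B l"
    then obtain g h where "g \<noteq> h" "{l, g} \<in> E'" "{l, h} \<in> E'"
      unfolding B_def E'_def by auto
    then show False using l[of g] l[of h] by simp
  qed
  then have leaf: "leaf_at l p" using lp unfolding leaf_at_def E'_def B_def by blast
  have "B p" using lp \<open>\<not> B l\<close> unfolding E'_def by auto
  then obtain h where "{p, h} \<in> E" "h \<noteq> l" unfolding B_def by metis
  then show ?thesis using that leaf by blast
qed

text \<open>Delete the pendant edges at \<open>p1\<close>. A leaf \<open>y\<close> of the rest other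
  than \<open>p1\<close> has lost no edge, since a deleted edge joins \<open>p1\<close> to one of
  its leaves; and \<open>y\<close> does not hang at \<open>p1\<close>.\<close>

lemma ex_leaf_pair:
  assumes l: "leaf_at l1 p1" and e: "e \<in> E" "p1 \<notin> e"
  obtains l2 p2 where "leaf_pair l1 p1 l2 p2"
proof -
  define E' where "E' = {e \<in> E. \<forall>x\<in>e. \<not> leaf_at x p1}"
  have "e \<in> E'"
  proof -
    have "\<not> leaf_at x p1" if "x \<in> e" for x
      using edge_through[OF e(1) that] e unfolding leaf_at_def by (metis insertI1 insert_commute)
    then show ?thesis using e by (simp add: E'_def)
  qed
  then obtain y p2 where y: "y \<noteq> p1" "\<And>g. {y, g} \<in> E' \<longleftrightarrow> g = p2"
    using sub_leaf[of E' p1] unfolding E'_def by (metis (no_types, lifting) empty_iff mem_Collect_eq subsetI)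
  have yp: "{y, p2} \<in> E" "\<not> leaf_at y p1" "\<not> leaf_at p2 p1" using y(2)[of p2] unfolding E'_def by auto
  have "g = p2" if g: "{y, g} \<in> E" for g
  proof -
    have "\<not> leaf_at g p1" using g y(1) unfolding leaf_at_def by (metis insert_commute)
    then show ?thesis using y(2)[of g] g yp(2) unfolding E'_def by auto
  qed
  then have "leaf_at y p2" using yp(1) unfolding leaf_at_def by blast
  then have "leaf_pair l1 p1 y p2"
    using l y(1) yp unfolding leaf_pair_def by auto
  then show ?thesis using that by blast
qed

text \<open>Exchanging \<open>l\<close> with \<open>l'\<close> will move an exceptional edge out of
  the copy without touching the degree sum, while \<open>x\<close> and \<open>y\<close> change the
  degree sum. If this were impossible, all vertices except \<open>l1\<close> and \<open>l2\<close>
  would share the residue of \<open>f0\<close>, so the nonisolated ones would have degree at least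
  3; but a leaf of the forest without \<open>l1\<close> and \<open>l2\<close> has degree at most
  2.\<close>

lemma ex_swap_positions:
  assumes lp: "leaf_pair l1 p1 l2 p2" and card: "card V \<ge> 6"
    and f0: "f0 \<in> V" "deg G f0 mod 3 = 0"
  obtains l p l' x y where "leaf_at l p" "deg G l' mod 3 = 1" "{p, l'} \<notin> E"
    "distinct [p, l, l', x, y]" "{p, l, l', x, y} \<subseteq> V" "deg G x mod 3 \<noteq> deg G y mod 3"
proof (rule ccontr)
  assume no: "\<not> thesis"
  note witness = that
  note d = leaf_pair_distinct[OF lp]
  have lf: "leaf_at l1 p1" "leaf_at l2 p2" "p1 \<noteq> p2" "l1 \<noteq> p2" "l2 \<noteq> p1"
    using lp unfolding leaf_pair_def by auto
  have dl: "deg G l1 mod 3 = 1" "deg G l2 mod 3 = 1" using lf(1,2)[THEN deg_leaf] by simp_all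
  have "{p1, l2} \<notin> E" "{p2, l1} \<notin> E" using lf unfolding leaf_at_def by (auto simp: insert_commute)
  then have same: "deg G x mod 3 = deg G y mod 3"
    if "x \<in> V" "y \<in> V" "x \<notin> {l1, l2}" "y \<notin> {l1, l2}" "p1 \<notin> {x, y} \<or> p2 \<notin> {x, y}" for x y
    using that no d dl lf witness[of l1 p1 l2 x y] witness[of l2 p2 l1 x y]
    by (cases "x = y") auto
  obtain t where t: "t \<in> V" "t \<notin> set [p1, p2, l1, l2]"
    using ex_not_in_list[of V "[p1, p2, l1, l2]"] finV card by auto
  have "deg G x mod 3 = deg G t mod 3" if "x \<in> V" "x \<notin> {l1, l2}" for x
    using same[of x t] that t lf(3) by auto
  moreover have "f0 \<notin> {l1, l2}" using f0 dl by auto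
  ultimately have zero: "deg G x mod 3 = 0" if "x \<in> V" "x \<notin> {l1, l2}" for x
    using that f0 by metis
  have ge3: "deg G x \<ge> 3" if "{x, g} \<in> E" "x \<notin> {l1, l2}" for x g
  proof -
    have "{x, g} \<in> {e \<in> E. x \<in> e}" using that by simp
    then have "deg G x \<noteq> 0" unfolding deg_def using finE by (auto simp: card_eq_0_iff)
    moreover have "x \<in> V" using edge_verts[OF that(1)] by blast
    ultimately show ?thesis using zero[of x] that(2) by auto
  qed
  define E' where "E' = {e \<in> E. l1 \<notin> e \<and> l2 \<notin> e}"
  have "deg G p1 \<ge> 2" using ge3[of p1 l1] leaf_at_verts[OF lf(1)] d by (auto simp: insert_commute)
  then obtain g h where "g \<noteq> h" "{p1, g} \<in> E" "{p1, h} \<in> E" using deg_ge_2_neighbours by blast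
  then obtain g where g: "g \<noteq> l1" "{p1, g} \<in> E" by metis
  have "g \<noteq> l2" using g(2) lf unfolding leaf_at_def by (auto simp: insert_commute)
  then have "{p1, g} \<in> E'" using g d unfolding E'_def by auto
  then obtain y p where y: "\<And>g. {y, g} \<in> E' \<longleftrightarrow> g = p"
    using sub_leaf[of E' undefined] unfolding E'_def by (metis (no_types, lifting) empty_iff mem_Collect_eq subsetI)
  have yp: "{y, p} \<in> E" "y \<notin> {l1, l2}" using y[of p] unfolding E'_def by auto
  \<comment> \<open>Besides its neighbour \<open>p\<close> in the subforest, \<open>y\<close> can
    only be adjacent to one of the two deleted leaves, because their supports differ.\<close>
  define N where "N = (if y = p1 then {p, l1} else {p, l2})"
  have "g \<in> N" if "{y, g} \<in> E" for g
  proof (cases "{y, g} \<in> E'")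
    case True then show ?thesis using y by (auto simp: N_def)
  next
    case False
    then have "g = l1 \<or> g = l2" using that yp unfolding E'_def by auto
    then show ?thesis using that lf unfolding leaf_at_def N_def by (auto simp: insert_commute)
  qed
  moreover have "finite N" by (auto simp: N_def)
  moreover have "card N \<le> 2" by (auto simp: N_def card_insert_if)
  ultimately have "deg G y \<le> 2" using deg_le_card[of y N] by auto
  then show False using ge3[OF yp] by simp
qed

end

section \<open>Forests with a vertex of degree divisible by 3\<close>

lemma z3_nonzero_cases:
  fixes a b e :: z3
  shows "a \<noteq> 0 \<Longrightarrow> b \<noteq> 0 \<Longrightarrow> a + b \<noteq> 0 \<Longrightarrow> a = b"
    and "a \<noteq> 0 \<Longrightarrow> e \<noteq> 0 \<Longrightarrow> a + e = 0 \<or> a + a + e = 0"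
    and "a \<noteq> 0 \<Longrightarrow> a \<noteq> 1 \<Longrightarrow> a = - 1"
  by (cases a; cases b; cases e; simp add: z3_defs)+

locale zero_sum_free_forest = zero_sum_free G C + forest_colouring G C
  for G :: "'v ugraph" and C :: "'v set \<Rightarrow> z3"
begin

text \<open>Away from \<open>a\<close> and \<open>b\<close> the weights turn out constant, so the
  colour sum depends only on which vertices occupy \<open>a\<close> and \<open>b\<close>. Trying
  suitable pairs restricts the degrees until two of the resulting inequalities contradict each
  other.\<close>

lemma not_weighted_but_one_edge:
  assumes dvd: "3 dvd card E" and card: "card V \<ge> 6"
    and f0: "f0 \<in> V" "deg G f0 mod 3 = 0" and fx: "fx \<in> V" "deg G fx mod 3 \<noteq> 1" "fx \<noteq> f0"
    and lp: "leaf_pair l1 p1 l2 p2"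
    and weighted: "weighted_but_one_edge V (\<lambda>x y. C {x, y})"
  shows False
proof -
  let ?d = "\<lambda>x. of_nat (deg G x) :: z3"
  obtain w a b \<epsilon> where ab: "a \<in> V" "b \<in> V" "a \<noteq> b" and \<epsilon>: "\<epsilon> \<noteq> 0"
    and w: "\<And>x y. x \<in> V \<Longrightarrow> y \<in> V \<Longrightarrow> x \<noteq> y \<Longrightarrow>
      C {x, y} = w x + w y + (if {x, y} = {a, b} then \<epsilon> else 0)"
    using weighted unfolding weighted_but_one_edge_def by blast
  have cs: "csum \<phi> = wsum w \<phi> + (if {\<alpha>, \<beta>} \<in> E then \<epsilon> else 0)"
    if "bij_betw \<phi> V V" "\<alpha> \<in> V" "\<beta> \<in> V" "\<phi> \<alpha> = a" "\<phi> \<beta> = b" for \<phi> \<alpha> \<beta>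
  proof -
    have "\<alpha> \<noteq> \<beta>" using that ab by auto
    then show ?thesis using csum_weighted[of \<phi> \<alpha> \<beta> w \<epsilon>] that w unfolding wsum_def by auto
  qed
  \<comment> \<open>Otherwise the weight change \<open>\<eta>\<close> of exchanging \<open>x\<close>
    and \<open>y\<close> and the loss of \<open>\<epsilon>\<close> by exchanging \<open>l\<close>
    and \<open>l'\<close> are independent.\<close>
  have const: "w r = w s" if rs: "r \<in> V - {a, b}" "s \<in> V - {a, b}" for r s
  proof (rule ccontr)
    assume ne: "w r \<noteq> w s"
    obtain l p l' x y where lf: "leaf_at l p" and l': "deg G l' mod 3 = 1" "{p, l'} \<notin> E"
      and dist: "distinct [p, l, l', x, y]" and V: "{p, l, l', x, y} \<subseteq> V"
      and xy: "deg G x mod 3 \<noteq> deg G y mod 3"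
      using ex_swap_positions[OF lp card f0] .
    obtain \<phi> where \<phi>: "bij_betw \<phi> V V" "map \<phi> [p, l, x, y] = [a, b, r, s]"
      using ex_bij_extending[of V "[p, l, x, y]" "[a, b, r, s]"] finV dist V rs ne ab by auto
    define \<eta> where "\<eta> = (?d x - ?d y) * (w s - w r)"
    have "\<eta> \<noteq> 0" using xy ne by (simp add: \<eta>_def of_nat_z3_eq_iff)
    have dl: "?d l = ?d l'" using of_nat_z3_eq_iff[of "deg G l" "deg G l'"] deg_leaf[OF lf] l'(1) by simp
    let ?t = "transpose x y" and ?u = "transpose l l'"
    have bij: "bij_betw (\<phi> \<circ> ?t) V V" "bij_betw (\<phi> \<circ> ?u) V V" "bij_betw (\<phi> \<circ> ?t \<circ> ?u) V V"
      using \<phi>(1) V by (auto intro!: bij_betw_transpose)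
    have ws: "wsum w (\<phi> \<circ> ?t) = wsum w \<phi> + \<eta>" "wsum w (\<phi> \<circ> ?u) = wsum w \<phi>"
      "wsum w (\<phi> \<circ> ?t \<circ> ?u) = wsum w (\<phi> \<circ> ?t)"
      using wsum_transpose[of x y w \<phi>] wsum_transpose[of l l' w \<phi>] wsum_transpose[of l l' w "\<phi> \<circ> ?t"]
        V dist \<phi>(2) dl by (simp_all add: \<eta>_def)
    have pl: "{p, l} \<in> E" using leaf_at_verts[OF lf] by (simp add: insert_commute)
    have at: "\<phi> p = a" "\<phi> l = b" "(\<phi> \<circ> ?t) p = a" "(\<phi> \<circ> ?t) l = b"
      "(\<phi> \<circ> ?u) p = a" "(\<phi> \<circ> ?u) l' = b" "(\<phi> \<circ> ?t \<circ> ?u) p = a" "(\<phi> \<circ> ?t \<circ> ?u) l' = b"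
      using \<phi>(2) dist by (auto simp: transpose_def)
    have "csum \<phi> = wsum w \<phi> + \<epsilon>" "csum (\<phi> \<circ> ?t) = wsum w \<phi> + \<eta> + \<epsilon>"
      "csum (\<phi> \<circ> ?u) = wsum w \<phi>" "csum (\<phi> \<circ> ?t \<circ> ?u) = wsum w \<phi> + \<eta>"
      using cs[OF \<phi>(1) _ _ at(1,2)] cs[OF bij(1) _ _ at(3,4)] cs[OF bij(2) _ _ at(5,6)]
        cs[OF bij(3) _ _ at(7,8)] V ws pl l'(2) by (simp_all del: comp_apply)
    then show False
      using z3_two_changes[OF \<open>\<eta> \<noteq> 0\<close> \<epsilon>, of "wsum w \<phi>"] no_zero \<phi>(1) bij by metis
  qed
  obtain r where r: "r \<in> V" "r \<notin> set [a, b]"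
    using ex_not_in_list[of V "[a, b]"] finV card by auto
  define A where "A = w a - w r"
  define B where "B = w b - w r"
  \<comment> \<open>\<open>A\<close> and \<open>B\<close> are the excess weights at the ends of the
    exceptional edge, on which \<open>\<alpha>\<close> and \<open>\<beta>\<close> are placed;
    constant weight elsewhere contributes nothing.\<close>
  have key: "?d \<alpha> * A + ?d \<beta> * B + (if {\<alpha>, \<beta>} \<in> E then \<epsilon> else 0) \<noteq> 0"
    if \<alpha>: "\<alpha> \<in> V" "\<beta> \<in> V" "\<alpha> \<noteq> \<beta>" for \<alpha> \<beta>
  proof -
    obtain \<phi> where \<phi>: "bij_betw \<phi> V V" "map \<phi> [\<alpha>, \<beta>] = [a, b]"
      using ex_bij_extending[of V "[\<alpha>, \<beta>]" "[a, b]"] finV \<alpha> ab by auto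
    have inj: "inj_on \<phi> V" using \<phi>(1) by (simp add: bij_betw_def)
    have "wsum w \<phi> = (\<Sum>x\<in>{\<alpha>, \<beta>}. ?d x * (w (\<phi> x) - w r))"
    proof (rule wsum_const[OF dvd])
      fix x assume x: "x \<in> V - {\<alpha>, \<beta>}"
      then have "\<phi> x \<noteq> \<phi> \<alpha>" "\<phi> x \<noteq> \<phi> \<beta>" "\<phi> x \<in> V"
        using \<alpha> \<phi>(1) inj_on_eq_iff[OF inj, of x] by (auto simp: bij_betw_def)
      then show "w (\<phi> x) = w r" using const[of "\<phi> x" r] r \<phi>(2) by auto
    qed (use \<alpha> in auto)
    also have "\<dots> = ?d \<alpha> * A + ?d \<beta> * B" using \<alpha> \<phi>(2) by (simp add: A_def B_def)
    finally show ?thesis using cs[OF \<phi>(1) \<alpha>(1,2)] no_zero[OF \<phi>(1)] \<phi>(2) by simp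
  qed
  have lf: "leaf_at l1 p1" "leaf_at l2 p2" "p1 \<noteq> p2" "l1 \<noteq> p2" "l2 \<noteq> p1"
    using lp unfolding leaf_pair_def by auto
  note d = leaf_pair_distinct[OF lp]
  have dl: "?d l1 = 1" "?d l2 = 1" using lf(1,2)[THEN deg_leaf] by simp_all
  have far: "\<exists>l\<in>V. ?d l = 1 \<and> l \<noteq> f \<and> {f, l} \<notin> E" if f: "f \<in> V" "?d f \<noteq> 1" for f
  proof (cases "f = p1")
    case True
    then have "{f, l2} \<notin> E" using lf unfolding leaf_at_def by (metis insert_commute)
    then show ?thesis using d dl f by (intro bexI[of _ l2]) auto
  next
    case False
    then have "{f, l1} \<notin> E" using lf unfolding leaf_at_def by (metis insert_commute)
    then show ?thesis using d dl f by (intro bexI[of _ l1]) auto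
  qed
  have df0: "?d f0 = 0" using f0 by (simp add: of_nat_z3_eq_0_iff dvd_eq_mod_eq_0)
  have dfx: "?d fx \<noteq> 1" using fx of_nat_z3_eq_iff[of "deg G fx" 1] by simp
  have "{l1, l2} \<notin> E" using lf unfolding leaf_at_def by blast
  then have AB: "A + B \<noteq> 0" using key[of l1 l2] d dl by auto
  obtain l where l: "l \<in> V" "?d l = 1" "l \<noteq> f0" "{f0, l} \<notin> E" using far[of f0] f0 df0 by auto
  have "B \<noteq> 0" "A \<noteq> 0"
    using key[of f0 l] key[of l f0] l f0 df0 by (auto simp: insert_commute)
  then have eq: "B = A" using z3_nonzero_cases(1)[of A B] AB by simp
  \<comment> \<open>A degree of -1 at one end and a nonadjacent leaf at the other would give
    \<open>A - A\<close>.\<close>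
  have deg01: "?d g = 0 \<or> ?d g = 1" if g: "g \<in> V" for g
  proof (rule ccontr)
    assume no: "\<not> ?thesis"
    then have "?d g = - 1" using z3_nonzero_cases(3) by blast
    moreover obtain l where "l \<in> V" "?d l = 1" "l \<noteq> g" "{g, l} \<notin> E" using far[OF g] no by auto
    ultimately show False using key[of g l] g eq by auto
  qed
  have zeros: "{g, h} \<in> E" if "g \<in> V" "h \<in> V" "g \<noteq> h" "?d g = 0" "?d h = 0" for g h
    using key[of g h] that by (auto split: if_splits)
  have dfx0: "?d fx = 0" using deg01[OF fx(1)] dfx by blast
  have e0: "{f0, fx} \<in> E" using zeros[of f0 fx] f0 fx df0 dfx0 by auto
  have others: "?d g = 1" if g: "g \<in> V" "g \<noteq> f0" "g \<noteq> fx" for g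
  proof (rule ccontr)
    assume "?d g \<noteq> 1"
    then have "?d g = 0" using deg01 g by blast
    then have "{f0, g} \<in> E" "{fx, g} \<in> E" using zeros[of f0 g] zeros[of fx g] g f0 fx df0 dfx0 by auto
    then show False using no_triangle[OF e0] by blast
  qed
  have "{f0, fx} \<in> {e \<in> E. f0 \<in> e}" using e0 by simp
  then have "deg G f0 \<noteq> 0" unfolding deg_def using finE by (auto simp: card_eq_0_iff)
  then have "deg G f0 \<ge> 2" using f0(2) by (auto simp: dvd_eq_mod_eq_0[symmetric] elim: dvdE)
  then obtain g where g: "{f0, g} \<in> E" "g \<noteq> fx" using deg_ge_2_neighbours[of f0] by metis
  have g1: "A + \<epsilon> \<noteq> 0" using key[of f0 g] g edge_verts[OF g(1)] others[of g] df0 eq by auto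
  \<comment> \<open>If \<open>f0\<close> and \<open>fx\<close> covered all edges, the edge joining
    them would be counted twice, and the number of edges would be -1 modulo 3.\<close>
  have "\<exists>e\<in>E. f0 \<notin> e \<and> fx \<notin> e"
  proof (rule ccontr)
    assume no: "\<not> ?thesis"
    let ?S = "\<lambda>x. {e \<in> E. x \<in> e}"
    have U: "E = ?S f0 \<union> ?S fx" using no by blast
    have "?S f0 \<inter> ?S fx = {{f0, fx}}"
    proof
      show "?S f0 \<inter> ?S fx \<subseteq> {{f0, fx}}"
      proof
        fix e assume e: "e \<in> ?S f0 \<inter> ?S fx"
        then obtain h where "e = {f0, h}" using edge_through by blast
        then show "e \<in> {{f0, fx}}" using e fx(3) by auto
      qed
    qed (use e0 in auto)
    then have "card E + 1 = deg G f0 + deg G fx"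
      using card_Un_Int[of "?S f0" "?S fx"] finE U unfolding deg_def by simp
    moreover have "3 dvd deg G f0" "3 dvd deg G fx"
      using df0 dfx0 by (simp_all add: of_nat_z3_eq_0_iff)
    ultimately show False using dvd by presburger
  qed
  then obtain e where e: "e \<in> E" "f0 \<notin> e" "fx \<notin> e" by blast
  obtain s t where st: "e = {s, t}" "s \<noteq> t" "s \<in> V" "t \<in> V" using edge_cases[OF e(1)] .
  then have "?d s = 1" "?d t = 1" using others e by auto
  then have "A + A + \<epsilon> \<noteq> 0" using key[of s t] st e eq by simp
  then show False using g1 z3_nonzero_cases(2)[OF \<open>A \<noteq> 0\<close> \<epsilon>] by blast
qed

text \<open>Without a suitable second vertex \<open>y\<close>, every further vertex is a leaf at
  \<open>p1\<close>, so the forest is a star with one subdivided edge. Then \<open>f0\<close> is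
  \<open>p1\<close>, and the number of edges is \<open>deg G p1 + 1\<close>, which is not divisible
  by 3.\<close>

lemma parallel_rows_if_good_pair:
  assumes dvd: "3 dvd card E"
    and f0: "f0 \<in> V" "deg G f0 mod 3 = 0" and fx: "fx \<in> V" "deg G fx mod 3 \<noteq> 1" "fx \<noteq> f0"
    and lp: "leaf_pair l1 p1 l2 p2" and x: "{x, p1} \<in> E" "{x, p2} \<notin> E" "x \<noteq> l1" "x \<noteq> p2"
  shows "rows_parallel \<and> card V \<ge> 6"
proof -
  note d = leaf_pair_distinct[OF lp]
  have lf: "leaf_at l1 p1" "leaf_at l2 p2" "p1 \<noteq> p2" "l1 \<noteq> p2" "l2 \<noteq> p1"
    using lp unfolding leaf_pair_def by auto
  have xP: "x \<in> V" "x \<notin> {p1, p2, l1, l2}"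
    using x edge_verts[OF x(1)] lf unfolding leaf_at_def by auto
  show ?thesis
  proof (cases "\<exists>y\<in>V. y \<notin> {p1, p2, l1, l2} \<and> \<not> ({y, p1} \<in> E \<and> {y, p2} \<notin> E)")
    case True
    then obtain y where y: "y \<in> V" "y \<notin> {p1, p2, l1, l2}" "\<not> ({y, p1} \<in> E \<and> {y, p2} \<notin> E)" by blast
    then have "x \<noteq> y" using x by blast
    then have "card V \<ge> 6"
      using length_le_card[of V "[p1, p2, l1, l2, x, y]"] finV d xP y by auto
    moreover have rows_parallel
      using parallel_rows_by_neighbours[OF lp xP(1) y(1) \<open>x \<noteq> y\<close> xP(2) y(2) x(1,2) y(3)] .
    ultimately show ?thesis by blast
  next
    case False
    then have all: "{y, p1} \<in> E" "{y, p2} \<notin> E" if "y \<in> V" "y \<notin> {p1, p2, l1, l2}" for y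
      using that by blast+
    have leaf: "leaf_at y p1" if y: "y \<in> V" "y \<notin> {p1, p2, l1, l2}" for y
    proof -
      have "g = p1" if g: "{y, g} \<in> E" for g
      proof (rule ccontr)
        assume "g \<noteq> p1"
        moreover have "g \<noteq> p2" using g all(2)[OF y] by blast
        moreover have "g \<noteq> l1" "g \<noteq> l2" using g y lf unfolding leaf_at_def by (metis insertI1 insert_commute insertI2)+
        ultimately have "{g, p1} \<in> E" using all(1)[of g] edge_verts[OF g] by blast
        then show False using no_triangle[OF g] all(1)[OF y] by blast
      qed
      then show ?thesis using all(1)[OF y] unfolding leaf_at_def by blast
    qed
    have nonleaf: "v \<in> {p1, p2}" if "v \<in> V" "deg G v mod 3 \<noteq> 1" for v
    proof (rule ccontr)
      assume "v \<notin> {p1, p2}"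
      then have "\<exists>p. leaf_at v p" using leaf[of v] lf that(1) by blast
      then show False using deg_leaf that(2) by auto
    qed
    have p2: "g = l2 \<or> g = p1" if g: "{p2, g} \<in> E" for g
    proof (rule ccontr)
      assume no: "\<not> ?thesis"
      have "g \<noteq> l1" using g lf unfolding leaf_at_def by (metis insert_commute)
      then have "{g, p2} \<notin> E" using all(2)[of g] edge_verts[OF g] no by blast
      then show False using g by (simp add: insert_commute)
    qed
    have f: "f0 \<in> {p1, p2}" "fx \<in> {p1, p2}" using nonleaf f0 fx by auto
    have adj: "{p1, p2} \<in> E"
    proof (rule ccontr)
      assume "{p1, p2} \<notin> E"
      then have "leaf_at p2 l2" using p2 leaf_at_verts[OF lf(2)] unfolding leaf_at_def
        by (metis insert_commute)
      then have "deg G p2 = 1" by (rule deg_leaf)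
      then show False using f fx f0 by auto
    qed
    have "deg G p2 \<le> card {l2, p1}" using p2 by (intro deg_le_card) auto
    then have le: "deg G p2 \<le> 2" using card_insert_le_m1[of 2 "{p1}" l2] by auto
    have "{p1, p2} \<in> {e \<in> E. p2 \<in> e}" using adj by simp
    then have "deg G p2 \<noteq> 0" unfolding deg_def using finE by (auto simp: card_eq_0_iff)
    then have "deg G p2 mod 3 \<noteq> 0" using le by auto
    then have "f0 = p1" using f f0 by auto
    have "E = insert {p2, l2} {e \<in> E. p1 \<in> e}"
    proof
      show "insert {p2, l2} {e \<in> E. p1 \<in> e} \<subseteq> E"
        using leaf_at_verts[OF lf(2)] by (auto simp: insert_commute)
      show "E \<subseteq> insert {p2, l2} {e \<in> E. p1 \<in> e}"
      proof
        fix e assume e: "e \<in> E"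
        obtain s t where st: "e = {s, t}" "s \<noteq> t" "s \<in> V" "t \<in> V" using edge_cases[OF e] .
        show "e \<in> insert {p2, l2} {e \<in> E. p1 \<in> e}"
        proof (cases "p1 \<in> e")
          case False
          have "s \<in> {p2, l2}"
            using leaf[of s] st e False lf unfolding leaf_at_def by (metis insertCI insertE singletonD)
          moreover have "t \<in> {p2, l2}"
            using leaf[of t] st e False lf unfolding leaf_at_def by (metis insertCI insertE singletonD insert_commute)
          ultimately show ?thesis using st by auto
        qed (use e in simp)
      qed
    qed
    moreover have "{p2, l2} \<notin> {e \<in> E. p1 \<in> e}" using d by auto
    ultimately have "card E = Suc (deg G p1)"
      unfolding deg_def using finE by (metis (no_types, lifting) card_insert_disjoint finite_insert)
    then have "3 dvd Suc (deg G p1)" using dvd by simp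
    moreover have "3 dvd deg G p1" using f0(2) \<open>f0 = p1\<close> by auto
    ultimately have False by presburger
    then show ?thesis ..
  qed
qed

text \<open>If no pair of leaves can be used, every neighbour of one support, other than its leaf
  and the other support, is adjacent to the other support. In a forest this leaves a path on four
  vertices when supports are adjacent, and legs of length two at a common centre when they are
  not.\<close>

lemma ex_parallel_rows:
  assumes dvd: "3 dvd card E" and ns: "\<And>q. \<exists>e\<in>E. q \<notin> e"
    and f0: "f0 \<in> V" "deg G f0 mod 3 = 0"
    and fx: "fx \<in> V" "deg G fx mod 3 \<noteq> 1" "fx \<noteq> f0" "deg G fx \<ge> 2"
  shows "rows_parallel \<and> card V \<ge> 6"
proof (rule ccontr)
  assume contra: "\<not> ?thesis"
  have NG: "x = l1 \<or> x = p2 \<or> {x, p2} \<in> E"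
    if "leaf_pair l1 p1 l2 p2" "{x, p1} \<in> E" for l1 p1 l2 p2 x
    using parallel_rows_if_good_pair[OF dvd f0 fx(1-3) that(1)] that(2) contra by blast
  obtain l1 p1 q where l1: "leaf_at l1 p1" and q: "{p1, q} \<in> E" "q \<noteq> l1"
    using ex_leaf_with_branching_support[OF fx(4)] .
  obtain l2 p2 where lp: "leaf_pair l1 p1 l2 p2" using ex_leaf_pair[OF l1] ns by blast
  note d = leaf_pair_distinct[OF lp]
  have l2: "leaf_at l2 p2" using lp unfolding leaf_pair_def by auto
  have e1: "{p1, l1} \<in> E" and e2: "{p2, l2} \<in> E"
    using leaf_at_verts[OF l1] leaf_at_verts[OF l2] by (simp_all add: insert_commute)
  have L1: "g = p1" if "{g, l1} \<in> E" for g using l1 that unfolding leaf_at_def by (simp add: insert_commute)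
  have L2: "g = p2" if "{g, l2} \<in> E" for g using l2 that unfolding leaf_at_def by (simp add: insert_commute)
  define E' where "E' = {e \<in> E. e \<inter> {p1, p2, l1, l2} = {}}"
  show False
  proof (cases "{p1, p2} \<in> E")
    case True
    have N1: "g = l1 \<or> g = p2" if "{p1, g} \<in> E" for g
      using NG[OF lp, of g] that no_triangle[OF _ True, of g] no_triangle[of p1 g p2] True
      by (auto simp: insert_commute)
    have N2: "g = l2 \<or> g = p1" if "{p2, g} \<in> E" for g
      using NG[OF leaf_pair_sym[OF lp], of g] that no_triangle[of p2 g p1] True
      by (auto simp: insert_commute)
    have "E' = {}"
    proof (rule ccontr)
      assume "E' \<noteq> {}"
      then obtain y p3 where y: "\<And>g. {y, g} \<in> E' \<longleftrightarrow> g = p3"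
        using sub_leaf[of E' undefined] unfolding E'_def by (metis (no_types, lifting) mem_Collect_eq subsetI)
      have yp: "{y, p3} \<in> E" "y \<notin> {p1, p2, l1, l2}" "p3 \<notin> {p1, p2, l1, l2}"
        using y[of p3] unfolding E'_def by auto
      have "g \<notin> {p1, p2, l1, l2}" if "{y, g} \<in> E" for g
        using that N1[of y] N2[of y] L1[of y] L2[of y] yp(2) by (auto simp: insert_commute)
      then have "leaf_at y p3" using y yp unfolding leaf_at_def E'_def by auto
      then have "leaf_pair l1 p1 y p3" using l1 yp unfolding leaf_pair_def by auto
      then have "p2 = l1 \<or> p2 = p3 \<or> {p2, p3} \<in> E"
        using NG[of l1 p1 y p3 p2] True by (auto simp: insert_commute)
      then show False using N2[of p3] yp d by auto
    qed
    have "E \<subseteq> {{l1, p1}, {p1, p2}, {p2, l2}}"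
    proof
      fix e assume e: "e \<in> E"
      then obtain v where v: "v \<in> e" "v \<in> {p1, p2, l1, l2}" using \<open>E' = {}\<close> unfolding E'_def by blast
      obtain g where g: "e = {v, g}" using edge_through[OF e v(1)] .
      then show "e \<in> {{l1, p1}, {p1, p2}, {p2, l2}}"
        using v(2) e N1[of g] N2[of g] L1[of g] L2[of g] by (auto simp: insert_commute)
    qed
    then have E: "E = {{l1, p1}, {p1, p2}, {p2, l2}}"
      using e1 e2 True by (auto simp: insert_commute)
    have "deg G p1 \<le> card {l1, p2}" "deg G p2 \<le> card {l2, p1}"
      using N1 N2 by (intro deg_le_card; auto)+
    then have le: "deg G p1 \<le> 2" "deg G p2 \<le> 2"
      using card_insert_le_m1[of 2 "{p2}" l1] card_insert_le_m1[of 2 "{p1}" l2] by auto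
    have "{p1, p2} \<in> {e \<in> E. p1 \<in> e}" "{p1, p2} \<in> {e \<in> E. p2 \<in> e}" using True by simp_all
    then have "deg G p1 \<noteq> 0" "deg G p2 \<noteq> 0" unfolding deg_def using finE by (auto simp: card_eq_0_iff)
    then have "deg G p1 mod 3 \<noteq> 0" "deg G p2 mod 3 \<noteq> 0" using le by auto
    \<comment> \<open>The inner vertices of the path have degree 1 or 2, so \<open>f0\<close> is a
      fifth vertex.\<close>
    then have "f0 \<notin> {p1, p2, l1, l2}" using f0 deg_leaf[OF l1] deg_leaf[OF l2] by auto
    then show False using not_path4_plus_one[OF E, of f0] f0 d by auto
  next
    case False
    have hq: "{q, p2} \<in> E" using NG[OF lp, of q] q False by (auto simp: insert_commute)
    have qd: "q \<notin> {p1, p2, l1, l2}"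
      using q hq False edge_verts[OF q(1)] edge_verts[OF hq] L2[of p1] d by auto
    have N1: "g = l1 \<or> g = q" if "{p1, g} \<in> E" for g
    proof (rule ccontr)
      assume no: "\<not> ?thesis"
      then have "{g, p2} \<in> E" using NG[OF lp, of g] that False by (auto simp: insert_commute)
      then show False using no_square[of p1 g p2 q] that hq q no d by (auto simp: insert_commute)
    qed
    have N2: "g = l2 \<or> g = q" if "{p2, g} \<in> E" for g
      using NG[OF leaf_pair_sym[OF lp], of g] that False N1[of g] L1[of p2] d by (auto simp: insert_commute)
    \<comment> \<open>Two legs alone form a path with four edges, which divisibility by 3 forbids;
      hence a third leg can be sought.\<close>
    have "E' \<noteq> {}"
    proof
      assume "E' = {}"
      have "E \<subseteq> {{l1, p1}, {p1, q}, {q, p2}, {p2, l2}}"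
      proof
        fix e assume e: "e \<in> E"
        then obtain v where v: "v \<in> e" "v \<in> {p1, p2, l1, l2}" using \<open>E' = {}\<close> unfolding E'_def by blast
        obtain g where g: "e = {v, g}" using edge_through[OF e v(1)] .
        then show "e \<in> {{l1, p1}, {p1, q}, {q, p2}, {p2, l2}}"
          using v(2) e N1[of g] N2[of g] L1[of g] L2[of g] by (auto simp: insert_commute)
      qed
      then have "E = {{l1, p1}, {p1, q}, {q, p2}, {p2, l2}}"
        using e1 e2 q hq by (auto simp: insert_commute)
      moreover have "card {{l1, p1}, {p1, q}, {q, p2}, {p2, l2}} = 4"
        using d qd by (auto simp: card_insert_if doubleton_eq_iff)
      ultimately have "card E = 4" by simp
      then show False using dvd by simp
    qed
    \<comment> \<open>Avoiding \<open>q\<close> matters: only \<open>q\<close> and vertices of the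
      two legs can have neighbours there, so any other leaf of the remainder is a leaf of the
      forest.\<close>
    then obtain l3 p3 where y: "l3 \<noteq> q" "\<And>g. {l3, g} \<in> E' \<longleftrightarrow> g = p3"
      using sub_leaf[of E' q] unfolding E'_def by (metis (no_types, lifting) mem_Collect_eq subsetI)
    have yp: "{l3, p3} \<in> E" "l3 \<notin> {p1, p2, l1, l2}" "p3 \<notin> {p1, p2, l1, l2}"
      using y(2)[of p3] unfolding E'_def by auto
    have "g \<notin> {p1, p2, l1, l2}" if "{l3, g} \<in> E" for g
      using that N1[of l3] N2[of l3] L1[of l3] L2[of l3] yp(2) y(1) by (auto simp: insert_commute)
    then have l3: "leaf_at l3 p3" using y yp unfolding leaf_at_def E'_def by auto
    then have lp3: "leaf_pair l1 p1 l3 p3" using l1 yp unfolding leaf_pair_def by auto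
    have "q \<noteq> p3"
    proof
      assume "q = p3"
      then have "p2 = l3 \<or> p2 = p1 \<or> {p2, p1} \<in> E"
        using NG[OF leaf_pair_sym[OF lp3], of p2] hq by (auto simp: insert_commute)
      then show False using yp d False by (auto simp: insert_commute)
    qed
    then have q3: "{q, p3} \<in> E"
      using NG[OF lp3, of q] q by (auto simp: insert_commute)
    have N3: "g = l3 \<or> g = q" if g: "{p3, g} \<in> E" for g
    proof -
      have "g = l3 \<or> g = p1 \<or> {g, p1} \<in> E"
        using NG[OF leaf_pair_sym[OF lp3], of g] g by (auto simp: insert_commute)
      moreover have "g \<noteq> p1" using N1[of p3] g yp \<open>q \<noteq> p3\<close> by (auto simp: insert_commute)
      moreover have "g \<noteq> l1" using L1[of p3] g yp by auto
      ultimately show ?thesis using N1[of g] by (auto simp: insert_commute)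
    qed
    have dist: "distinct [p1, p2, l1, l2, q, p3, l3]"
      using d qd yp y(1) \<open>q \<noteq> p3\<close> edge_verts[OF yp(1)] by auto
    have "rows_parallel"
    proof (rule parallel_rows_by_legs[OF l1 l2 l3 _ _ _ dist])
      show "{p1, g} \<in> E \<longleftrightarrow> g = l1 \<or> g = q" for g using N1 e1 q by blast
      show "{p2, g} \<in> E \<longleftrightarrow> g = l2 \<or> g = q" for g using N2 e2 hq by (metis insert_commute)
      show "{p3, g} \<in> E \<longleftrightarrow> g = l3 \<or> g = q" for g using N3 yp(1) q3 by (metis insert_commute)
    qed
    moreover have "{p1, p2, l1, l2, q, p3, l3} \<subseteq> V"
      using d edge_verts[OF q(1)] edge_verts[OF yp(1)] by auto
    then have "card V \<ge> 6" using length_le_card[OF finV dist] by auto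
    ultimately show False using contra by blast
  qed
qed

text \<open>\<open>f0\<close> may be isolated, which lets the theorem serve hosts with an extra
  vertex. The degree bound on \<open>fx\<close> provides a leaf whose support branches.\<close>

theorem no_zero_sum_free_forest:
  assumes dvd: "3 dvd card E" and ns: "\<And>q. \<exists>e\<in>E. q \<notin> e"
    and f0: "f0 \<in> V" "deg G f0 mod 3 = 0"
    and fx: "fx \<in> V" "deg G fx mod 3 \<noteq> 1" "fx \<noteq> f0" "deg G fx \<ge> 2"
  shows False
proof -
  let ?c = "\<lambda>x y. C {x, y}"
  have par: rows_parallel and card: "card V \<ge> 6"
    using ex_parallel_rows[OF assms] by blast+
  have sym: "?c x y = ?c y x" for x y by (simp add: insert_commute)
  obtain l1 p1 where l1: "leaf_at l1 p1"
    using ex_leaf_with_branching_support[OF fx(4)] by blast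
  obtain l2 p2 where lp: "leaf_pair l1 p1 l2 p2" using ex_leaf_pair[OF l1] ns by blast
  note d = leaf_pair_distinct[OF lp]
  show False
  proof (cases "\<exists>a b u v. distinct [a, b, u, v] \<and> {a, b, u, v} \<subseteq> V \<and> alt ?c a b u v \<noteq> 0")
    case False
    have "\<exists>w. \<forall>x\<in>V. \<forall>y\<in>V. x \<noteq> y \<longrightarrow> C {x, y} = w x + w y"
    proof (rule weighted_if_alt_zero[of ?c p1 V p2 l1, OF sym])
      show "alt ?c a b u v = 0" if "distinct [a, b, u, v]" "{a, b, u, v} \<subseteq> V" for a b u v
        using False that by blast
    qed (use d in auto)
    then obtain w where w: "\<forall>x\<in>V. \<forall>y\<in>V. x \<noteq> y \<longrightarrow> C {x, y} = w x + w y" ..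
    have "leaf_at l2 p2" using lp unfolding leaf_pair_def by auto
    then have "deg G l1 = 1" "deg G l2 = 1" using l1 deg_leaf by blast+
    then show False
      using not_weighted[OF dvd f0 fx(1-3), of l1 l2 w] d w by auto
  next
    case True
    interpret P: parallel_rows V ?c
      by unfold_locales (use finV card sym par in \<open>auto simp: rows_parallel_def\<close>)
    have "weighted_but_one_edge V ?c" using True P.weighted_up_to_one_edge by blast
    then show False using not_weighted_but_one_edge[OF dvd card f0 fx(1-3) lp] by blast
  qed
qed

end

section \<open>Lower bounds\<close>

lemma inj_on_image_edges:
  assumes "simple_graph G" "inj_on f (uverts G)"
  shows "inj_on ((`) f) (uedges G)"
proof (rule inj_onI)
  fix e e' assume "e \<in> uedges G" "e' \<in> uedges G" "f ` e = f ` e'"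
  then show "e = e'"
    using assms inj_on_image_eq_iff[of f "uverts G" e e'] unfolding simple_graph_def by blast
qed

lemma zero_sum_arrows_mono:
  assumes "zero_sum_arrows N G k" "N \<le> N'"
  shows "zero_sum_arrows N' G k"
  unfolding zero_sum_arrows_def
proof (intro allI impI)
  fix \<chi> :: "nat set \<Rightarrow> nat"
  have sub: "uverts (complete_graph N) \<subseteq> uverts (complete_graph N')"
    "uedges (complete_graph N) \<subseteq> uedges (complete_graph N')"
    using assms(2) by (auto simp: complete_graph_def)
  assume "\<forall>e\<in>uedges (complete_graph N'). \<chi> e \<in> {..<k}"
  then have "\<forall>e\<in>uedges (complete_graph N). \<chi> e \<in> {..<k}" using sub by blast
  with assms(1) have "\<exists>H. subgraph H (complete_graph N) \<and> isomorphic G H \<and> (\<Sum>e\<in>uedges H. \<chi> e) mod k = 0"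
    unfolding zero_sum_arrows_def by (elim allE[of _ \<chi>] impE)
  then obtain H where "subgraph H (complete_graph N)" "isomorphic G H" "(\<Sum>e\<in>uedges H. \<chi> e) mod k = 0"
    by (elim exE conjE)
  then show "\<exists>H. subgraph H (complete_graph N') \<and> isomorphic G H \<and> (\<Sum>e\<in>uedges H. \<chi> e) mod k = 0"
    using sub unfolding subgraph_def by (intro exI[of _ H]) auto
qed

lemma zero_sum_ramsey_eqI:
  assumes "zero_sum_arrows (Suc N) G k" "\<not> zero_sum_arrows N G k"
  shows "zero_sum_ramsey G k = Suc N"
  unfolding zero_sum_ramsey_def
proof (rule Least_equality)
  show "zero_sum_arrows (Suc N) G k" by (rule assms(1))
  fix M assume "zero_sum_arrows M G k"
  then show "Suc N \<le> M" using zero_sum_arrows_mono[of M G k N] assms(2) by (meson not_less_eq_eq)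
qed

lemma not_arrowsI:
  assumes G: "simple_graph G" and \<chi>: "\<And>e. \<chi> e < k"
    and no: "\<And>f. inj_on f (uverts G) \<Longrightarrow> f ` uverts G \<subseteq> {..<N} \<Longrightarrow> (\<Sum>e\<in>uedges G. \<chi> (f ` e)) mod k \<noteq> 0"
  shows "\<not> zero_sum_arrows N G k"
proof
  assume "zero_sum_arrows N G k"
  moreover have "\<forall>e\<in>uedges (complete_graph N). \<chi> e \<in> {..<k}" using \<chi> by simp
  ultimately have "\<exists>H. subgraph H (complete_graph N) \<and> isomorphic G H \<and> (\<Sum>e\<in>uedges H. \<chi> e) mod k = 0"
    unfolding zero_sum_arrows_def by (elim allE[of _ \<chi>] impE)
  then obtain H where H: "subgraph H (complete_graph N)" "isomorphic G H"
    "(\<Sum>e\<in>uedges H. \<chi> e) mod k = 0" by (elim exE conjE)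
  obtain f where f: "bij_betw f (uverts G) (uverts H)" "uedges H = (\<lambda>e. f ` e) ` uedges G"
    using H(2) unfolding isomorphic_def by blast
  have inj: "inj_on f (uverts G)" using f(1) by (simp add: bij_betw_def)
  have "f ` uverts G \<subseteq> {..<N}"
    using f(1) H(1) unfolding bij_betw_def subgraph_def complete_graph_def by auto
  moreover have "(\<Sum>e\<in>uedges H. \<chi> e) = (\<Sum>e\<in>uedges G. \<chi> (f ` e))"
    unfolding f(2) using inj_on_image_edges[OF G inj] by (simp add: sum.reindex)
  ultimately show False using no[OF inj] H(3) by simp
qed

text \<open>Colour each edge by the sum of the weights of its ends; the colour sum of a copy becomes
  a sum over vertices with degrees as coefficients.\<close>

lemma not_arrows_by_weights:
  fixes w :: "nat \<Rightarrow> nat"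
  assumes G: "simple_graph G"
    and no: "\<And>f. inj_on f (uverts G) \<Longrightarrow> f ` uverts G \<subseteq> {..<N} \<Longrightarrow>
      (\<Sum>v\<in>uverts G. deg G v * w (f v)) mod 3 \<noteq> 0"
  shows "\<not> zero_sum_arrows N G 3"
proof (rule not_arrowsI[OF G, where \<chi> = "\<lambda>e. (\<Sum>x\<in>e. w x) mod 3"])
  fix f assume f: "inj_on f (uverts G)" "f ` uverts G \<subseteq> {..<N}"
  have fin: "finite (uverts G)" "finite (uedges G)"
    using G finite_subset[of "uedges G" "Pow (uverts G)"] by (auto simp: simple_graph_def)
  have edge: "(\<Sum>x\<in>f ` e. w x) = (\<Sum>v\<in>uverts G. if v \<in> e then w (f v) else 0)" if "e \<in> uedges G" for e
  proof -
    have sub: "e \<subseteq> uverts G" using G that by (auto simp: simple_graph_def)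
    then have "(\<Sum>x\<in>f ` e. w x) = (\<Sum>v\<in>e. w (f v))"
      using f(1) by (simp add: sum.reindex inj_on_subset)
    also have "e = {v \<in> uverts G. v \<in> e}" using sub by auto
    then have "(\<Sum>v\<in>e. w (f v)) = (\<Sum>v\<in>uverts G. if v \<in> e then w (f v) else 0)"
      using sum.inter_filter[OF fin(1), of "\<lambda>v. w (f v)" "\<lambda>v. v \<in> e"] by simp
    finally show ?thesis .
  qed
  have "(\<Sum>e\<in>uedges G. (\<Sum>x\<in>f ` e. w x) mod 3) mod 3 = (\<Sum>e\<in>uedges G. \<Sum>x\<in>f ` e. w x) mod 3"
    by (rule mod_sum_eq)
  also have "(\<Sum>e\<in>uedges G. \<Sum>x\<in>f ` e. w x)
      = (\<Sum>v\<in>uverts G. \<Sum>e\<in>uedges G. if v \<in> e then w (f v) else 0)"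
    using edge by (simp add: sum.swap[of _ "uedges G"])
  also have "\<dots> = (\<Sum>v\<in>uverts G. deg G v * w (f v))"
  proof (rule sum.cong[OF refl])
    fix v
    show "(\<Sum>e\<in>uedges G. if v \<in> e then w (f v) else 0) = deg G v * w (f v)"
      using sum.inter_filter[OF fin(2), of "\<lambda>_. w (f v)" "\<lambda>e. v \<in> e"] by (simp add: deg_def)
  qed
  finally show "(\<Sum>e\<in>uedges G. (\<Sum>x\<in>f ` e. w x) mod 3) mod 3 \<noteq> 0" using no[OF f] by simp
qed simp

lemma not_arrows_less_card:
  assumes "simple_graph G" "N < card (uverts G)"
  shows "\<not> zero_sum_arrows N G 3"
proof (rule not_arrowsI[OF assms(1), where \<chi> = "\<lambda>_. 0"])
  fix f :: "'a \<Rightarrow> nat" assume f: "inj_on f (uverts G)" "f ` uverts G \<subseteq> {..<N}"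
  then have "card (uverts G) \<le> N" using card_inj_on_le[OF f] by simp
  then show "(\<Sum>e\<in>uedges G. 0) mod 3 \<noteq> (0::nat)" using assms(2) by simp
qed simp

text \<open>A spanning copy covers the only vertex of weight 1, so its sum is the degree of the
  vertex placed there.\<close>

lemma not_arrows_no_zero_degree:
  assumes G: "simple_graph G" "uverts G \<noteq> {}" and deg: "\<And>v. v \<in> uverts G \<Longrightarrow> \<not> 3 dvd deg G v"
  shows "\<not> zero_sum_arrows (card (uverts G)) G 3"
proof (rule not_arrows_by_weights[OF G(1), where w = "\<lambda>x. if x = 0 then 1 else 0"])
  fix f assume f: "inj_on f (uverts G)" "f ` uverts G \<subseteq> {..<card (uverts G)}"
  have fin: "finite (uverts G)" using G by (simp add: simple_graph_def)
  have "f ` uverts G = {..<card (uverts G)}"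
    using f by (intro card_subset_eq) (auto simp: card_image)
  moreover have "0 < card (uverts G)" using fin G(2) by (simp add: card_gt_0_iff)
  ultimately have "0 \<in> f ` uverts G" by simp
  then obtain a where a: "a \<in> uverts G" "f a = 0" by force
  have "(\<Sum>v\<in>uverts G. deg G v * (if f v = 0 then 1 else 0)) = (\<Sum>v\<in>{a}. deg G v * (if f v = 0 then 1 else 0))"
    using a fin inj_on_eq_iff[OF f(1) _ a(1)] by (intro sum.mono_neutral_right) auto
  then show "(\<Sum>v\<in>uverts G. deg G v * (if f v = 0 then 1 else 0)) mod 3 \<noteq> 0"
    using deg[OF a(1)] a by (simp add: dvd_eq_mod_eq_0)
qed

text \<open>With weight 1 on the vertices 0 and 1, a copy meeting one or both of them in vertices of degree 1
  modulo 3 has sum 1 or 2, and so does one meeting both if one of the two degrees is divisible by 3.\<close>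
lemma sum_two_weights:
  fixes f d :: "'a \<Rightarrow> nat"
  assumes fin: "finite V" and f: "inj_on f V"
  shows "(\<Sum>v\<in>V. d v * (if f v < 2 then 1 else 0)) = (\<Sum>v\<in>{v\<in>V. f v < 2}. d v)"
    and "card {v\<in>V. f v < 2} \<le> 2"
proof -
  show "(\<Sum>v\<in>V. d v * (if f v < 2 then 1 else 0)) = (\<Sum>v\<in>{v\<in>V. f v < 2}. d v)"
    unfolding sum.inter_filter[OF fin] by (intro sum.cong) auto
  have "card {v\<in>V. f v < 2} \<le> card {..<2::nat}"
    using f by (intro card_inj_on_le[of f]) (auto intro: inj_on_subset)
  then show "card {v\<in>V. f v < 2} \<le> 2" by simp
qed

lemma not_arrows_one_mod_3_regular:
  assumes G: "simple_graph G" "uverts G \<noteq> {}" and reg: "one_mod_3_regular G"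
  shows "\<not> zero_sum_arrows (Suc (card (uverts G))) G 3"
proof (rule not_arrows_by_weights[OF G(1), where w = "\<lambda>x. if x < 2 then 1 else 0"])
  fix f assume f: "inj_on f (uverts G)" "f ` uverts G \<subseteq> {..<Suc (card (uverts G))}"
  let ?S = "{v \<in> uverts G. f v < 2}"
  have fin: "finite (uverts G)" using G by (simp add: simple_graph_def)
  then have pos: "0 < card (uverts G)" using G(2) by (simp add: card_gt_0_iff)
  \<comment> \<open>A copy misses only one of the \<open>n + 1\<close> vertices, so it cannot miss
    both 0 and 1.\<close>
  have "?S \<noteq> {}"
  proof
    assume "?S = {}"
    then have "f ` uverts G \<subseteq> {2..<Suc (card (uverts G))}" using f(2) by force
    then have "card (uverts G) \<le> card {2..<Suc (card (uverts G))}"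
      using f(1) by (intro card_inj_on_le[of f]) auto
    then show False using pos by simp
  qed
  then have "card ?S \<noteq> 0" using fin by simp
  then have "card ?S mod 3 \<noteq> 0" using sum_two_weights(2)[OF fin f(1)] by auto
  moreover have "(\<Sum>v\<in>?S. deg G v) mod 3 = (\<Sum>v\<in>?S. deg G v mod 3) mod 3"
    by (rule mod_sum_eq[symmetric])
  moreover have "(\<Sum>v\<in>?S. deg G v mod 3) = card ?S"
    using reg unfolding one_mod_3_regular_def by simp
  ultimately show "(\<Sum>v\<in>uverts G. deg G v * (if f v < 2 then 1 else 0)) mod 3 \<noteq> 0"
    using sum_two_weights(1)[OF fin f(1), of "deg G"] by simp
qed

lemma not_arrows_one_zero_degree:
  assumes G: "simple_graph G" "card (uverts G) \<ge> 2"
    and v: "v \<in> uverts G" "deg G v mod 3 = 0" and reg: "\<And>u. u \<in> uverts G - {v} \<Longrightarrow> deg G u mod 3 = 1"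
  shows "\<not> zero_sum_arrows (card (uverts G)) G 3"
proof (rule not_arrows_by_weights[OF G(1), where w = "\<lambda>x. if x < 2 then 1 else 0"])
  fix f assume f: "inj_on f (uverts G)" "f ` uverts G \<subseteq> {..<card (uverts G)}"
  let ?S = "{v \<in> uverts G. f v < 2}"
  have fin: "finite (uverts G)" using G by (simp add: simple_graph_def)
  have "f ` uverts G = {..<card (uverts G)}"
    using f by (intro card_subset_eq) (auto simp: card_image)
  then have "0 \<in> f ` uverts G" "1 \<in> f ` uverts G" using G(2) by auto
  then obtain a b where ab: "a \<in> uverts G" "f a = 0" "b \<in> uverts G" "f b = 1" by force
  then have "a \<noteq> b" by auto
  have "?S = {a, b}"
  proof
    show "?S \<subseteq> {a, b}"
    proof
      fix x assume "x \<in> ?S"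
      then have x: "x \<in> uverts G" "f x = f a \<or> f x = f b" using ab by auto
      then show "x \<in> {a, b}" using inj_onD[OF f(1)] ab by blast
    qed
  qed (use ab in auto)
  then have "(\<Sum>v\<in>uverts G. deg G v * (if f v < 2 then 1 else 0)) = deg G a + deg G b"
    using sum_two_weights(1)[OF fin f(1), of "deg G"] \<open>a \<noteq> b\<close> by simp
  \<comment> \<open>At most one of \<open>a\<close> and \<open>b\<close> is the vertex of degree 0
    modulo 3, so the sum is 1 or 2.\<close>
  moreover have "deg G a mod 3 = 1 \<and> deg G b mod 3 \<le> 1 \<or> deg G b mod 3 = 1 \<and> deg G a mod 3 \<le> 1"
    using v reg ab \<open>a \<noteq> b\<close> by (metis Diff_iff le_numeral_extra(4) singletonD zero_le_one)
  then have "(deg G a + deg G b) mod 3 \<noteq> 0" by presburger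
  ultimately show "(\<Sum>v\<in>uverts G. deg G v * (if f v < 2 then 1 else 0)) mod 3 \<noteq> 0" by simp
qed

lemma star_edges_image:
  "(\<lambda>e. f ` e) ` {{0, i} |i. i \<in> S} = (\<lambda>v. {f 0, v}) ` (f ` S)"
proof -
  have "{{0, i} |i. i \<in> S} = (\<lambda>i. {0, i}) ` S" by auto
  then show ?thesis by (simp add: image_image)
qed

lemma is_starE:
  fixes G :: "'a ugraph"
  assumes "is_star G"
  obtains q where "q \<in> uverts G" "uedges G = (\<lambda>v. {q, v}) ` (uverts G - {q})"
    "card (uverts G) \<ge> 2"
proof -
  obtain m :: nat and f :: "nat \<Rightarrow> 'a" where m: "m \<ge> 1" and f: "bij_betw f {0..m} (uverts G)"
    and E: "uedges G = (\<lambda>e. f ` e) ` {{0, i} |i. i \<in> {1..m}}"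
    using assms unfolding is_star_def isomorphic_def star_graph_def fst_conv snd_conv by blast
  have inj: "inj_on f {0..m}" and img: "uverts G = f ` {0..m}" using f by (auto simp: bij_betw_def)
  have "f ` {1..m} = uverts G - {f 0}"
  proof -
    have "{1..m} = {0..m} - {0}" by auto
    then show ?thesis unfolding img using inj by (simp add: inj_on_image_set_diff)
  qed
  moreover have "uedges G = (\<lambda>v. {f 0, v}) ` (f ` {1..m})"
    unfolding E star_edges_image ..
  moreover have "card (uverts G) = Suc m" using bij_betw_same_card[OF f] by simp
  ultimately show ?thesis using that[of "f 0"] img m by auto
qed

text \<open>Its contrapositive is how not being a star enters the upper bounds: every vertex is
  avoided by some edge.\<close>

lemma is_starI:
  assumes G: "simple_graph G" and ne: "uverts G \<noteq> {}"
    and deg: "\<And>v. v \<in> uverts G \<Longrightarrow> deg G v \<noteq> 0" and q: "\<And>e. e \<in> uedges G \<Longrightarrow> q \<in> e"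
  shows "is_star G"
proof -
  have fin: "finite (uverts G)" using G by (simp add: simple_graph_def)
  have ex: "\<exists>e\<in>uedges G. v \<in> e" if "v \<in> uverts G" for v
    using deg[OF that] unfolding deg_def by (metis (mono_tags, lifting) Collect_empty_eq card.empty)
  have edge: "e \<subseteq> uverts G" "card e = 2" if "e \<in> uedges G" for e
    using G that by (auto simp: simple_graph_def)
  have star: "{q, v} \<in> uedges G" if v: "v \<in> uverts G" "v \<noteq> q" for v
  proof -
    obtain e where e: "e \<in> uedges G" "v \<in> e" using ex v by blast
    then have "{q, v} \<subseteq> e" using q by blast
    moreover have "card {q, v} = card e" using that edge(2)[OF e(1)] by simp
    moreover have "finite e" using edge(2)[OF e(1)] by (metis card.infinite zero_neq_numeral)
    ultimately have "{q, v} = e" by (simp add: card_subset_eq)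
    then show ?thesis using e by simp
  qed
  obtain e where e: "e \<in> uedges G" using ex ne by blast
  have qV: "q \<in> uverts G" using q[OF e] edge(1)[OF e] by blast
  have E: "uedges G = (\<lambda>v. {q, v}) ` (uverts G - {q})"
  proof
    show "uedges G \<subseteq> (\<lambda>v. {q, v}) ` (uverts G - {q})"
    proof
      fix e assume e: "e \<in> uedges G"
      then obtain x y where "e = {x, y}" "x \<noteq> y" using edge(2) by (meson card_2_iff)
      then obtain v where "e = {q, v}" "v \<noteq> q" using q[OF e] by (cases "q = x") auto
      then show "e \<in> (\<lambda>v. {q, v}) ` (uverts G - {q})" using edge(1)[OF e] by blast
    qed
  qed (use star in auto)
  define m where "m = card (uverts G - {q})"
  have "uverts G - {q} \<noteq> {}" using e E by blast
  then have m: "m \<ge> 1" unfolding m_def using fin by (simp add: Suc_le_eq card_gt_0_iff)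
  obtain h where h: "bij_betw h {1..m} (uverts G - {q})"
    using finite_same_card_bij[of "{1..m}" "uverts G - {q}"] fin by (auto simp: m_def)
  define f where "f i = (if i = 0 then q else h i)" for i
  have f1: "bij_betw f {1..m} (uverts G - {q})"
    using h by (rule bij_betw_cong[THEN iffD1, rotated]) (simp add: f_def)
  have "bij_betw f ({0} \<union> {1..m}) ({q} \<union> (uverts G - {q}))"
    using f1 by (intro bij_betw_combine) (auto simp: f_def bij_betw_def)
  moreover have "{0} \<union> {1..m} = {0..m}" "{q} \<union> (uverts G - {q}) = uverts G" using qV by auto
  ultimately have f: "bij_betw f {0..m} (uverts G)" by simp
  have "(\<lambda>e. f ` e) ` {{0, i} |i. i \<in> {1..m}} = (\<lambda>v. {q, v}) ` (f ` {1..m})"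
    unfolding star_edges_image by (simp add: f_def)
  also have "f ` {1..m} = uverts G - {q}" using f1 by (simp add: bij_betw_def)
  finally have "uedges G = (\<lambda>e. f ` e) ` {{0, i} |i. i \<in> {1..m}}" using E by simp
  then show ?thesis
    unfolding is_star_def isomorphic_def star_graph_def using m f by auto
qed

text \<open>The colouring is the indicator of a Hamiltonian cycle: a star misses at most one of the two
  cycle edges at its centre.\<close>
lemma not_arrows_star:
  assumes G: "simple_graph G" "is_star G" and dvd: "3 dvd card (uedges G)"
  shows "\<not> zero_sum_arrows (Suc (card (uverts G))) G 3"
proof -
  obtain q where q: "q \<in> uverts G" and E: "uedges G = (\<lambda>v. {q, v}) ` (uverts G - {q})"
    and card2: "card (uverts G) \<ge> 2" using is_starE[OF G(2)] .
  define N where "N = Suc (card (uverts G))"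
  have fin: "finite (uverts G)" using G by (simp add: simple_graph_def)
  have inj: "inj_on (\<lambda>v. {q, v}) (uverts G - {q})" by (auto simp: inj_on_def doubleton_eq_iff)
  have "card (uedges G) = card (uverts G) - 1" unfolding E using inj q fin by (simp add: card_image)
  then have "3 \<le> card (uverts G) - 1" using dvd card2 dvd_imp_le[of 3 "card (uverts G) - 1"] by simp
  then have N: "N \<ge> 5" unfolding N_def by simp
  \<comment> \<open>The cycle runs through 0, ..., \<open>N - 1\<close> and is closed by the edge
    joining 0 and \<open>N - 1\<close>.\<close>
  define \<chi> where "\<chi> e = (if \<exists>x y. e = {x, y} \<and> (y = Suc x \<or> x = 0 \<and> y = N - 1) then 1 else 0 :: nat)" for e
  have nbrs: "\<exists>a b. a \<noteq> b \<and> a < N \<and> b < N \<and> c \<noteq> a \<and> c \<noteq> b \<and>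
    (\<forall>x<N. \<chi> {c, x} = (if x = a \<or> x = b then 1 else 0))" if c: "c < N" for c
  proof -
    have \<chi>: "\<chi> {c, x} = (if x = Suc c \<or> c = Suc x \<or> c = 0 \<and> x = N - 1 \<or> x = 0 \<and> c = N - 1 then 1 else 0)" for x
      unfolding \<chi>_def by (auto simp: doubleton_eq_iff)
    consider "c = 0" | "c = N - 1" "c \<noteq> 0" | "c \<noteq> 0" "c \<noteq> N - 1" by blast
    then show ?thesis
    proof cases
      case 1
      then show ?thesis unfolding \<chi> using N by (intro exI[of _ 1] exI[of _ "N - 1"]) auto
    next
      case 2
      then show ?thesis unfolding \<chi> using N by (intro exI[of _ 0] exI[of _ "N - 2"]) auto
    next
      case 3
      then show ?thesis unfolding \<chi> using N c by (intro exI[of _ "c - 1"] exI[of _ "Suc c"]) auto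
    qed
  qed
  show ?thesis
    unfolding N_def[symmetric]
  proof (rule not_arrowsI[OF G(1), where \<chi> = \<chi>])
    show "\<chi> e < 3" for e by (simp add: \<chi>_def)
    fix f assume f: "inj_on f (uverts G)" "f ` uverts G \<subseteq> {..<N}"
    have "f q < N" using f q by auto
    then obtain a b where ab: "a \<noteq> b" "a < N" "b < N" "f q \<noteq> a" "f q \<noteq> b"
      and \<chi>: "\<And>x. x < N \<Longrightarrow> \<chi> {f q, x} = (if x = a \<or> x = b then 1 else 0)"
      using nbrs[of "f q"] by auto
    let ?S = "{v \<in> uverts G - {q}. f v = a \<or> f v = b}"
    have "(\<Sum>e\<in>uedges G. \<chi> (f ` e)) = (\<Sum>v\<in>uverts G - {q}. \<chi> {f q, f v})"
      unfolding E using inj by (simp add: sum.reindex)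
    also have "\<dots> = (\<Sum>v\<in>uverts G - {q}. if f v = a \<or> f v = b then 1 else 0)"
      using f(2) by (intro sum.cong) (auto simp: \<chi>)
    also have "\<dots> = card ?S" using fin by (simp add: sum.inter_filter[symmetric])
    finally have sum: "(\<Sum>e\<in>uedges G. \<chi> (f ` e)) = card ?S" .
    have "card ?S \<le> card {a, b}"
      using f(1) by (intro card_inj_on_le[of f]) (auto intro: inj_on_subset)
    then have le: "card ?S \<le> 2" using ab(1) by simp
    have "?S \<noteq> {}"
    proof
      assume "?S = {}"
      then have "f ` uverts G \<subseteq> {..<N} - {a, b}" using f(2) ab by auto
      then have "card (uverts G) \<le> card ({..<N} - {a, b})"
        using f(1) by (intro card_inj_on_le[of f]) auto
      also have "\<dots> = N - 2" using ab by (simp add: card_Diff_subset)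
      finally show False using N unfolding N_def by simp
    qed
    then have "card ?S \<noteq> 0" using fin by simp
    then show "(\<Sum>e\<in>uedges G. \<chi> (f ` e)) mod 3 \<noteq> 0" using le sum by auto
  qed
qed

section \<open>Padding with isolated vertices\<close>

locale padded_forest =
  fixes F :: "'a ugraph" and g :: "'a \<Rightarrow> nat" and n N :: nat
  assumes forestF: "forest F" and g: "bij_betw g (uverts F) {..<n}" and nN: "n \<le> N"
begin

definition padded :: "nat ugraph" where
  "padded = ({..<N}, (\<lambda>e. g ` e) ` uedges F)"

lemma simpleF: "simple_graph F"
  using forestF by (simp add: forest_def)

lemma inj: "inj_on g (uverts F)" and img: "g ` uverts F = {..<n}"
  using g by (auto simp: bij_betw_def)

lemma edgeF: "e \<in> uedges F \<Longrightarrow> e \<subseteq> uverts F" "e \<in> uedges F \<Longrightarrow> card e = 2"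
  using simpleF by (auto simp: simple_graph_def)

lemma inj_edges: "inj_on ((`) g) (uedges F)"
  using inj_on_image_edges[OF simpleF inj] .

lemma uverts_padded: "uverts padded = {..<N}"
  by (simp add: padded_def)

lemma uedges_padded: "uedges padded = (\<lambda>e. g ` e) ` uedges F"
  by (simp add: padded_def)

lemma card_uedges_padded: "card (uedges padded) = card (uedges F)"
  unfolding uedges_padded using inj_edges by (rule card_image)

lemma simple_padded: "simple_graph padded"
  unfolding simple_graph_def uverts_padded uedges_padded
proof (intro conjI ballI)
  fix e assume "e \<in> (\<lambda>e. g ` e) ` uedges F"
  then obtain e' where e': "e' \<in> uedges F" "e = g ` e'" by blast
  have "e \<subseteq> {..<n}" using e' edgeF(1) img by blast
  then show "e \<subseteq> {..<N}" using nN by auto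
  show "card e = 2"
    using e' edgeF[OF e'(1)] inj by (simp add: card_image inj_on_subset)
qed simp

lemma deg_padded:
  assumes "v \<in> uverts F" shows "deg padded (g v) = deg F v"
proof -
  have "{e \<in> uedges padded. g v \<in> e} = (\<lambda>e. g ` e) ` {e \<in> uedges F. v \<in> e}"
  proof -
    have "g v \<in> g ` e \<longleftrightarrow> v \<in> e" if "e \<in> uedges F" for e
      using inj_on_image_mem_iff[OF inj assms edgeF(1)[OF that]] .
    then show ?thesis unfolding uedges_padded by auto
  qed
  then show ?thesis
    unfolding deg_def using inj_edges by (simp add: card_image inj_on_subset)
qed

lemma padded_edge_bound: "e \<in> uedges padded \<Longrightarrow> x \<in> e \<Longrightarrow> x < n"
  unfolding uedges_padded using edgeF(1) img by blast

lemma deg_padded_new: "n \<le> x \<Longrightarrow> deg padded x = 0"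
  unfolding deg_def using padded_edge_bound by (metis (no_types, lifting) card.empty empty_Collect_eq linorder_not_le)

lemma forest_padded: "forest padded"
proof -
  have "\<not> cycle_in padded c" for c
  proof
    assume c: "cycle_in padded c"
    define h where "h = inv_into (uverts F) g"
    have edge: "{c ! i, c ! (Suc i mod length c)} \<in> uedges padded" if "i < length c" for i
      using c that unfolding cycle_in_def by blast
    have sub: "set c \<subseteq> g ` uverts F"
      using padded_edge_bound[OF edge] img by (fastforce simp: in_set_conv_nth)
    have "cycle_in F (map h c)"
      unfolding cycle_in_def
    proof (intro conjI allI impI)
      show "length (map h c) \<ge> 3" using c unfolding cycle_in_def by simp
      show "distinct (map h c)"
        using c inj_on_inv_into[OF sub] unfolding cycle_in_def h_def by (simp add: distinct_map)
      show "set (map h c) \<subseteq> uverts F" using sub unfolding h_def by (auto intro: inv_into_into)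
      fix i assume i: "i < length (map h c)"
      then obtain e where e: "e \<in> uedges F" "{c ! i, c ! (Suc i mod length c)} = g ` e"
        using edge[of i] unfolding uedges_padded by auto
      have "Suc i mod length c < length c" using i by (intro mod_less_divisor) auto
      then have "{map h c ! i, map h c ! (Suc i mod length (map h c))} = h ` {c ! i, c ! (Suc i mod length c)}"
        using i by simp
      also have "\<dots> = e" unfolding e(2) h_def using edgeF(1)[OF e(1)] inj by (rule inv_into_image_cancel[rotated])
      finally show "{map h c ! i, map h c ! (Suc i mod length (map h c))} \<in> uedges F" using e(1) by simp
    qed
    then show False using forestF unfolding forest_def by blast
  qed
  then show ?thesis using simple_padded unfolding forest_def by blast
qed

text \<open>A permutation of the host composed with the numbering \<open>g\<close> is an embedding
  of \<open>F\<close>, so a bad colouring reduced modulo 3 admits no permutation of sum 0.\<close>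

lemma zero_sum_free_if_not_arrows:
  assumes "\<not> zero_sum_arrows N F 3"
  obtains C where "zero_sum_free_forest padded C"
proof -
  obtain \<chi> :: "nat set \<Rightarrow> nat" where no: "\<And>H. subgraph H (complete_graph N) \<Longrightarrow> isomorphic F H \<Longrightarrow> (\<Sum>e\<in>uedges H. \<chi> e) mod 3 \<noteq> 0"
    using assms unfolding zero_sum_arrows_def by (metis (no_types, lifting))
  define C :: "nat set \<Rightarrow> z3" where "C e = of_nat (\<chi> e)" for e
  interpret S: spanning_colouring padded C by unfold_locales (rule simple_padded)
  have "S.csum \<phi> \<noteq> 0" if \<phi>: "bij_betw \<phi> {..<N} {..<N}" for \<phi>
  proof
    assume zero: "S.csum \<phi> = 0"
    define f where "f = \<phi> \<circ> g"
    define H where "H = (f ` uverts F, (\<lambda>e. f ` e) ` uedges F)"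
    have "inj_on \<phi> (g ` uverts F)"
      using \<phi> img nN unfolding bij_betw_def by (auto intro: inj_on_subset)
    then have injf: "inj_on f (uverts F)" unfolding f_def by (rule comp_inj_on[OF inj])
    have sub: "f ` uverts F \<subseteq> {..<N}"
      using \<phi> img nN unfolding f_def bij_betw_def by (auto simp flip: image_image)
    have card2: "card (f ` e) = 2" if "e \<in> uedges F" for e
      using injf edgeF[OF that] by (simp add: card_image inj_on_subset)
    have "simple_graph H"
      unfolding simple_graph_def H_def using simpleF edgeF(1) card2
      by (auto simp: simple_graph_def)
    moreover have "uedges H \<subseteq> uedges (complete_graph N)"
      unfolding H_def complete_graph_def using edgeF(1) sub card2 by auto
    ultimately have "subgraph H (complete_graph N)"
      using sub unfolding subgraph_def by (simp add: H_def complete_graph_def)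
    moreover have "isomorphic F H"
      unfolding isomorphic_def H_def using injf by (intro exI[of _ f]) (simp add: bij_betw_def)
    ultimately have "(\<Sum>e\<in>uedges H. \<chi> e) mod 3 \<noteq> 0" by (rule no)
    moreover have "of_nat (\<Sum>e\<in>uedges H. \<chi> e) = S.csum \<phi>"
    proof -
      have "of_nat (\<Sum>e\<in>uedges H. \<chi> e) = (\<Sum>e\<in>uedges F. C (f ` e))"
        unfolding H_def using inj_on_image_edges[OF simpleF injf]
        by (simp add: sum.reindex C_def)
      also have "\<dots> = S.csum \<phi>"
        unfolding S.csum_def uedges_padded f_def using inj_edges
        by (simp add: sum.reindex image_comp)
      finally show ?thesis .
    qed
    ultimately show False using zero of_nat_z3_eq_0_iff[of "\<Sum>e\<in>uedges H. \<chi> e"] by (simp add: dvd_eq_mod_eq_0)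
  qed
  then have "zero_sum_free_forest padded C"
    using forest_padded by unfold_locales (auto simp: uverts_padded)
  then show ?thesis using that by blast
qed

lemma padded_not_star:
  assumes "\<And>q. \<exists>e\<in>uedges F. q \<notin> e"
  shows "\<exists>e\<in>uedges padded. x \<notin> e"
proof (cases "x \<in> g ` uverts F")
  case True
  then obtain q where q: "q \<in> uverts F" "x = g q" by blast
  obtain e where e: "e \<in> uedges F" "q \<notin> e" using assms by blast
  then have "x \<notin> g ` e" using inj_on_image_mem_iff[OF inj q(1) edgeF(1)[OF e(1)]] q by simp
  then show ?thesis using e(1) unfolding uedges_padded by blast
next
  case False
  obtain e where "e \<in> uedges F" using assms by blast
  then have "x \<notin> g ` e" using False edgeF(1) by blast
  then show ?thesis using \<open>e \<in> uedges F\<close> unfolding uedges_padded by blast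
qed

lemma new_isolated:
  assumes "n \<le> z" shows "spanning_colouring.isolated padded z"
proof -
  interpret spanning_colouring padded by unfold_locales (rule simple_padded)
  show ?thesis unfolding isolated_def using padded_edge_bound[of _ z] assms by force
qed

end

section \<open>Upper bounds and the theorem\<close>

lemma arrows_core:
  fixes F :: "'a ugraph"
  assumes F: "forest F" and dvd: "3 dvd card (uedges F)" and ns: "\<And>q. \<exists>e\<in>uedges F. q \<notin> e"
    and fx: "fx \<in> uverts F" "deg F fx mod 3 \<noteq> 1" "deg F fx \<ge> 2"
  shows "zero_sum_arrows (Suc (card (uverts F))) F 3"
    and "f0 \<in> uverts F \<Longrightarrow> deg F f0 mod 3 = 0 \<Longrightarrow> f0 \<noteq> fx \<Longrightarrow> zero_sum_arrows (card (uverts F)) F 3"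
proof -
  let ?n = "card (uverts F)"
  have "finite (uverts F)" using F by (simp add: forest_def simple_graph_def)
  then obtain g where g: "bij_betw g (uverts F) {..<?n}"
    using ex_bij_betw_finite_nat[of "uverts F"] by (auto simp: atLeast0LessThan)
  show "zero_sum_arrows (Suc ?n) F 3"
  proof (rule ccontr)
    interpret P: padded_forest F g ?n "Suc ?n" by unfold_locales (use F g in auto)
    assume "\<not> ?thesis"
    then obtain C where "zero_sum_free_forest P.padded C" by (rule P.zero_sum_free_if_not_arrows)
    then interpret Z: zero_sum_free_forest P.padded C .
    have "g fx < ?n" using P.img fx(1) by auto
    then show False
      \<comment> \<open>The added vertex \<open>?n\<close> is isolated and plays the role of
        \<open>f0\<close>.\<close>
      using Z.no_zero_sum_free_forest[of ?n "g fx"] P.padded_not_star[OF ns] dvd fx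
      by (simp add: P.card_uedges_padded P.uverts_padded P.deg_padded P.deg_padded_new)
  qed
  assume f0: "f0 \<in> uverts F" "deg F f0 mod 3 = 0" "f0 \<noteq> fx"
  show "zero_sum_arrows ?n F 3"
  proof (rule ccontr)
    interpret P: padded_forest F g ?n ?n by unfold_locales (use F g in auto)
    assume "\<not> ?thesis"
    then obtain C where "zero_sum_free_forest P.padded C" by (rule P.zero_sum_free_if_not_arrows)
    then interpret Z: zero_sum_free_forest P.padded C .
    have "g fx < ?n" "g f0 < ?n" "g fx \<noteq> g f0"
      using P.img fx(1) f0 inj_on_eq_iff[OF P.inj fx(1) f0(1)] by auto
    then show False
      using Z.no_zero_sum_free_forest[of "g f0" "g fx"] P.padded_not_star[OF ns] dvd fx f0
      by (simp add: P.card_uedges_padded P.uverts_padded P.deg_padded)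
  qed
qed

lemma arrows_star:
  fixes F :: "'a ugraph"
  assumes F: "forest F" "is_star F" and dvd: "3 dvd card (uedges F)"
  shows "zero_sum_arrows (Suc (Suc (card (uverts F)))) F 3"
proof (rule ccontr)
  let ?n = "card (uverts F)"
  assume na: "\<not> ?thesis"
  have fin: "finite (uverts F)" using F by (simp add: forest_def simple_graph_def)
  then obtain g where g: "bij_betw g (uverts F) {..<?n}"
    using ex_bij_betw_finite_nat[of "uverts F"] by (auto simp: atLeast0LessThan)
  interpret P: padded_forest F g ?n "Suc (Suc ?n)" by unfold_locales (use F g in auto)
  obtain C where "zero_sum_free_forest P.padded C"
    using na by (rule P.zero_sum_free_if_not_arrows)
  then interpret Z: zero_sum_free_forest P.padded C .
  obtain q where q: "q \<in> uverts F" and E: "uedges F = (\<lambda>v. {q, v}) ` (uverts F - {q})"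
    and card2: "card (uverts F) \<ge> 2" using is_starE[OF F(2)] .
  have "inj_on (\<lambda>v. {q, v}) (uverts F - {q})" by (auto simp: inj_on_def doubleton_eq_iff)
  then have "card (uedges F) = ?n - 1" unfolding E using q fin by (simp add: card_image)
  then have "3 \<le> ?n - 1" using dvd card2 dvd_imp_le[of 3 "?n - 1"] by simp
  then have n4: "?n \<ge> 4" by linarith
  then obtain l where l: "l \<in> uverts F" "l \<notin> set [q]"
    using ex_not_in_list[of "uverts F" "[q]"] fin by auto
  obtain l' where l': "l' \<in> uverts F" "l' \<notin> set [q, l]"
    using ex_not_in_list[of "uverts F" "[q, l]"] fin n4 by auto
  have EP: "uedges P.padded = (\<lambda>v. {g q, g v}) ` (uverts F - {q})"
    unfolding P.uedges_padded E by (simp add: image_image)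
  have leaf: "Z.leaf_at (g v) (g q)" if v: "v \<in> uverts F" "v \<noteq> q" for v
    unfolding Z.leaf_at_def
  proof (intro allI iffI)
    fix x assume "{g v, x} \<in> uedges P.padded"
    then obtain u where "u \<in> uverts F" "{g v, x} = {g q, g u}" unfolding EP by blast
    moreover have "g v \<noteq> g q" using inj_on_eq_iff[OF P.inj v(1) q] v(2) by simp
    ultimately show "x = g q" by (auto simp: doubleton_eq_iff)
  next
    fix x assume "x = g q"
    then show "{g v, x} \<in> uedges P.padded" unfolding EP using v by (auto simp: insert_commute)
  qed
  show False
  proof (rule Z.not_star_plus_two[of "g q" "g l" "g l'" ?n "Suc ?n"])
    show "3 dvd card (uedges P.padded)" using dvd by (simp add: P.card_uedges_padded)
    show "\<And>e. e \<in> uedges P.padded \<Longrightarrow> g q \<in> e" unfolding EP by auto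
    show "g l \<noteq> g l'" using inj_on_eq_iff[OF P.inj l(1) l'(1)] l' by auto
  qed (use leaf l l' P.new_isolated in \<open>auto simp: P.uverts_padded\<close>)
qed

text \<open>Regularity gives a degree sum congruent to the number of vertices, and that sum is twice
  a multiple of 3. So the number of vertices is a multiple of 3 and at least 4, hence at least 6,
  and padding yields the eight vertices needed for disjoint cherries.\<close>

lemma arrows_one_mod_3_regular:
  fixes F :: "'a ugraph"
  assumes F: "forest F" "one_mod_3_regular F" and ns: "\<And>q. \<exists>e\<in>uedges F. q \<notin> e"
    and dvd: "3 dvd card (uedges F)"
  shows "zero_sum_arrows (Suc (Suc (card (uverts F)))) F 3"
proof (rule ccontr)
  let ?n = "card (uverts F)"
  assume na: "\<not> ?thesis"
  have fin: "finite (uverts F)" using F by (simp add: forest_def simple_graph_def)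
  then obtain g where g: "bij_betw g (uverts F) {..<?n}"
    using ex_bij_betw_finite_nat[of "uverts F"] by (auto simp: atLeast0LessThan)
  interpret P: padded_forest F g ?n "Suc (Suc ?n)" by unfold_locales (use F g in auto)
  obtain C where "zero_sum_free_forest P.padded C"
    using na by (rule P.zero_sum_free_if_not_arrows)
  then interpret Z: zero_sum_free_forest P.padded C .
  have ns': "\<exists>e\<in>uedges P.padded. x \<notin> e" for x using P.padded_not_star[OF ns] .
  obtain l1 p1 where l1: "Z.leaf_at l1 p1"
    using Z.sub_leaf[of "uedges P.padded" undefined] ns' unfolding Z.leaf_at_def by (metis order_refl empty_iff)
  obtain l2 p2 where lp: "Z.leaf_pair l1 p1 l2 p2" using Z.ex_leaf_pair[OF l1] ns' by blast
  have l2: "Z.leaf_at l2 p2" using lp unfolding Z.leaf_pair_def by blast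
  have "{l1, p1} \<in> uedges P.padded" "{l2, p2} \<in> uedges P.padded"
    using l1 l2 unfolding Z.leaf_at_def by blast+
  then have "{p1, p2, l1, l2} \<subseteq> {..<?n}" using P.padded_edge_bound by blast
  then have n4: "?n \<ge> 4" using length_le_card[of "{..<?n}" "[p1, p2, l1, l2]"] Z.leaf_pair_distinct(1)[OF lp] by auto
  have "(\<Sum>v\<in>uverts F. deg F v) = 2 * card (uedges F)"
  proof -
    interpret S: spanning_colouring F by unfold_locales (rule P.simpleF)
    show ?thesis by (rule S.deg_sum)
  qed
  moreover have "(\<Sum>v\<in>uverts F. deg F v) mod 3 = (\<Sum>v\<in>uverts F. deg F v mod 3) mod 3"
    by (rule mod_sum_eq[symmetric])
  moreover have "(\<Sum>v\<in>uverts F. deg F v mod 3) = ?n"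
    using F(2) unfolding one_mod_3_regular_def by simp
  ultimately have "?n mod 3 = 0" using dvd by (metis dvd_imp_mod_0 dvd_mult)
  then have n6: "?n \<ge> 6" using n4 by presburger
  show False
  proof (rule Z.not_two_leaves_plus_two[of l1 p1 l2 p2 ?n "Suc ?n"])
    show "3 dvd card (uedges P.padded)" using dvd by (simp add: P.card_uedges_padded)
  qed (use n6 lp P.new_isolated in \<open>auto simp: P.uverts_padded Z.leaf_pair_def\<close>)
qed

theorem theorem1p2:
  fixes F :: "'a ugraph" and n :: nat
  assumes "forest F"
    and "uverts F \<noteq> {}"
    and "card (uverts F) = n"
    and "3 dvd card (uedges F)"
    and "\<forall>v \<in> uverts F. deg F v \<noteq> 0"
  shows "zero_sum_ramsey F 3 =
    (if one_mod_3_regular F \<or> is_star F then n + 2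
     else if (\<forall>v \<in> uverts F. \<not> 3 dvd deg F v) \<or>
             (\<exists>v \<in> uverts F. deg F v mod 3 = 0 \<and>
                (\<forall>u \<in> uverts F - {v}. deg F u mod 3 = 1)) then n + 1
     else n)"
proof -
  have simple: "simple_graph F" using assms(1) by (simp add: forest_def)
  then have fin: "finite (uverts F)" by (simp add: simple_graph_def)
  have npos: "n \<ge> 1" using assms(2,3) fin by (metis One_nat_def Suc_leI card_gt_0_iff)
  have ns: "\<exists>e\<in>uedges F. q \<notin> e" if "\<not> is_star F" for q
    using is_starI[OF simple assms(2), of q] assms(5) that by blast
  have big: "deg F v \<ge> 2" if "v \<in> uverts F" "deg F v mod 3 \<noteq> 1" for v
  proof -
    have "deg F v \<noteq> 0" "deg F v \<noteq> 1" using that assms(5) by auto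
    then show ?thesis by linarith
  qed
  consider (star) "is_star F" | (regular) "one_mod_3_regular F" "\<not> is_star F"
    | (mid) "\<not> one_mod_3_regular F" "\<not> is_star F" "(\<forall>v \<in> uverts F. \<not> 3 dvd deg F v) \<or>
             (\<exists>v \<in> uverts F. deg F v mod 3 = 0 \<and> (\<forall>u \<in> uverts F - {v}. deg F u mod 3 = 1))"
    | (low) "\<not> one_mod_3_regular F" "\<not> is_star F" "\<not> ((\<forall>v \<in> uverts F. \<not> 3 dvd deg F v) \<or>
             (\<exists>v \<in> uverts F. deg F v mod 3 = 0 \<and> (\<forall>u \<in> uverts F - {v}. deg F u mod 3 = 1)))"
    by blast
  then show ?thesis
  proof cases
    case star
    have "zero_sum_ramsey F 3 = Suc (Suc n)"
      using arrows_star[OF assms(1) star assms(4)] not_arrows_star[OF simple star assms(4)] assms(3)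
      by (intro zero_sum_ramsey_eqI) auto
    then show ?thesis using star by simp
  next
    case regular
    have "zero_sum_ramsey F 3 = Suc (Suc n)"
      using arrows_one_mod_3_regular[OF assms(1) regular(1) ns[OF regular(2)] assms(4)]
        not_arrows_one_mod_3_regular[OF simple assms(2) regular(1)] assms(3)
      by (intro zero_sum_ramsey_eqI) auto
    then show ?thesis using regular by simp
  next
    case mid
    obtain fx where fx: "fx \<in> uverts F" "deg F fx mod 3 \<noteq> 1"
      using mid(1) unfolding one_mod_3_regular_def by blast
    have up: "zero_sum_arrows (Suc n) F 3"
      using arrows_core(1)[OF assms(1,4) ns[OF mid(2)] fx big[OF fx]] assms(3) by simp
    have "\<not> zero_sum_arrows n F 3"
      using mid(3)
    proof
      assume "\<forall>v\<in>uverts F. \<not> 3 dvd deg F v"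
      then show ?thesis using not_arrows_no_zero_degree[OF simple assms(2)] assms(3) by blast
    next
      assume "\<exists>v \<in> uverts F. deg F v mod 3 = 0 \<and> (\<forall>u \<in> uverts F - {v}. deg F u mod 3 = 1)"
      then obtain v where v: "v \<in> uverts F" "deg F v mod 3 = 0" "\<forall>u \<in> uverts F - {v}. deg F u mod 3 = 1"
        by (elim bexE conjE)
      obtain e where "e \<in> uedges F" using ns[OF mid(2)] by blast
      then have "e \<subseteq> uverts F" "card e = 2" using simple by (auto simp: simple_graph_def)
      then have "card (uverts F) \<ge> 2" using card_mono[OF fin] by metis
      then show ?thesis
        using not_arrows_one_zero_degree[OF simple _ v(1,2) bspec[OF v(3)]] assms(3) by blast
    qed
    then have "zero_sum_ramsey F 3 = Suc n" using up by (intro zero_sum_ramsey_eqI)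
    then show ?thesis using mid by simp
  next
    case low
    then obtain f0 where f0: "f0 \<in> uverts F" "deg F f0 mod 3 = 0" by (auto simp: dvd_eq_mod_eq_0)
    have "\<not> (\<forall>u \<in> uverts F - {f0}. deg F u mod 3 = 1)" using low(3) f0 by metis
    then obtain fx where fx: "fx \<in> uverts F" "deg F fx mod 3 \<noteq> 1" "f0 \<noteq> fx" by auto
    have "zero_sum_arrows n F 3"
      using arrows_core(2)[OF assms(1,4) ns[OF low(2)] fx(1,2) big[OF fx(1,2)] f0 fx(3)] assms(3) by simp
    \<comment> \<open>A host with \<open>n - 1\<close> vertices contains no copy at all.\<close>
    moreover have "\<not> zero_sum_arrows (n - 1) F 3"
      using npos assms(3) by (intro not_arrows_less_card[OF simple]) auto
    ultimately have "zero_sum_ramsey F 3 = n"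
      using zero_sum_ramsey_eqI[of "n - 1" F 3] npos by simp
    then show ?thesis using low by simp
  qed
qed

end
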